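(* Let $\varphi\in\mathcal{Q}_0$ and, for $\ell$ large, $\ell_\varphi=\ell-s_\varphi-1$. Then $$\limsup_{\ell\to\infty}\,(2\ell)^{-1}\,\mathbb{E}^\star_1\Big[(-\mathcal{S}_{\Lambda_\ell})^{-1}\sum_{|x|\le\ell_\varphi}\tau_x\varphi,\ \sum_{|x|\le\ell_\varphi}\tau_x\varphi\Big]\le|||\varphi|||_1^2 .$$
   Context: Fix $\lambda>0$, $\gamma>0$ and $C>1$. The disorder $\mathbf m=\{m_x\}_{x\in\mathbb{Z}}$ is i.i.d. with values in $[C^{-1},C]$; its law on $\Omega^{\mathcal D}=[C^{-1},C]^{\mathbb{Z}}$ is $\mathbb{P}$. $\mu_1$ is the product of standard Gaussian laws on $\Omega=\mathbb{R}^{\mathbb{Z}}$; $\mathbb{E}^\star_1$ is expectation under $\mathbb{P}\otimes\mu_1$ and $\mathbb{E}^\star_1[f,g]=\mathbb{E}^\star_1[fg]$; $\chi(1)=2$. $\omega^x$ is obtained from $\omega$ by changing $\omega_x$ into $-\omega_x$, and $\omega^{x,x+1}$ by exchanging $\omega_x$ and $\omega_{x+1}$; $(\nabla_xf)(\mathbf m,\omega)=f(\mathbf m,\omega^x)-f(\mathbf m,\omega)$, $(\nabla_{x,x+1}f)(\mathbf m,\omega)=f(\mathbf m,\omega^{x,x+1})-f(\mathbf m,\omega)$. Translations: $(\tau_xf)(\mathbf m,\omega)=f(\tau_x\mathbf m,\tau_x\omega)$, $(\tau_x\mathbf m)_z=m_{x+z}$, $(\tau_x\omega)_z=\omega_{x+z}$.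 $\Lambda_\ell=\{-\ell,\dots,\ell\}$. A cylinder function $f$ depends on finitely many coordinates $(m_x,\omega_x)$; $s_f$ is the smallest positive integer $s$ such that $f$ depends only on coordinates in $\Lambda_s$. For a cylinder function $f$, $\Gamma_f=\sum_{x\in\mathbb{Z}}\tau_xf$ is a formal sum, of which only the gradients $\nabla_0\Gamma_f,\nabla_{0,1}\Gamma_f$ (finite sums) are used. $\mathcal{S}_{\Lambda_\ell}=\gamma\sum_{x\in\Lambda_\ell}\nabla_x+\lambda\sum_{x\in\Lambda_\ell\setminus\{\ell\}}\nabla_{x,x+1}$, with Dirichlet form $$\mathcal{D}_\ell(h)=\mathbb{E}^\star_1[h,-\mathcal{S}_{\Lambda_\ell}h]=\frac\gamma2\sum_{x\in\Lambda_\ell}\mathbb{E}^\star_1[(\nabla_xh)^2]+\frac\lambda2\sum_{x\in\Lambda_\ell\setminus\{\ell\}}\mathbb{E}^\star_1[(\nabla_{x,x+1}h)^2].$$ The function $\Phi=\sum_{|x|\le\ell_\varphi}\tau_x\varphi$ is in the range of $\mathcal{S}_{\Lambda_\ell}$, and $\mathbb{E}^\star_1[(-\mathcal{S}_{\Lambda_\ell})^{-1}\Phi,\Phi]=\sup_h\{2\mathbb{E}^\star_1[\Phi,h]-\mathcal{D}_\ell(h)\}$, the supremum being over cylinder functions $h$ continuous in $\mathbf m$, and in $\mathbf L^2(\mu_1)$ with zero $\mu_1$-mean for each $\mathbf m$. $\mathcal{Q}$: functions $f(\mathbf m,\omega)=\sum_{i\in\mathbb{Z}}\psi_{i,i}(\mathbf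 m)(\omega_{i+1}^2-\omega_i^2)+\sum_{i\ne j}\psi_{i,j}(\mathbf m)\omega_i\omega_j$, where each $\psi_{i,j}=\psi_{j,i}$ is a continuous cylinder function on $\Omega^{\mathcal D}$ and all but finitely many vanish. $\mathcal{Q}_0$: functions $\varphi=\sum_{x\in\Lambda}\{\nabla_xF_x+\nabla_{x,x+1}G_x\}$ with $\Lambda\subset\mathbb{Z}$ finite and $F_x,G_x$ measurable cylinder functions, continuous in $\mathbf m$ for each $\omega$, in $\mathbf L^2(\mu_1)$ for each $\mathbf m$, and homogeneous polynomials of degree two in $\omega$. Set $\ll g,h\gg_{1,\star}=\sum_{x\in\mathbb{Z}}\mathbb{E}^\star_1[g\,\tau_xh]$ and $\ll g\gg_{1,\star\star}=\sum_{x\in\mathbb{Z}}x\,\mathbb{E}^\star_1[g\,\omega_x^2]$. For $\varphi\in\mathcal{Q}_0$, $$|||\varphi|||_1^2=\sup_{g\in\mathcal{Q}}\Big\{2\ll\varphi,g\gg_{1,\star}-\frac\gamma2\mathbb{E}^\star_1[(\nabla_0\Gamma_g)^2]-\frac\lambda2\mathbb{E}^\star_1[(\nabla_{0,1}\Gamma_g)^2]\Big\}+\frac1{\lambda\chi(1)}\ll\varphi\gg_{1,\star\star}^2.$$ *)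

theory Defs
  imports "HOL-Probability.Probability"
begin

type_synonym config = "int \<Rightarrow> real"

text \<open>
  An observable takes the disorder first and the configuration second.  Observables are total
  functions, but only their values at disorders in \<open>disorder_set C\<close> matter.
\<close>

type_synonym observable = "config \<Rightarrow> config \<Rightarrow> real"

definition disorder_set :: "real \<Rightarrow> config set" where
  "disorder_set C = {m. \<forall>x. m x \<in> {1 / C..C}}"

text \<open>
  The law \<open>\<nu>\<close> of a single \<open>m\<^sub>x\<close> is a probability measure on the interval itself (as a subspace
  of the Borel line), so that the space of \<open>disorder_law \<nu>\<close> is exactly \<open>disorder_set C\<close>.
\<close>

definition site_law :: "real \<Rightarrow> real measure \<Rightarrow> bool" where
  "site_law C \<nu> \<longleftrightarrow> prob_space \<nu> \<and> sets \<nu> = sets (restrict_space borel {1 / C..C})"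

definition disorder_law :: "real measure \<Rightarrow> config measure" where
  "disorder_law \<nu> = PiM UNIV (\<lambda>_. \<nu>)"

definition gauss_law :: "config measure" where
  "gauss_law = PiM UNIV (\<lambda>_. density lborel std_normal_density)"

definition joint_law :: "real measure \<Rightarrow> (config \<times> config) measure" where
  "joint_law \<nu> = disorder_law \<nu> \<Otimes>\<^sub>M gauss_law"

definition E_star :: "real measure \<Rightarrow> observable \<Rightarrow> real" where
  "E_star \<nu> f = (LINT z|joint_law \<nu>. f (fst z) (snd z))"

definition chi_1 :: real where
  "chi_1 = 2"


definition flip :: "int \<Rightarrow> config \<Rightarrow> config" where
  "flip x \<omega> = (\<lambda>z. if z = x then - \<omega> x else \<omega> z)"

definition exchange :: "int \<Rightarrow> config \<Rightarrow> config" where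
  "exchange x \<omega> =
    (\<lambda>z. if z = x then \<omega> (x + 1) else if z = x + 1 then \<omega> x else \<omega> z)"

definition grad_flip :: "int \<Rightarrow> observable \<Rightarrow> observable" where
  "grad_flip x f m \<omega> = f m (flip x \<omega>) - f m \<omega>"

definition grad_exch :: "int \<Rightarrow> observable \<Rightarrow> observable" where
  "grad_exch x f m \<omega> = f m (exchange x \<omega>) - f m \<omega>"

definition shift :: "int \<Rightarrow> config \<Rightarrow> config" where
  "shift x \<omega> z = \<omega> (x + z)"

definition translate :: "int \<Rightarrow> observable \<Rightarrow> observable" where
  "translate x f m \<omega> = f (shift x m) (shift x \<omega>)"

definition box :: "nat \<Rightarrow> int set" where
  "box l = {- int l..int l}"


definition depends_only_on :: "real \<Rightarrow> observable \<Rightarrow> int set \<Rightarrow> bool" where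
  "depends_only_on C f A \<longleftrightarrow>
    (\<forall>m\<in>disorder_set C. \<forall>m'\<in>disorder_set C. \<forall>\<omega> \<omega>'.
      (\<forall>x\<in>A. m x = m' x \<and> \<omega> x = \<omega>' x) \<longrightarrow> f m \<omega> = f m' \<omega>')"

definition cylinder :: "real \<Rightarrow> observable \<Rightarrow> bool" where
  "cylinder C f \<longleftrightarrow> (\<exists>A. finite A \<and> depends_only_on C f A)"

definition cyl_radius :: "real \<Rightarrow> observable \<Rightarrow> nat" where
  "cyl_radius C f = (LEAST s. 0 < s \<and> depends_only_on C f (box s))"

definition sq_integrable :: "'a measure \<Rightarrow> ('a \<Rightarrow> real) \<Rightarrow> bool" where
  "sq_integrable M f \<longleftrightarrow> f \<in> borel_measurable M \<and> integrable M (\<lambda>z. (f z)\<^sup>2)"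


definition generator :: "real \<Rightarrow> real \<Rightarrow> nat \<Rightarrow> observable \<Rightarrow> observable" where
  "generator \<gamma> lam l f m \<omega> =
     \<gamma> * (\<Sum>x\<in>box l. grad_flip x f m \<omega>)
   + lam * (\<Sum>x\<in>box l - {int l}. grad_exch x f m \<omega>)"

text \<open>
  The generator is a bounded self-adjoint operator on \<open>L\<^sup>2\<close> of \<open>joint_law \<nu>\<close> with a nontrivial
  kernel, so a preimage of \<open>\<Phi>\<close> under minus the generator is only determined up to that kernel.
  The kernel is orthogonal to the range, hence the pairing of any preimage with a \<open>\<Phi>\<close> in the
  range does not depend on the preimage selected.
\<close>

definition neg_generator_inv ::
    "real measure \<Rightarrow> real \<Rightarrow> real \<Rightarrow> nat \<Rightarrow> observable \<Rightarrow> observable" where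
  "neg_generator_inv \<nu> \<gamma> lam l \<Phi> =
    (SOME h. sq_integrable (joint_law \<nu>) (\<lambda>(m, \<omega>). h m \<omega>) \<and>
             (AE (m, \<omega>) in joint_law \<nu>. - generator \<gamma> lam l h m \<omega> = \<Phi> m \<omega>))"

text \<open>
  The index ranges over integers: the sum is empty when \<open>r\<close> is negative.
\<close>

definition translate_sum :: "int \<Rightarrow> observable \<Rightarrow> observable" where
  "translate_sum r f m \<omega> = (\<Sum>x\<in>{- r..r}. translate x f m \<omega>)"


definition class_Q :: "real \<Rightarrow> observable set" where
  "class_Q C = {f. \<exists>\<psi> :: int \<Rightarrow> int \<Rightarrow> config \<Rightarrow> real.
     (\<forall>i j. \<psi> i j = \<psi> j i) \<and>
     (\<forall>i j. continuous_on (disorder_set C) (\<psi> i j) \<and> cylinder C (\<lambda>m _. \<psi> i j m)) \<and>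
     finite {(i, j). \<exists>m\<in>disorder_set C. \<psi> i j m \<noteq> 0} \<and>
     (\<forall>m\<in>disorder_set C. \<forall>\<omega>. f m \<omega> =
        (\<Sum>\<^sub>\<infinity>i. \<psi> i i m * ((\<omega> (i + 1))\<^sup>2 - (\<omega> i)\<^sup>2))
      + (\<Sum>\<^sub>\<infinity>(i, j)\<in>{(i, j). i \<noteq> j}. \<psi> i j m * \<omega> i * \<omega> j))}"

definition homogeneous_quadratic :: "(config \<Rightarrow> real) \<Rightarrow> bool" where
  "homogeneous_quadratic p \<longleftrightarrow>
    (\<exists>A a. finite A \<and> (\<forall>\<omega>. p \<omega> = (\<Sum>i\<in>A. \<Sum>j\<in>A. a i j * \<omega> i * \<omega> j)))"

definition quadratic_potential :: "real \<Rightarrow> real measure \<Rightarrow> observable \<Rightarrow> bool" where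
  "quadratic_potential C \<nu> F \<longleftrightarrow>
     (\<lambda>(m, \<omega>). F m \<omega>) \<in> borel_measurable (joint_law \<nu>) \<and>
     cylinder C F \<and>
     (\<forall>\<omega>. continuous_on (disorder_set C) (\<lambda>m. F m \<omega>)) \<and>
     (\<forall>m\<in>disorder_set C. sq_integrable gauss_law (F m)) \<and>
     (\<forall>m\<in>disorder_set C. homogeneous_quadratic (F m))"

definition class_Q0 :: "real \<Rightarrow> real measure \<Rightarrow> observable set" where
  "class_Q0 C \<nu> = {\<phi>. \<exists>\<Lambda> F G. finite \<Lambda> \<and>
     (\<forall>x\<in>\<Lambda>. quadratic_potential C \<nu> (F x) \<and> quadratic_potential C \<nu> (G x)) \<and>
     (\<forall>m\<in>disorder_set C. \<forall>\<omega>.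
        \<phi> m \<omega> = (\<Sum>x\<in>\<Lambda>. grad_flip x (F x) m \<omega> + grad_exch x (G x) m \<omega>))}"


text \<open>
  In the infinite sums below, for the observables to which they are applied, all but finitely
  many terms vanish.
\<close>

definition grad_flip_Gamma :: "observable \<Rightarrow> observable" where
  "grad_flip_Gamma f m \<omega> = (\<Sum>\<^sub>\<infinity>x. grad_flip 0 (translate x f) m \<omega>)"

definition grad_exch_Gamma :: "observable \<Rightarrow> observable" where
  "grad_exch_Gamma f m \<omega> = (\<Sum>\<^sub>\<infinity>x. grad_exch 0 (translate x f) m \<omega>)"

definition pairing_star :: "real measure \<Rightarrow> observable \<Rightarrow> observable \<Rightarrow> real" where
  "pairing_star \<nu> g h = (\<Sum>\<^sub>\<infinity>x. E_star \<nu> (\<lambda>m \<omega>. g m \<omega> * translate x h m \<omega>))"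

definition bracket_star_star :: "real measure \<Rightarrow> observable \<Rightarrow> real" where
  "bracket_star_star \<nu> g =
     (\<Sum>\<^sub>\<infinity>x. real_of_int x * E_star \<nu> (\<lambda>m \<omega>. g m \<omega> * (\<omega> x)\<^sup>2))"

definition triple_norm_sq ::
    "real \<Rightarrow> real measure \<Rightarrow> real \<Rightarrow> real \<Rightarrow> observable \<Rightarrow> ereal" where
  "triple_norm_sq C \<nu> \<gamma> lam \<phi> =
     (SUP g\<in>class_Q C. ereal
        (2 * pairing_star \<nu> \<phi> g
         - \<gamma> / 2 * E_star \<nu> (\<lambda>m \<omega>. (grad_flip_Gamma g m \<omega>)\<^sup>2)
         - lam / 2 * E_star \<nu> (\<lambda>m \<omega>. (grad_exch_Gamma g m \<omega>)\<^sup>2)))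
   + ereal (1 / (lam * chi_1) * (bracket_star_star \<nu> \<phi>)\<^sup>2)"

end

theory Submission
  imports Defs
begin

text \<open>
  Everything happens on quadratic forms.  A function of \<open>class_Q0\<close> is
  \<open>\<phi> m \<omega> = (\<Sum>i j. \<alpha> m i j * \<omega> i * \<omega> j)\<close> with a symmetric, local, continuous coefficient matrix
  whose trace vanishes, because flips leave the diagonal coefficients alone and exchanges only
  permute them.  By Wick's formula, two forms of which one has trace zero have Gaussian covariance
  twice the scalar product of their matrices, so every expectation in the statement becomes a
  disorder average, written \<open>\<langle>\<cdot>\<rangle>\<close>, of such a scalar product.  Minus the generator acts on matrices as
  \<open>c i j \<mapsto> 4 * \<gamma> * of_bool (i \<noteq> j) * c i j + lam * (\<Sum>x. c i j - c (\<sigma>\<^sub>x i) (\<sigma>\<^sub>x j))\<close>, where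
  \<open>\<sigma>\<^sub>x\<close> exchanges \<open>x\<close> and \<open>x + 1\<close>.  Diagonal and off-diagonal entries do not interact, and the two
  parts are treated by different means.

  On the diagonal the problem is one-dimensional and explicitly solvable.  With \<open>b\<close> the discrete
  primitive of the diagonal coefficients and \<open>B m = (\<Sum>i. b (\<tau>\<^sub>-\<^sub>i m) i)\<close>, the resolvent of the box
  contributes \<open>2 / lam\<close> times the sum over the sites of the second moments of a current that equals
  \<open>B \<circ> \<tau>\<^sub>y\<close> at all sites \<open>y\<close> but a bounded number; the contribution per site tends to
  \<open>2 / lam * \<langle>B\<^sup>2\<rangle>\<close>.  For the norm, a test function \<open>\<Psi> m * (\<omega>\<^sub>1\<^sup>2 - \<omega>\<^sub>0\<^sup>2)\<close> enters only through
  the discrete Laplacian of \<open>\<Psi>\<close> along the translations, and \<open>\<Psi>\<close> can be chosen with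
  \<open>- \<Delta>\<Psi> = (B - avg) / lam\<close>, where \<open>avg\<close> is the mean of \<open>B\<close> over \<open>2 * N + 1\<close> translations.  Its value
  is \<open>2 / lam * (\<langle>B\<^sup>2\<rangle> - \<langle>avg\<^sup>2\<rangle>)\<close>.  As the disorder is independent, \<open>\<langle>avg\<^sup>2\<rangle>\<close> tends to \<open>\<langle>B\<rangle>\<^sup>2\<close>, and
  this missing amount is exactly the last term of the norm, because \<open>\<ll>\<phi>\<gg>\<^sub>\<star>\<^sub>\<star> = 2 * \<langle>B\<rangle>\<close>.

  Off the diagonal the killing term \<open>4 * \<gamma>\<close> makes the operator uniformly invertible:
  \<open>1 - (- S) / (4 * \<gamma> + 4 * lam)\<close> contracts the supremum norm by \<open>r = lam / (\<gamma> + lam)\<close>, in the whole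
  lattice and in every box.  The Neumann sums \<open>g\<^sub>n\<close> of order \<open>n\<close> started from the off-diagonal
  part of \<open>\<alpha>\<close> are local and translation covariant, and leave a residual of size \<open>r ^ n\<close>.  The sum
  of the translates of \<open>g\<^sub>n\<close> over the box is therefore close to the resolvent of the box, with an
  error per site that is exponentially small in \<open>n\<close> up to a power of \<open>n\<close>; and \<open>g\<^sub>n\<close> itself, as a
  test function, gives a value of the functional that differs from the same limit by as little.
  The value is computed with \<open>Dirichlet_Gam\<close>: the Dirichlet form of the formal sum \<open>\<Gamma>\<^sub>g\<close> is the
  pairing of \<open>- S g\<close> with \<open>\<Gamma>\<^sub>g\<close>.

  The upper bound for the resolvent is \<open>resolvent_upper_bound\<close>, the lower bound for the functional
  in the norm is \<open>functional_test_field\<close>, and letting \<open>n\<close> and \<open>N\<close> grow gives the theorem.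
\<close>

section \<open>The disorder\<close>

locale disorder =
  fixes C :: real and \<nu> :: "real measure"
  assumes C_gt_1: "C > 1" and law: "site_law C \<nu>"
begin

abbreviation "D \<equiv> disorder_set C"
abbreviation "P \<equiv> disorder_law \<nu>"
abbreviation mean :: "(config \<Rightarrow> real) \<Rightarrow> real" where "mean f \<equiv> integral\<^sup>L P f"

lemma prob_site: "prob_space \<nu>" and sets_site: "sets \<nu> = sets (restrict_space borel {1 / C..C})"
  using law by (auto simp: site_law_def)

lemma space_site: "space \<nu> = {1 / C..C}"
  using sets_eq_imp_space_eq[OF sets_site] by (simp add: space_restrict_space)

lemma space_disorder: "space P = D"
  by (auto simp: disorder_law_def space_PiM space_site disorder_set_def)

lemma prob_disorder: "prob_space P"
  unfolding disorder_law_def by (intro prob_space_PiM prob_site)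

lemma shift_disorder [simp]: "m \<in> D \<Longrightarrow> shift x m \<in> D"
  by (auto simp: disorder_set_def shift_def)

lemma measurable_coordinate_disorder: "(\<lambda>m. m i) \<in> borel_measurable P"
proof -
  have "(\<lambda>m. m i) \<in> P \<rightarrow>\<^sub>M \<nu>"
    unfolding disorder_law_def by (rule measurable_component_singleton) auto
  moreover have "(\<lambda>x. x) \<in> \<nu> \<rightarrow>\<^sub>M borel"
    using measurable_cong_sets[OF sets_site refl, of borel]
      measurable_restrict_space1[of "\<lambda>x. x" borel borel "{1/C..C}"] by auto
  ultimately show ?thesis by (rule measurable_compose)
qed

text \<open>
  The \<sigma>-algebra of \<open>P\<close> is a product of traces of Borel \<sigma>-algebras, whereas continuity refers to
  the product topology.  The two fit together because a countable product of second countable spaces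
  carries the product of the Borel \<sigma>-algebras.
\<close>

lemma measurable_continuous_disorder:
  assumes "continuous_on D f"
  shows "(f :: config \<Rightarrow> real) \<in> borel_measurable P"
proof -
  have "(\<lambda>m. m) \<in> P \<rightarrow>\<^sub>M Pi\<^sub>M UNIV (\<lambda>_. borel)"
    by (rule measurable_PiM_single')
      (auto simp: measurable_coordinate_disorder space_PiM)
  then have "(\<lambda>m. m) \<in> P \<rightarrow>\<^sub>M borel"
    using sets_PiM_equal_borel measurable_cong_sets by blast
  then have "(\<lambda>m. m) \<in> P \<rightarrow>\<^sub>M restrict_space borel D"
    by (rule measurable_restrict_space2[rotated]) (auto simp: space_disorder)
  from measurable_compose[OF this borel_measurable_continuous_on_restrict[OF assms]]
  show ?thesis by simp
qed

text \<open>
  Tychonoff's theorem.  Compactness turns continuity in the disorder into boundedness, and hence into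
  integrability, of all coefficients below.
\<close>

lemma compact_disorder: "compact D"
proof -
  have "D = PiE UNIV (\<lambda>_. {1 / C..C})"
    by (auto simp: disorder_set_def)
  moreover have "compactin (product_topology (\<lambda>_::int. euclideanreal) UNIV) (PiE UNIV (\<lambda>_. {1 / C..C}))"
    by (subst compactin_PiE) simp
  ultimately show ?thesis
    by (simp only: euclidean_product_topology compactin_euclidean_iff)
qed

lemma bounded_continuous_disorder:
  assumes "continuous_on D (f :: config \<Rightarrow> real)"
  obtains K where "K \<ge> 0" "\<And>m. m \<in> D \<Longrightarrow> \<bar>f m\<bar> \<le> K"
proof -
  have "bounded (f ` D)"
    using compact_continuous_image[OF assms compact_disorder] by (rule compact_imp_bounded)
  then obtain K where "\<forall>y\<in>f ` D. norm y \<le> K" by (auto simp: bounded_iff)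
  then have "\<bar>f m\<bar> \<le> max K 0" if "m \<in> D" for m
    using that by (metis image_eqI max.coboundedI1 real_norm_def)
  then show thesis by (intro that[of "max K 0"]) auto
qed

lemma integrable_continuous_disorder:
  assumes "continuous_on D (f :: config \<Rightarrow> real)"
  shows "integrable P f"
proof -
  interpret prob_space P by (rule prob_disorder)
  obtain K where "\<And>m. m \<in> D \<Longrightarrow> \<bar>f m\<bar> \<le> K" using bounded_continuous_disorder[OF assms] by blast
  then show ?thesis
    by (intro integrable_const_bound[of _ K] measurable_continuous_disorder assms AE_I2)
      (simp add: space_disorder)
qed

lemma continuous_on_shift: "continuous_on S (shift x)"
proof (rule continuous_on_coordinatewise_then_product)
  show "continuous_on S (\<lambda>\<omega>. shift x \<omega> z)" for z
    unfolding shift_def by (rule continuous_on_subset[OF continuous_on_product_coordinates]) simp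
qed

lemma continuous_shift:
  assumes "continuous_on D f"
  shows "continuous_on D (\<lambda>m. f (shift x m))"
  by (rule continuous_on_compose2[OF assms continuous_on_shift]) auto

lemma mean_shift:
  assumes "continuous_on D (f :: config \<Rightarrow> real)"
  shows "mean (\<lambda>m. f (shift x m)) = mean f"
proof -
  have "distr (Pi\<^sub>M UNIV (\<lambda>_. \<nu>)) (Pi\<^sub>M UNIV (\<lambda>_. \<nu>)) (\<lambda>\<omega>. \<lambda>n\<in>UNIV. \<omega> (x + n)) = Pi\<^sub>M UNIV (\<lambda>_. \<nu>)"
    by (rule distr_PiM_reindex) (auto simp: prob_site)
  then have d: "distr P P (shift x) = P"
    by (simp add: disorder_law_def shift_def[abs_def] restrict_def)
  have "shift x \<in> P \<rightarrow>\<^sub>M P"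
    unfolding disorder_law_def shift_def[abs_def]
    by (rule measurable_PiM_single') (auto simp: space_PiM)
  then have "integral\<^sup>L (distr P P (shift x)) f = mean (\<lambda>m. f (shift x m))"
    using measurable_continuous_disorder[OF assms] by (rule integral_distr)
  then show ?thesis by (simp add: d)
qed

text \<open>
  Disjoint blocks of coordinates are independent.  A function that only sees the block \<open>A\<close> is made a
  function of the restriction of \<open>m\<close> to \<open>A\<close> by filling the other sites with the constant \<open>1\<close>, which
  is an admissible value of the disorder as \<open>C > 1\<close>.
\<close>

lemma mean_mult_independent:
  fixes f g :: "config \<Rightarrow> real"
  assumes f: "continuous_on D f" and g: "continuous_on D g" and AB: "A \<inter> B = {}"
    and fA: "\<And>m m'. m \<in> D \<Longrightarrow> m' \<in> D \<Longrightarrow> (\<forall>x\<in>A. m x = m' x) \<Longrightarrow> f m = f m'"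
    and gB: "\<And>m m'. m \<in> D \<Longrightarrow> m' \<in> D \<Longrightarrow> (\<forall>x\<in>B. m x = m' x) \<Longrightarrow> g m = g m'"
  shows "mean (\<lambda>m. f m * g m) = mean f * mean g"
proof -
  interpret prob_space P by (rule prob_disorder)
  define ext :: "int set \<Rightarrow> config \<Rightarrow> config" where "ext S x = (\<lambda>i. if i \<in> S then x i else 1)" for S x
  have one: "1 \<in> space \<nu>" using C_gt_1 by (simp add: space_site)
  have ext_meas: "ext S \<in> Pi\<^sub>M S (\<lambda>_. \<nu>) \<rightarrow>\<^sub>M P" for S
    unfolding disorder_law_def
  proof (rule measurable_PiM_single')
    show "(\<lambda>m. ext S m i) \<in> Pi\<^sub>M S (\<lambda>_. \<nu>) \<rightarrow>\<^sub>M \<nu>" for i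
      by (cases "i \<in> S") (simp_all add: ext_def one)
  qed (auto simp: ext_def space_PiM one)
  have extD: "ext S (restrict m S) \<in> D" if "m \<in> D" for m S
    using that C_gt_1 by (auto simp: ext_def disorder_set_def)
  have ind: "indep_vars (\<lambda>_. \<nu>) (\<lambda>i m. m i) UNIV"
  proof (subst indep_vars_iff_distr_eq_PiM')
    show "UNIV \<noteq> ({} :: int set)" by simp
    show "(\<lambda>m. m i) \<in> P \<rightarrow>\<^sub>M \<nu>" for i :: int
      unfolding disorder_law_def by (rule measurable_component_singleton) auto
    have "distr P \<nu> (\<lambda>m. m i) = \<nu>" for i :: int
      unfolding disorder_law_def by (rule distr_PiM_component) (auto simp: prob_site)
    then show "distr P (Pi\<^sub>M UNIV (\<lambda>_. \<nu>)) (\<lambda>x. \<lambda>i\<in>UNIV. x i) = (\<Pi>\<^sub>M i\<in>(UNIV::int set). distr P \<nu> (\<lambda>m. m i))"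
      by (simp add: disorder_law_def restrict_def)
  qed
  have "indep_var (Pi\<^sub>M A (\<lambda>_. \<nu>)) (\<lambda>m. restrict m A) (Pi\<^sub>M B (\<lambda>_. \<nu>)) (\<lambda>m. restrict m B)"
    using indep_var_restrict[OF ind AB] by simp
  then have iv: "indep_var borel ((f \<circ> ext A) \<circ> (\<lambda>m. restrict m A)) borel ((g \<circ> ext B) \<circ> (\<lambda>m. restrict m B))"
    by (rule indep_var_compose)
      (auto intro!: measurable_comp[OF ext_meas] measurable_continuous_disorder f g)
  have fe: "f (ext A (restrict m A)) = f m" if "m \<in> D" for m
    by (rule fA) (use that extD in \<open>auto simp: ext_def\<close>)
  have ge: "g (ext B (restrict m B)) = g m" if "m \<in> D" for m
    by (rule gB) (use that extD in \<open>auto simp: ext_def\<close>)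
  have "integrable P (\<lambda>m. f (ext A (restrict m A))) \<longleftrightarrow> integrable P f"
    by (rule Bochner_Integration.integrable_cong) (auto simp: space_disorder fe)
  moreover have "integrable P (\<lambda>m. g (ext B (restrict m B))) \<longleftrightarrow> integrable P g"
    by (rule Bochner_Integration.integrable_cong) (auto simp: space_disorder ge)
  ultimately have "mean (\<lambda>m. f (ext A (restrict m A)) * g (ext B (restrict m B)))
    = mean (\<lambda>m. f (ext A (restrict m A))) * mean (\<lambda>m. g (ext B (restrict m B)))"
    using indep_var_lebesgue_integral[OF iv, unfolded comp_def] integrable_continuous_disorder f g by simp
  moreover have "mean (\<lambda>m. f (ext A (restrict m A)) * g (ext B (restrict m B))) = mean (\<lambda>m. f m * g m)"
    "mean (\<lambda>m. f (ext A (restrict m A))) = mean f" "mean (\<lambda>m. g (ext B (restrict m B))) = mean g"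
    by (auto intro!: Bochner_Integration.integral_cong simp: space_disorder fe ge)
  ultimately show ?thesis by simp
qed

end

section \<open>Gaussian moments and invariance\<close>

lemma prob_gauss: "prob_space gauss_law"
  unfolding gauss_law_def by (intro prob_space_PiM prob_space_normal_density) simp

lemma space_gauss [simp]: "space gauss_law = UNIV"
  by (simp add: gauss_law_def space_PiM PiE_UNIV_domain)

lemma measurable_coordinate_gauss [measurable]: "(\<lambda>\<omega>. \<omega> i) \<in> borel_measurable gauss_law"
proof -
  have "(\<lambda>\<omega>. \<omega> i) \<in> gauss_law \<rightarrow>\<^sub>M density lborel std_normal_density"
    unfolding gauss_law_def by (rule measurable_component_singleton) auto
  then show ?thesis by simp
qed

lemma distr_coordinate_gauss: "distr gauss_law borel (\<lambda>\<omega>. \<omega> i) = density lborel std_normal_density"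
proof -
  have "distr gauss_law (density lborel std_normal_density) (\<lambda>\<omega>. \<omega> i) = density lborel std_normal_density"
    unfolding gauss_law_def by (rule distr_PiM_component) (auto intro: prob_space_normal_density)
  moreover have "distr gauss_law (density lborel std_normal_density) (\<lambda>\<omega>. \<omega> i) = distr gauss_law borel (\<lambda>\<omega>. \<omega> i)"
    by (rule distr_cong) auto
  ultimately show ?thesis by simp
qed

lemma has_integral_power_gauss:
  shows "integrable gauss_law (\<lambda>\<omega>. \<omega> i ^ n)"
    and "(LINT \<omega>|gauss_law. \<omega> i ^ n) = (LINT x|lborel. std_normal_density x * x ^ n)"
proof -
  have "integrable (density lborel std_normal_density) (\<lambda>x. x ^ n)"
    by (subst integrable_density) (auto simp: integrable_std_normal_moment)
  then have "integrable (distr gauss_law borel (\<lambda>\<omega>. \<omega> i)) (\<lambda>x. x ^ n)"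
    by (simp add: distr_coordinate_gauss)
  then show "integrable gauss_law (\<lambda>\<omega>. \<omega> i ^ n)"
    by (subst (asm) integrable_distr_eq) auto
  have "(LINT \<omega>|gauss_law. \<omega> i ^ n) = (LINT x|distr gauss_law borel (\<lambda>\<omega>. \<omega> i). x ^ n)"
    by (subst integral_distr) auto
  also have "\<dots> = (LINT x|lborel. std_normal_density x * x ^ n)"
    unfolding distr_coordinate_gauss by (subst integral_density) auto
  finally show "(LINT \<omega>|gauss_law. \<omega> i ^ n) = (LINT x|lborel. std_normal_density x * x ^ n)" .
qed

lemma indep_coordinates_gauss:
  "prob_space.indep_vars gauss_law (\<lambda>_. borel) (\<lambda>i \<omega>. \<omega> i) UNIV"
proof -
  interpret prob_space gauss_law by (rule prob_gauss)
  show ?thesis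
  proof (subst indep_vars_iff_distr_eq_PiM')
    show "UNIV \<noteq> ({} :: int set)" by simp
    have "distr gauss_law (Pi\<^sub>M UNIV (\<lambda>_. borel)) (\<lambda>x. \<lambda>i\<in>UNIV. x i) = distr gauss_law gauss_law (\<lambda>x. x)"
      by (rule distr_cong) (auto simp: gauss_law_def intro!: sets_PiM_cong)
    then show "distr gauss_law (Pi\<^sub>M UNIV (\<lambda>_. borel)) (\<lambda>x. \<lambda>i\<in>UNIV. x i)
        = (\<Pi>\<^sub>M i\<in>(UNIV::int set). distr gauss_law borel (\<lambda>m. m i))"
      by (simp add: distr_coordinate_gauss) (simp add: gauss_law_def)
  qed auto
qed

lemma monomial_gauss:
  fixes N :: "int \<Rightarrow> nat"
  assumes "finite I"
  shows "integrable gauss_law (\<lambda>\<omega>. \<Prod>i\<in>I. \<omega> i ^ N i)"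
    and "(LINT \<omega>|gauss_law. (\<Prod>i\<in>I. \<omega> i ^ N i)) = (\<Prod>i\<in>I. (LINT x|lborel. std_normal_density x * x ^ N i))"
proof -
  interpret prob_space gauss_law by (rule prob_gauss)
  have "indep_vars (\<lambda>_. borel) (\<lambda>i \<omega>. \<omega> i) I"
    using indep_coordinates_gauss indep_vars_subset by blast
  then have iv: "indep_vars (\<lambda>_. borel) (\<lambda>i \<omega>. \<omega> i ^ N i) I"
    by (rule indep_vars_compose2[where M' = "\<lambda>_. borel" and Y = "\<lambda>i y. y ^ N i"]) auto
  show "integrable gauss_law (\<lambda>\<omega>. \<Prod>i\<in>I. \<omega> i ^ N i)"
    by (rule indep_vars_integrable[OF assms iv]) (rule has_integral_power_gauss)
  show "(LINT \<omega>|gauss_law. (\<Prod>i\<in>I. \<omega> i ^ N i)) = (\<Prod>i\<in>I. (LINT x|lborel. std_normal_density x * x ^ N i))"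
    using indep_vars_lebesgue_integral[OF assms iv] has_integral_power_gauss by simp
qed

abbreviation "kron i j \<equiv> (of_bool (i = j) :: real)"

lemma kron_sum: "finite A \<Longrightarrow> i \<in> A \<Longrightarrow> (\<Sum>j\<in>A. f j * kron i j) = f i"
  by (simp add: of_bool_def if_distrib cong: if_cong)

text \<open>
  Wick's formula for the standard Gaussian product law.  The monomial is written as a product of
  powers of distinct coordinates, so that independence reduces it to one-dimensional moments.
\<close>

lemma wick:
  fixes i j k l :: int
  shows "integrable gauss_law (\<lambda>\<omega>. \<omega> i * \<omega> j * (\<omega> k * \<omega> l))"
    and "(LINT \<omega>|gauss_law. \<omega> i * \<omega> j * (\<omega> k * \<omega> l)) =
      kron i j * kron k l + kron i k * kron j l + kron i l * kron j k"
proof -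
  define N where "N z = (of_bool (z = i) + of_bool (z = j) + of_bool (z = k) + of_bool (z = l) :: nat)" for z
  define I where "I = {i, j, k, l}"
  \<comment> \<open>the moments of the standard normal law: 1, 0, 1, 0, 3\<close>
  define mom where "mom n = (LINT x|lborel. std_normal_density x * x ^ n)" for n
  have mom: "mom 0 = 1" "mom (Suc 0) = 0" "mom 2 = 1" "mom 3 = 0" "mom 4 = 3"
    using integral_std_normal_moment_even[of 0] integral_std_normal_moment_odd[of 0]
      integral_std_normal_moment_even[of 1] integral_std_normal_moment_odd[of 1]
      integral_std_normal_moment_even[of 2]
    by (simp_all add: mom_def fact_numeral numeral_3_eq_3 del: power_Suc)
  then have mom': "mom (Suc (Suc 0)) = 1" "mom (Suc (Suc (Suc 0))) = 0" "mom (Suc (Suc (Suc (Suc 0)))) = 3"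
    by (simp_all add: eval_nat_numeral)
  have fin: "finite I" and mem: "i \<in> I" "j \<in> I" "k \<in> I" "l \<in> I" by (simp_all add: I_def)
  have single: "(\<Prod>z\<in>I. \<omega> z ^ of_bool (z = y)) = \<omega> y" if "y \<in> I" for y and \<omega> :: config
  proof -
    have "(\<Prod>z\<in>I. \<omega> z ^ of_bool (z = y)) = (\<Prod>z\<in>I. if z = y then \<omega> z else 1)"
      by (rule prod.cong) auto
    then show ?thesis using that fin by simp
  qed
  have eq: "(\<Prod>z\<in>I. \<omega> z ^ N z) = \<omega> i * \<omega> j * (\<omega> k * \<omega> l)" for \<omega> :: config
    by (simp only: N_def power_add prod.distrib) (simp only: single mem mult.assoc)
  show "integrable gauss_law (\<lambda>\<omega>. \<omega> i * \<omega> j * (\<omega> k * \<omega> l))"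
    using monomial_gauss(1)[OF fin, of N] by (simp add: eq)
  have "(LINT \<omega>|gauss_law. \<omega> i * \<omega> j * (\<omega> k * \<omega> l)) = (\<Prod>z\<in>I. mom (N z))"
    using monomial_gauss(2)[OF fin, of N] by (simp add: eq mom_def)
  also have "\<dots> = kron i j * kron k l + kron i k * kron j l + kron i l * kron j k"
    unfolding I_def N_def
    by (cases "i = j"; cases "i = k"; cases "i = l"; cases "j = k"; cases "j = l"; cases "k = l")
      (simp_all add: mom mom' prod.insert_if)
  finally show "(LINT \<omega>|gauss_law. \<omega> i * \<omega> j * (\<omega> k * \<omega> l)) =
      kron i j * kron k l + kron i k * kron j l + kron i l * kron j k" .
qed

text \<open>
  The last clause makes composition with \<open>T\<close> self-adjoint, and not only isometric, on the square
  integrable functions.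
\<close>

definition preserves_gauss :: "(config \<Rightarrow> config) \<Rightarrow> bool" where
  "preserves_gauss T \<longleftrightarrow> T \<in> gauss_law \<rightarrow>\<^sub>M gauss_law \<and> distr gauss_law gauss_law T = gauss_law
     \<and> (\<forall>\<omega>. T (T \<omega>) = \<omega>)"

lemma preserves_gauss_exchange: "preserves_gauss (exchange x)"
  unfolding preserves_gauss_def
proof (intro conjI allI)
  define s where "s z = (if z = x then x + 1 else if z = x + 1 then x else z)" for z
  have ex: "exchange x = (\<lambda>\<omega> z. \<omega> (s z))"
    by (auto simp: exchange_def s_def fun_eq_iff)
  show "exchange x \<in> gauss_law \<rightarrow>\<^sub>M gauss_law"
    unfolding gauss_law_def ex
    by (rule measurable_PiM_single') (auto simp: space_PiM measurable_coordinate_gauss[unfolded gauss_law_def])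
  have "distr gauss_law (Pi\<^sub>M UNIV (\<lambda>_. density lborel std_normal_density)) (\<lambda>\<omega>. \<lambda>n\<in>UNIV. \<omega> (s n))
      = Pi\<^sub>M UNIV (\<lambda>_. density lborel std_normal_density)"
    unfolding gauss_law_def
    by (rule distr_PiM_reindex) (auto intro!: prob_space_normal_density simp: inj_on_def s_def split: if_splits)
  then show "distr gauss_law gauss_law (exchange x) = gauss_law"
    unfolding ex by (simp add: gauss_law_def restrict_def)
  show "exchange x (exchange x \<omega>) = \<omega>" for \<omega>
    by (auto simp: exchange_def fun_eq_iff)
qed

lemma distr_neg_coordinate_gauss: "distr gauss_law borel (\<lambda>\<omega>. - \<omega> i) = density lborel std_normal_density"
proof -
  interpret prob_space gauss_law by (rule prob_gauss)
  have "distributed gauss_law lborel (\<lambda>\<omega>. \<omega> i) std_normal_density"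
    using distr_coordinate_gauss[of i] by (auto simp: distributed_def cong: distr_cong)
  from normal_density_affine[OF this, of "-1" 0]
  have "distr gauss_law lborel (\<lambda>\<omega>. - \<omega> i) = density lborel std_normal_density"
    by (simp add: distributed_def)
  moreover have "distr gauss_law lborel (\<lambda>\<omega>. - \<omega> i) = distr gauss_law borel (\<lambda>\<omega>. - \<omega> i)"
    by (rule distr_cong) auto
  ultimately show ?thesis by simp
qed

lemma sets_gauss: "sets gauss_law = sets (Pi\<^sub>M UNIV (\<lambda>_. borel))"
  by (auto simp: gauss_law_def intro!: sets_PiM_cong)

lemma preserves_gauss_flip: "preserves_gauss (flip x)"
  unfolding preserves_gauss_def
proof (intro conjI allI)
  interpret prob_space gauss_law by (rule prob_gauss)
  have coord: "(\<lambda>\<omega>. flip x \<omega> i) \<in> borel_measurable gauss_law" for i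
    by (cases "i = x") (simp_all add: flip_def)
  have "flip x \<in> gauss_law \<rightarrow>\<^sub>M Pi\<^sub>M UNIV (\<lambda>_. borel)"
    by (rule measurable_PiM_single') (auto simp: space_PiM coord)
  then show "flip x \<in> gauss_law \<rightarrow>\<^sub>M gauss_law"
    using measurable_cong_sets[OF refl sets_gauss] by blast
  have "indep_vars (\<lambda>_. borel) (\<lambda>i \<omega>. if i = x then - \<omega> i else \<omega> i) UNIV"
    by (rule indep_vars_compose2[OF indep_coordinates_gauss,
          where Y = "\<lambda>i y. if i = x then - y else y"]) auto
  then have "indep_vars (\<lambda>_. borel) (\<lambda>i \<omega>. flip x \<omega> i) UNIV"
    by (simp add: flip_def[abs_def] cong: if_cong)
  then have "distr gauss_law (Pi\<^sub>M UNIV (\<lambda>_. borel)) (\<lambda>\<omega>. \<lambda>i\<in>UNIV. flip x \<omega> i)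
      = (\<Pi>\<^sub>M i\<in>UNIV. distr gauss_law borel (\<lambda>\<omega>. flip x \<omega> i))"
    by (subst (asm) indep_vars_iff_distr_eq_PiM') (auto simp: coord)
  also have "(\<lambda>i. distr gauss_law borel (\<lambda>\<omega>. flip x \<omega> i)) = (\<lambda>_. density lborel std_normal_density)"
  proof
    fix i
    show "distr gauss_law borel (\<lambda>\<omega>. flip x \<omega> i) = density lborel std_normal_density"
      by (cases "i = x") (simp_all add: flip_def distr_coordinate_gauss distr_neg_coordinate_gauss)
  qed
  finally have "distr gauss_law (Pi\<^sub>M UNIV (\<lambda>_. borel)) (flip x) = gauss_law"
    by (simp add: gauss_law_def restrict_def)
  moreover have "distr gauss_law (Pi\<^sub>M UNIV (\<lambda>_. borel)) (flip x) = distr gauss_law gauss_law (flip x)"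
    by (rule distr_cong) (auto simp: sets_gauss)
  ultimately show "distr gauss_law gauss_law (flip x) = gauss_law" by simp
  show "flip x (flip x \<omega>) = \<omega>" for \<omega>
    by (auto simp: flip_def fun_eq_iff)
qed

section \<open>The joint law and the symmetry of the generator\<close>

context disorder begin

abbreviation "J \<equiv> joint_law \<nu>"

lemma pair_prob: "pair_prob_space P gauss_law"
  by (simp add: pair_prob_space_def pair_sigma_finite_def prob_disorder prob_gauss
      prob_space_imp_sigma_finite)

lemma space_joint: "space J = D \<times> UNIV"
  by (simp add: joint_law_def space_pair_measure space_disorder)

lemma E_star_cong:
  assumes "\<And>m \<omega>. m \<in> D \<Longrightarrow> f m \<omega> = g m \<omega>"
  shows "E_star \<nu> f = E_star \<nu> g"
  unfolding E_star_def by (rule Bochner_Integration.integral_cong) (auto simp: space_joint assms)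

lemma E_star_product:
  assumes f: "continuous_on D f" and g: "integrable gauss_law (g :: config \<Rightarrow> real)"
  shows "integrable J (\<lambda>z. f (fst z) * g (snd z))"
    and "E_star \<nu> (\<lambda>m \<omega>. f m * g \<omega>) = mean f * integral\<^sup>L gauss_law g"
proof -
  interpret pair_prob_space P gauss_law by (rule pair_prob)
  note [measurable] = measurable_continuous_disorder[OF f] borel_measurable_integrable[OF g]
  have m: "(\<lambda>z. f (fst z) * g (snd z)) \<in> borel_measurable (P \<Otimes>\<^sub>M gauss_law)" by measurable
  have fi: "integrable P f" by (rule integrable_continuous_disorder[OF f])
  have int: "integrable (P \<Otimes>\<^sub>M gauss_law) (\<lambda>z. f (fst z) * g (snd z))"
    by (rule Fubini_integrable[OF m]) (simp_all add: abs_mult fi g)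
  then show "integrable J (\<lambda>z. f (fst z) * g (snd z))" by (simp add: joint_law_def)
  have "E_star \<nu> (\<lambda>m \<omega>. f m * g \<omega>) = (LINT m|P. LINT \<omega>|gauss_law. f m * g \<omega>)"
    using integral_fst'[OF int] by (simp add: E_star_def joint_law_def)
  then show "E_star \<nu> (\<lambda>m \<omega>. f m * g \<omega>) = mean f * integral\<^sup>L gauss_law g" by simp
qed

lemma mean_sum:
  assumes "\<And>i. i \<in> I \<Longrightarrow> continuous_on D (f i :: config \<Rightarrow> real)"
  shows "mean (\<lambda>m. \<Sum>i\<in>I. f i m) = (\<Sum>i\<in>I. mean (f i))"
  by (rule Bochner_Integration.integral_sum) (auto intro: integrable_continuous_disorder assms)

text \<open>
  Covariance of two quadratic forms with random coefficients.  The three pairings of Wick's formula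
  produce the product of the traces and twice the scalar product of the matrices; the first vanishes
  as soon as one of the traces does.
\<close>

lemma
  fixes c d :: "config \<Rightarrow> int \<Rightarrow> int \<Rightarrow> real"
  assumes fin: "finite A"
    and c: "\<And>i j. continuous_on D (\<lambda>m. c m i j)" and d: "\<And>i j. continuous_on D (\<lambda>m. d m i j)"
  shows integrable_quadratics: "integrable J (\<lambda>z. (\<Sum>i\<in>A. \<Sum>j\<in>A. c (fst z) i j * snd z i * snd z j)
      * (\<Sum>k\<in>A. \<Sum>l\<in>A. d (fst z) k l * snd z k * snd z l))" (is "integrable J ?F")
    and E_star_quadratics:
      "\<lbrakk>\<And>m i j. m \<in> D \<Longrightarrow> d m i j = d m j i; \<And>m. m \<in> D \<Longrightarrow> (\<Sum>i\<in>A. c m i i) = 0\<rbrakk> \<Longrightarrow>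
       E_star \<nu> (\<lambda>m \<omega>. (\<Sum>i\<in>A. \<Sum>j\<in>A. c m i j * \<omega> i * \<omega> j)
          * (\<Sum>k\<in>A. \<Sum>l\<in>A. d m k l * \<omega> k * \<omega> l))
        = 2 * mean (\<lambda>m. \<Sum>i\<in>A. \<Sum>j\<in>A. c m i j * d m i j)"
proof -
  have cd: "continuous_on D (\<lambda>m. c m i j * d m k l)" for i j k l
    by (intro continuous_intros c d)
  define t where "t i j k l z = (c (fst z) i j * d (fst z) k l) * (snd z i * snd z j * (snd z k * snd z l))"
    for i j k l :: int and z :: "config \<times> config"
  have expand: "?F = (\<lambda>z. \<Sum>i\<in>A. \<Sum>j\<in>A. \<Sum>k\<in>A. \<Sum>l\<in>A. t i j k l z)"
    by (simp only: sum_distrib_right, simp only: sum_distrib_left t_def) (simp add: mult_ac)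
  have int: "integrable J (t i j k l)" for i j k l
    unfolding t_def by (rule E_star_product(1)[OF cd wick(1)])
  show "integrable J ?F"
    unfolding expand by (intro Bochner_Integration.integrable_sum int)
  assume sym: "\<And>m i j. m \<in> D \<Longrightarrow> d m i j = d m j i" and tr: "\<And>m. m \<in> D \<Longrightarrow> (\<Sum>i\<in>A. c m i i) = 0"
  have "E_star \<nu> (\<lambda>m \<omega>. (\<Sum>i\<in>A. \<Sum>j\<in>A. c m i j * \<omega> i * \<omega> j)
          * (\<Sum>k\<in>A. \<Sum>l\<in>A. d m k l * \<omega> k * \<omega> l)) = integral\<^sup>L J ?F"
    by (simp add: E_star_def)
  also have "\<dots> = (\<Sum>i\<in>A. \<Sum>j\<in>A. \<Sum>k\<in>A. \<Sum>l\<in>A. integral\<^sup>L J (t i j k l))"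
    unfolding expand by (simp add: int)
  also have "\<dots> = (\<Sum>i\<in>A. \<Sum>j\<in>A. \<Sum>k\<in>A. \<Sum>l\<in>A. mean (\<lambda>m. c m i j * d m k l)
      * (kron i j * kron k l + kron i k * kron j l + kron i l * kron j k))"
    using E_star_product(2)[OF cd wick(1)] by (simp add: wick(2) t_def[abs_def] E_star_def)
  also have "\<dots> = (\<Sum>i\<in>A. \<Sum>j\<in>A. \<Sum>k\<in>A. \<Sum>l\<in>A. mean (\<lambda>m. c m i j * d m k l
      * (kron i j * kron k l + kron i k * kron j l + kron i l * kron j k)))"
    by simp
  also have "\<dots> = mean (\<lambda>m. \<Sum>i\<in>A. \<Sum>j\<in>A. \<Sum>k\<in>A. \<Sum>l\<in>A. c m i j * d m k l
      * (kron i j * kron k l + kron i k * kron j l + kron i l * kron j k))"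
    by (subst Bochner_Integration.integral_sum integral_mult_left_zero,
        (intro integrable_continuous_disorder continuous_intros c d)?)+ simp
  also have "\<dots> = mean (\<lambda>m. 2 * (\<Sum>i\<in>A. \<Sum>j\<in>A. c m i j * d m i j))"
  proof (rule Bochner_Integration.integral_cong[OF refl])
    fix m assume "m \<in> space P"
    then have m: "m \<in> D" by (simp add: space_disorder)
    have "(\<Sum>i\<in>A. \<Sum>j\<in>A. \<Sum>k\<in>A. \<Sum>l\<in>A. c m i j * d m k l * (kron i j * kron k l + kron i k * kron j l + kron i l * kron j k))
       = (\<Sum>i\<in>A. \<Sum>j\<in>A. \<Sum>k\<in>A. \<Sum>l\<in>A. c m i j * d m k l * kron i j * kron k l)
       + (\<Sum>i\<in>A. \<Sum>j\<in>A. \<Sum>k\<in>A. \<Sum>l\<in>A. c m i j * d m k l * kron i k * kron j l)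
       + (\<Sum>i\<in>A. \<Sum>j\<in>A. \<Sum>k\<in>A. \<Sum>l\<in>A. c m i j * d m k l * kron i l * kron j k)"
      by (simp add: sum.distrib algebra_simps)
    also have "(\<Sum>i\<in>A. \<Sum>j\<in>A. \<Sum>k\<in>A. \<Sum>l\<in>A. c m i j * d m k l * kron i j * kron k l)
       = (\<Sum>i\<in>A. \<Sum>j\<in>A. (\<Sum>k\<in>A. c m i j * d m k k) * kron i j)"
      by (simp only: kron_sum[OF fin] sum_distrib_right cong: sum.cong)
    also have "\<dots> = (\<Sum>i\<in>A. c m i i) * (\<Sum>k\<in>A. d m k k)"
      by (simp only: kron_sum[OF fin] cong: sum.cong) (simp only: sum_product)
    also have "(\<Sum>i\<in>A. \<Sum>j\<in>A. \<Sum>k\<in>A. \<Sum>l\<in>A. c m i j * d m k l * kron i k * kron j l)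
       = (\<Sum>i\<in>A. \<Sum>j\<in>A. c m i j * d m i j)"
      by (simp only: kron_sum[OF fin] cong: sum.cong)
    also have "(\<Sum>i\<in>A. \<Sum>j\<in>A. \<Sum>k\<in>A. \<Sum>l\<in>A. c m i j * d m k l * kron i l * kron j k)
       = (\<Sum>i\<in>A. \<Sum>j\<in>A. \<Sum>k\<in>A. (\<Sum>l\<in>A. c m i j * d m k l * kron i l) * kron j k)"
      by (simp only: sum_distrib_right)
    also have "\<dots> = (\<Sum>i\<in>A. \<Sum>j\<in>A. c m i j * d m j i)"
      by (simp only: kron_sum[OF fin] cong: sum.cong)
    finally show "(\<Sum>i\<in>A. \<Sum>j\<in>A. \<Sum>k\<in>A. \<Sum>l\<in>A. c m i j * d m k l * (kron i j * kron k l + kron i k * kron j l + kron i l * kron j k))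
       = 2 * (\<Sum>i\<in>A. \<Sum>j\<in>A. c m i j * d m i j)"
      by (simp add: tr[OF m] sym[OF m, of _ _])
  qed
  finally show "E_star \<nu> (\<lambda>m \<omega>. (\<Sum>i\<in>A. \<Sum>j\<in>A. c m i j * \<omega> i * \<omega> j)
          * (\<Sum>k\<in>A. \<Sum>l\<in>A. d m k l * \<omega> k * \<omega> l))
        = 2 * mean (\<lambda>m. \<Sum>i\<in>A. \<Sum>j\<in>A. c m i j * d m i j)"
    by simp
qed

lemma joint_move:
  assumes T: "preserves_gauss T"
  defines "T' \<equiv> (\<lambda>z. (fst z, T (snd z)))"
  shows "T' \<in> J \<rightarrow>\<^sub>M J" and "distr J J T' = J"
proof -
  have Tm: "T \<in> gauss_law \<rightarrow>\<^sub>M gauss_law" and Td: "distr gauss_law gauss_law T = gauss_law"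
    using T by (auto simp: preserves_gauss_def)
  note [measurable] = Tm
  show "T' \<in> J \<rightarrow>\<^sub>M J" unfolding T'_def joint_law_def by measurable
  have "distr P P (\<lambda>x. x) \<Otimes>\<^sub>M distr gauss_law gauss_law T
      = distr (P \<Otimes>\<^sub>M gauss_law) (P \<Otimes>\<^sub>M gauss_law) (\<lambda>(x, y). (x, T y))"
    by (rule pair_measure_distr) (auto simp: Td prob_gauss prob_space_imp_sigma_finite)
  then show "distr J J T' = J"
    by (simp add: Td T'_def joint_law_def case_prod_unfold)
qed

lemma sq_integrable_product:
  assumes "sq_integrable M f" "sq_integrable M g"
  shows "integrable M (\<lambda>z. f z * g z)"
proof (rule Bochner_Integration.integrable_bound)
  show "integrable M (\<lambda>z. (f z)\<^sup>2 + (g z)\<^sup>2)" using assms by (simp add: sq_integrable_def)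
  show "(\<lambda>z. f z * g z) \<in> borel_measurable M"
    using assms by (auto simp: sq_integrable_def intro: borel_measurable_times)
  have "\<bar>a * b\<bar> \<le> a\<^sup>2 + b\<^sup>2" for a b :: real
  proof -
    have "2 * (\<bar>a\<bar> * \<bar>b\<bar>) \<le> a\<^sup>2 + b\<^sup>2"
      using sum_squares_bound[of "\<bar>a\<bar>" "\<bar>b\<bar>"] by (simp add: mult.assoc)
    moreover have "0 \<le> \<bar>a\<bar> * \<bar>b\<bar>" by simp
    ultimately show ?thesis unfolding abs_mult by linarith
  qed
  then show "AE z in M. norm (f z * g z) \<le> norm ((f z)\<^sup>2 + (g z)\<^sup>2)"
    by (intro AE_I2) (simp add: abs_of_nonneg)
qed

lemma sq_integrable_move:
  assumes T: "preserves_gauss T" and f: "sq_integrable J (\<lambda>z. f (fst z) (snd z))"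
  shows "sq_integrable J (\<lambda>z. f (fst z) (T (snd z)))"
proof -
  note T' = joint_move[OF T]
  have fm: "(\<lambda>z. f (fst z) (snd z)) \<in> borel_measurable J" using f by (simp add: sq_integrable_def)
  have "integrable (distr J J (\<lambda>z. (fst z, T (snd z)))) (\<lambda>z. (f (fst z) (snd z))\<^sup>2)"
    using f by (simp add: T'(2) sq_integrable_def)
  then have "integrable J (\<lambda>z. (f (fst z) (T (snd z)))\<^sup>2)"
    using fm by (subst (asm) integrable_distr_eq[OF T'(1)]) simp_all
  moreover have "(\<lambda>z. f (fst z) (T (snd z))) \<in> borel_measurable J"
    using measurable_compose[OF T'(1) fm] by simp
  ultimately show ?thesis by (simp add: sq_integrable_def)
qed

lemma move_adjoint:
  assumes T: "preserves_gauss T"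
    and f: "sq_integrable J (\<lambda>z. f (fst z) (snd z))" and g: "sq_integrable J (\<lambda>z. g (fst z) (snd z))"
  shows "(LINT z|J. f (fst z) (T (snd z)) * g (fst z) (snd z)) = (LINT z|J. f (fst z) (snd z) * g (fst z) (T (snd z)))"
proof -
  note T' = joint_move[OF T]
  have TT: "T (T \<omega>) = \<omega>" for \<omega> using T by (simp add: preserves_gauss_def)
  have m: "(\<lambda>z. f (fst z) (T (snd z)) * g (fst z) (snd z)) \<in> borel_measurable J"
    using sq_integrable_move[OF T f] g by (auto simp: sq_integrable_def intro: borel_measurable_times)
  have "(LINT z|J. f (fst z) (T (snd z)) * g (fst z) (snd z)) =
      (LINT z|distr J J (\<lambda>z. (fst z, T (snd z))). f (fst z) (T (snd z)) * g (fst z) (snd z))"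
    by (simp add: T'(2))
  also have "\<dots> = (LINT z|J. f (fst z) (snd z) * g (fst z) (T (snd z)))"
    by (subst integral_distr[OF T'(1) m]) (simp add: TT)
  finally show ?thesis .
qed

lemma grad_adjoint:
  assumes T: "preserves_gauss T"
    and f: "sq_integrable J (\<lambda>z. f (fst z) (snd z))" and g: "sq_integrable J (\<lambda>z. g (fst z) (snd z))"
  shows "(LINT z|J. (f (fst z) (T (snd z)) - f (fst z) (snd z)) * g (fst z) (snd z))
      = (LINT z|J. f (fst z) (snd z) * (g (fst z) (T (snd z)) - g (fst z) (snd z)))"
    and "integrable J (\<lambda>z. (f (fst z) (T (snd z)) - f (fst z) (snd z)) * g (fst z) (snd z))"
  using move_adjoint[OF assms] sq_integrable_product[OF sq_integrable_move[OF T f] g]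
    sq_integrable_product[OF f sq_integrable_move[OF T g]] sq_integrable_product[OF f g]
  by (simp_all add: left_diff_distrib right_diff_distrib)

lemma measurable_generator:
  assumes f: "sq_integrable J (\<lambda>z. f (fst z) (snd z))"
  shows "(\<lambda>z. generator \<gamma> lam l f (fst z) (snd z)) \<in> borel_measurable J"
  unfolding generator_def grad_flip_def grad_exch_def
  using sq_integrable_move[OF preserves_gauss_flip f] sq_integrable_move[OF preserves_gauss_exchange f] f
  by (intro borel_measurable_add borel_measurable_times borel_measurable_sum borel_measurable_diff
      borel_measurable_const) (auto simp: sq_integrable_def)

text \<open>
  Flips and exchanges are measure preserving involutions.
\<close>

lemma generator_symmetric:
  assumes f: "sq_integrable J (\<lambda>z. f (fst z) (snd z))" and g: "sq_integrable J (\<lambda>z. g (fst z) (snd z))"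
  shows "(LINT z|J. generator \<gamma> lam l f (fst z) (snd z) * g (fst z) (snd z))
      = (LINT z|J. f (fst z) (snd z) * generator \<gamma> lam l g (fst z) (snd z))"
proof -
  note F = grad_adjoint[OF preserves_gauss_flip f g] grad_adjoint(2)[OF preserves_gauss_flip g f]
  note E = grad_adjoint[OF preserves_gauss_exchange f g] grad_adjoint(2)[OF preserves_gauss_exchange g f]
  have "(LINT z|J. generator \<gamma> lam l f (fst z) (snd z) * g (fst z) (snd z))
     = \<gamma> * (\<Sum>x\<in>box l. LINT z|J. (f (fst z) (flip x (snd z)) - f (fst z) (snd z)) * g (fst z) (snd z))
     + lam * (\<Sum>x\<in>box l - {int l}. LINT z|J. (f (fst z) (exchange x (snd z)) - f (fst z) (snd z)) * g (fst z) (snd z))"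
    by (simp add: generator_def grad_flip_def grad_exch_def distrib_right sum_distrib_right mult.assoc F E)
  also have "\<dots> = \<gamma> * (\<Sum>x\<in>box l. LINT z|J. (g (fst z) (flip x (snd z)) - g (fst z) (snd z)) * f (fst z) (snd z))
     + lam * (\<Sum>x\<in>box l - {int l}. LINT z|J. (g (fst z) (exchange x (snd z)) - g (fst z) (snd z)) * f (fst z) (snd z))"
    unfolding F(1) E(1) by (simp add: mult.commute)
  also have "\<dots> = (LINT z|J. generator \<gamma> lam l g (fst z) (snd z) * f (fst z) (snd z))"
    by (simp add: generator_def grad_flip_def grad_exch_def distrib_right sum_distrib_right mult.assoc F E)
  finally show ?thesis by (simp add: mult.commute)
qed

text \<open>
  The selected preimage of \<open>\<Phi>\<close> is unknown, but by symmetry of the generator its pairing with \<open>\<Phi>\<close> is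
  the same as for any explicit square integrable preimage \<open>h\<close>.
\<close>

lemma neg_generator_inv_pairing:
  assumes h: "sq_integrable J (\<lambda>z. h (fst z) (snd z))"
    and Sh: "\<And>m \<omega>. m \<in> D \<Longrightarrow> - generator \<gamma> lam l h m \<omega> = \<Phi> m \<omega>"
  shows "E_star \<nu> (\<lambda>m \<omega>. neg_generator_inv \<nu> \<gamma> lam l \<Phi> m \<omega> * \<Phi> m \<omega>)
       = E_star \<nu> (\<lambda>m \<omega>. h m \<omega> * \<Phi> m \<omega>)"
proof -
  define k where "k = neg_generator_inv \<nu> \<gamma> lam l \<Phi>"
  have "AE z in J. - generator \<gamma> lam l h (fst z) (snd z) = \<Phi> (fst z) (snd z)"
    by (rule AE_I2) (auto simp: space_joint intro!: Sh)
  then have "sq_integrable J (\<lambda>(m, \<omega>). h m \<omega>) \<and> (AE (m, \<omega>) in J. - generator \<gamma> lam l h m \<omega> = \<Phi> m \<omega>)"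
    using h by (simp add: case_prod_unfold)
  then have "sq_integrable J (\<lambda>(m, \<omega>). k m \<omega>) \<and> (AE (m, \<omega>) in J. - generator \<gamma> lam l k m \<omega> = \<Phi> m \<omega>)"
    unfolding k_def neg_generator_inv_def
    by (rule someI[where P = "\<lambda>h. sq_integrable J (\<lambda>(m, \<omega>). h m \<omega>)
      \<and> (AE (m, \<omega>) in J. - generator \<gamma> lam l h m \<omega> = \<Phi> m \<omega>)"])
  then have k: "sq_integrable J (\<lambda>z. k (fst z) (snd z))"
    and Sk: "AE z in J. - generator \<gamma> lam l k (fst z) (snd z) = \<Phi> (fst z) (snd z)"
    by (simp_all add: case_prod_unfold)
  have "E_star \<nu> (\<lambda>m \<omega>. k m \<omega> * \<Phi> m \<omega>) = E_star \<nu> (\<lambda>m \<omega>. k m \<omega> * - generator \<gamma> lam l h m \<omega>)"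
    by (rule E_star_cong) (simp add: Sh)
  also have "\<dots> = - (LINT z|J. k (fst z) (snd z) * generator \<gamma> lam l h (fst z) (snd z))"
    by (simp add: E_star_def)
  also have "\<dots> = - (LINT z|J. generator \<gamma> lam l k (fst z) (snd z) * h (fst z) (snd z))"
    by (simp add: generator_symmetric[OF k h])
  also have "\<dots> = (LINT z|J. - generator \<gamma> lam l k (fst z) (snd z) * h (fst z) (snd z))"
    by simp
  also have "\<dots> = E_star \<nu> (\<lambda>m \<omega>. h m \<omega> * \<Phi> m \<omega>)"
    unfolding E_star_def
  proof (rule integral_cong_AE)
    have "(\<lambda>z. h (fst z) (snd z) * - generator \<gamma> lam l h (fst z) (snd z)) \<in> borel_measurable J"
      using measurable_generator[OF h] h
      by (intro borel_measurable_times borel_measurable_uminus) (auto simp: sq_integrable_def)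
    then show "(\<lambda>z. h (fst z) (snd z) * \<Phi> (fst z) (snd z)) \<in> borel_measurable J"
      by (rule measurable_cong[THEN iffD1, rotated]) (auto simp: space_joint Sh[symmetric])
    show "(\<lambda>z. - generator \<gamma> lam l k (fst z) (snd z) * h (fst z) (snd z)) \<in> borel_measurable J"
      using measurable_generator[OF k] h
      by (intro borel_measurable_times borel_measurable_uminus) (auto simp: sq_integrable_def)
    show "AE z in J. - generator \<gamma> lam l k (fst z) (snd z) * h (fst z) (snd z) = h (fst z) (snd z) * \<Phi> (fst z) (snd z)"
      using Sk by eventually_elim simp
  qed
  finally show ?thesis by (simp add: k_def)
qed

end

section \<open>Coefficient matrices\<close>

type_synonym matrix = "int \<Rightarrow> int \<Rightarrow> real"

lemma mem_box [simp]: "i \<in> box l \<longleftrightarrow> \<bar>i\<bar> \<le> int l"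
  by (auto simp: box_def)

lemma finite_box [simp]: "finite (box l)"
  by (simp add: box_def)

lemma card_box [simp]: "card (box l) = 2 * l + 1"
  by (simp add: box_def)

abbreviation "bonds l \<equiv> box l - {int l}"

definition swap_site :: "int \<Rightarrow> int \<Rightarrow> int" where
  "swap_site x i = (if i = x then x + 1 else if i = x + 1 then x else i)"

definition flip_sign :: "int \<Rightarrow> int \<Rightarrow> real" where
  "flip_sign x i = (if i = x then - 1 else 1)"

text \<open>
  The exchanges over all other bonds fix both \<open>i\<close> and \<open>j\<close>.  There are at most four elements, whatever
  the size of the box.
\<close>

definition touching :: "int \<Rightarrow> int \<Rightarrow> int set" where
  "touching i j = {i - 1, i, j - 1, j}"

definition supported :: "nat \<Rightarrow> matrix \<Rightarrow> bool" where
  "supported R c \<longleftrightarrow> (\<forall>i j. c i j \<noteq> 0 \<longrightarrow> \<bar>i\<bar> \<le> int R \<and> \<bar>j\<bar> \<le> int R)"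

definition symm :: "matrix \<Rightarrow> bool" where
  "symm c \<longleftrightarrow> (\<forall>i j. c i j = c j i)"

definition hollow :: "matrix \<Rightarrow> bool" where
  "hollow c \<longleftrightarrow> (\<forall>i. c i i = 0)"

text \<open>
  A quadratic form and a scalar product are taken over a box given by its radius.  For a matrix
  supported in a smaller box the value does not depend on the radius, which allows the radius to be
  enlarged whenever a matrix spreads.
\<close>

definition quad :: "nat \<Rightarrow> matrix \<Rightarrow> config \<Rightarrow> real" where
  "quad l c \<omega> = (\<Sum>i\<in>box l. \<Sum>j\<in>box l. c i j * \<omega> i * \<omega> j)"

definition dot :: "nat \<Rightarrow> matrix \<Rightarrow> matrix \<Rightarrow> real" where
  "dot l c d = (\<Sum>i\<in>box l. \<Sum>j\<in>box l. c i j * d i j)"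

lemma swap_site_involution [simp]: "swap_site x (swap_site x i) = i"
  by (simp add: swap_site_def)

lemma swap_site_inj [simp]: "swap_site x i = swap_site x j \<longleftrightarrow> i = j"
  by (metis swap_site_involution)

lemma finite_touching [simp]: "finite (touching i j)"
  by (simp add: touching_def)

lemma swap_site_touching: "x \<notin> touching i j \<Longrightarrow> swap_site x i = i \<and> swap_site x j = j"
  by (auto simp: swap_site_def touching_def)

lemma swap_site_box: "x \<in> bonds l \<Longrightarrow> \<bar>swap_site x i\<bar> \<le> int l \<longleftrightarrow> \<bar>i\<bar> \<le> int l"
  by (auto simp: swap_site_def)

lemma sum_swap_site: "x \<in> bonds l \<Longrightarrow> (\<Sum>i\<in>box l. f (swap_site x i)) = (\<Sum>i\<in>box l. f i)"
  by (rule sum.reindex_bij_witness[where i = "swap_site x" and j = "swap_site x"]) (auto simp: swap_site_box simp del: Diff_iff)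

lemma supported_mono: "supported R c \<Longrightarrow> R \<le> R' \<Longrightarrow> supported R' c"
  unfolding supported_def by (meson of_nat_mono order_trans)

lemma sum_box_mono:
  assumes "R \<le> R'" "\<And>i. \<bar>i\<bar> > int R \<Longrightarrow> f i = 0"
  shows "sum f (box R') = sum f (box R)"
  by (rule sum.mono_neutral_right) (use assms in auto)

lemma dot_mono:
  assumes "supported R c" "R \<le> R'"
  shows "dot R' c d = dot R c d"
proof -
  have z: "c i j = 0" if "\<bar>i\<bar> > int R \<or> \<bar>j\<bar> > int R" for i j
    using that assms(1) unfolding supported_def by fastforce
  have "(\<Sum>j\<in>box R'. c i j * d i j) = (\<Sum>j\<in>box R. c i j * d i j)" for i
    by (rule sum_box_mono[OF assms(2)]) (simp add: z)
  then show ?thesis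
    unfolding dot_def by (simp only:) (rule sum_box_mono[OF assms(2)], simp add: z)
qed

lemma quad_mono:
  assumes "supported R c" "R \<le> R'"
  shows "quad R' c \<omega> = quad R c \<omega>"
  using dot_mono[OF assms, of "\<lambda>i j. \<omega> i * \<omega> j"] by (simp add: quad_def dot_def mult.assoc)

lemma dot_commute: "dot l c d = dot l d c"
  by (simp add: dot_def mult.commute)

lemma exchange_swap_site: "exchange x \<omega> i = \<omega> (swap_site x i)"
  by (simp add: exchange_def swap_site_def)

lemma flip_eq_sign: "flip x \<omega> i = flip_sign x i * \<omega> i"
  by (simp add: flip_def flip_sign_def)

lemma quad_flip: "quad l c (flip x \<omega>) = quad l (\<lambda>i j. flip_sign x i * flip_sign x j * c i j) \<omega>"
  by (simp add: quad_def flip_eq_sign mult_ac)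

lemma quad_exchange:
  assumes "x \<in> bonds l"
  shows "quad l c (exchange x \<omega>) = quad l (\<lambda>i j. c (swap_site x i) (swap_site x j)) \<omega>"
  unfolding quad_def exchange_swap_site
  using sum_swap_site[OF assms, of "\<lambda>i. \<Sum>j\<in>box l. c i (swap_site x j) * \<omega> (swap_site x i) * \<omega> j"]
    sum_swap_site[OF assms, of "\<lambda>j. c _ j * \<omega> (swap_site x _) * \<omega> (swap_site x j)"]
  by simp

lemma quad_add: "quad l c \<omega> + quad l d \<omega> = quad l (\<lambda>i j. c i j + d i j) \<omega>"
  by (simp add: quad_def sum.distrib distrib_right)

lemma quad_diff: "quad l c \<omega> - quad l d \<omega> = quad l (\<lambda>i j. c i j - d i j) \<omega>"
  by (simp add: quad_def sum_subtractf left_diff_distrib)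

lemma quad_minus: "- quad l c \<omega> = quad l (\<lambda>i j. - c i j) \<omega>"
  by (simp add: quad_def sum_negf)

lemma quad_cmult: "a * quad l c \<omega> = quad l (\<lambda>i j. a * c i j) \<omega>"
  by (simp add: quad_def sum_distrib_left mult_ac)

lemma quad_sum: "(\<Sum>x\<in>S. quad l (c x) \<omega>) = quad l (\<lambda>i j. \<Sum>x\<in>S. c x i j) \<omega>"
proof (induction S rule: infinite_finite_induct)
  case (insert x S)
  then show ?case by (simp add: quad_add)
qed (simp_all add: quad_def)

lemma quad_cong: "(\<And>i j. \<bar>i\<bar> \<le> int l \<Longrightarrow> \<bar>j\<bar> \<le> int l \<Longrightarrow> c i j = d i j) \<Longrightarrow> quad l c \<omega> = quad l d \<omega>"
  unfolding quad_def by (intro sum.cong) auto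

lemma dot_cong: "(\<And>i j. \<bar>i\<bar> \<le> int l \<Longrightarrow> \<bar>j\<bar> \<le> int l \<Longrightarrow> c i j * d i j = c' i j * d' i j) \<Longrightarrow> dot l c d = dot l c' d'"
  unfolding dot_def by (intro sum.cong) auto

lemma dot_sum_left: "dot l (\<lambda>i j. \<Sum>x\<in>S. c x i j) d = (\<Sum>x\<in>S. dot l (c x) d)"
proof (induction S rule: infinite_finite_induct)
  case (insert x S)
  then show ?case by (simp add: dot_def distrib_right sum.distrib)
qed (simp_all add: dot_def)

lemma dot_add_left: "dot l (\<lambda>i j. c i j + c' i j) d = dot l c d + dot l c' d"
  by (simp add: dot_def distrib_right sum.distrib)

lemma dot_diff_left: "dot l (\<lambda>i j. c i j - c' i j) d = dot l c d - dot l c' d"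
  by (simp add: dot_def left_diff_distrib sum_subtractf)

lemma dot_cmult_left: "dot l (\<lambda>i j. a * c i j) d = a * dot l c d"
  by (simp add: dot_def sum_distrib_left mult_ac)

lemma dot_swap_site:
  assumes "x \<in> bonds l"
  shows "dot l (\<lambda>i j. c (swap_site x i) (swap_site x j)) d = dot l c (\<lambda>i j. d (swap_site x i) (swap_site x j))"
  unfolding dot_def
  using sum_swap_site[OF assms, of "\<lambda>i. \<Sum>j\<in>box l. c i (swap_site x j) * d (swap_site x i) j"]
    sum_swap_site[OF assms, of "\<lambda>j. c _ j * d (swap_site x _) (swap_site x j)"]
  by simp

lemma abs_dot_le:
  assumes "\<And>i j. \<bar>d i j\<bar> \<le> K"
  shows "\<bar>dot l c d\<bar> \<le> (\<Sum>i\<in>box l. \<Sum>j\<in>box l. \<bar>c i j\<bar>) * K"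
proof -
  have "\<bar>dot l c d\<bar> \<le> (\<Sum>i\<in>box l. \<bar>\<Sum>j\<in>box l. c i j * d i j\<bar>)"
    unfolding dot_def by (rule sum_abs)
  also have "\<dots> \<le> (\<Sum>i\<in>box l. \<Sum>j\<in>box l. \<bar>c i j * d i j\<bar>)"
    by (intro sum_mono sum_abs)
  also have "\<dots> \<le> (\<Sum>i\<in>box l. \<Sum>j\<in>box l. \<bar>c i j\<bar> * K)"
    by (intro sum_mono) (simp add: abs_mult assms mult_left_mono)
  finally show ?thesis by (simp add: sum_distrib_right)
qed

section \<open>The generator on coefficient matrices\<close>

locale rates =
  fixes \<gamma> lam :: real
  assumes \<gamma>_pos: "\<gamma> > 0" and lam_pos: "lam > 0"
begin

text \<open>
  Minus the generator in terms of the coefficients, with exchanges over the bonds in \<open>X\<close> only.  The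
  sum is restricted to the bonds that touch \<open>i\<close> or \<open>j\<close>, so that the definition makes sense for the
  infinite lattice, \<open>X = UNIV\<close>, as well as for a box, \<open>X = bonds l\<close>.
\<close>

definition neg_gen :: "int set \<Rightarrow> matrix \<Rightarrow> matrix" where
  "neg_gen X c i j = (if i = j then 0 else 4 * \<gamma> * c i j)
     + lam * (\<Sum>x\<in>X \<inter> touching i j. c i j - c (swap_site x i) (swap_site x j))"

lemma neg_gen_finite:
  assumes "finite X"
  shows "neg_gen X c i j = (if i = j then 0 else 4 * \<gamma> * c i j)
     + lam * (\<Sum>x\<in>X. c i j - c (swap_site x i) (swap_site x j))"
proof -
  have "(\<Sum>x\<in>X \<inter> touching i j. c i j - c (swap_site x i) (swap_site x j)) = (\<Sum>x\<in>X. c i j - c (swap_site x i) (swap_site x j))"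
    by (rule sum.mono_neutral_left) (use assms in auto, metis swap_site_touching)
  then show ?thesis by (simp add: neg_gen_def)
qed

text \<open>
  The bonds that leave the box of radius \<open>l\<close> only see coefficients that vanish.
\<close>

lemma neg_gen_bonds:
  assumes c: "supported R c" and R: "R < l"
  shows "neg_gen UNIV c = neg_gen (bonds l) c"
proof (intro ext)
  fix i j
  have "c i j - c (swap_site x i) (swap_site x j) = 0" if "x \<notin> bonds l" for x
  proof (cases "c i j = 0 \<and> c (swap_site x i) (swap_site x j) = 0")
    case False
    then have "(\<bar>i\<bar> \<le> int R \<and> \<bar>j\<bar> \<le> int R) \<or> (\<bar>swap_site x i\<bar> \<le> int R \<and> \<bar>swap_site x j\<bar> \<le> int R)"
      using c unfolding supported_def by blast
    then have "swap_site x i = i \<and> swap_site x j = j"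
      using that R by (auto simp: swap_site_def split: if_splits)
    then show ?thesis by simp
  qed simp
  then have "(\<Sum>x\<in>UNIV \<inter> touching i j. c i j - c (swap_site x i) (swap_site x j)) = (\<Sum>x\<in>bonds l \<inter> touching i j. c i j - c (swap_site x i) (swap_site x j))"
    by (intro sum.mono_neutral_right) (simp, blast, blast)
  then show "neg_gen UNIV c i j = neg_gen (bonds l) c i j" by (simp add: neg_gen_def)
qed

lemma supported_neg_gen_bonds:
  assumes "supported l c"
  shows "supported l (neg_gen (bonds l) c)"
  unfolding supported_def
proof (intro allI impI)
  fix i j assume ne: "neg_gen (bonds l) c i j \<noteq> 0"
  show "\<bar>i\<bar> \<le> int l \<and> \<bar>j\<bar> \<le> int l"
  proof (rule ccontr)
    assume out: "\<not> (\<bar>i\<bar> \<le> int l \<and> \<bar>j\<bar> \<le> int l)"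
    then have "c i j = 0" "\<And>x. x \<in> bonds l \<Longrightarrow> c (swap_site x i) (swap_site x j) = 0"
      using assms swap_site_box unfolding supported_def by blast+
    then show False using ne by (simp add: neg_gen_def del: Diff_iff split: if_splits)
  qed
qed

lemma supported_neg_gen:
  assumes "supported R c"
  shows "supported (Suc R) (neg_gen UNIV c)"
  using supported_neg_gen_bonds[OF supported_mono[OF assms, of "Suc R"]] neg_gen_bonds[OF assms, of "Suc R"] by simp

lemma symm_neg_gen: "symm c \<Longrightarrow> symm (neg_gen X c)"
  unfolding symm_def neg_gen_def touching_def by (simp add: insert_commute)

lemma hollow_neg_gen: "hollow c \<Longrightarrow> hollow (neg_gen X c)"
  unfolding hollow_def neg_gen_def by simp

lemma neg_gen_add: "neg_gen X (\<lambda>i j. c i j + d i j) i j = neg_gen X c i j + neg_gen X d i j"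
  by (simp add: neg_gen_def algebra_simps sum.distrib sum_subtractf)

lemma neg_gen_sum: "neg_gen X (\<lambda>i j. \<Sum>a\<in>S. c a i j) i j = (\<Sum>a\<in>S. neg_gen X (c a) i j)"
proof (induction S rule: infinite_finite_induct)
  case (insert a S)
  then show ?case by (simp add: neg_gen_add)
qed (simp_all add: neg_gen_def)

lemma neg_gen_cmult: "neg_gen X (\<lambda>i j. a * c i j) i j = a * neg_gen X c i j"
  by (simp add: neg_gen_def algebra_simps sum_distrib_left[symmetric] sum_subtractf)

lemma neg_gen_translate: "neg_gen UNIV (\<lambda>i j. c (i - x) (j - x)) i j = neg_gen UNIV c (i - x) (j - x)"
proof -
  have "(\<Sum>y\<in>touching i j. c (i - x) (j - x) - c (swap_site y i - x) (swap_site y j - x))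
      = (\<Sum>y\<in>touching (i - x) (j - x). c (i - x) (j - x) - c (swap_site y (i - x)) (swap_site y (j - x)))"
    by (rule sum.reindex_bij_witness[where i = "\<lambda>y. y + x" and j = "\<lambda>y. y - x"])
      (auto simp: touching_def swap_site_def algebra_simps)
  then show ?thesis by (simp add: neg_gen_def)
qed

lemma dot_neg_gen:
  "dot l (neg_gen (bonds l) c) d = 4 * \<gamma> * dot l (\<lambda>i j. if i = j then 0 else c i j) d
     + lam * (\<Sum>x\<in>bonds l. dot l (\<lambda>i j. c i j - c (swap_site x i) (swap_site x j)) d)"
proof -
  have "neg_gen (bonds l) c = (\<lambda>i j. 4 * \<gamma> * (if i = j then 0 else c i j)
      + lam * (\<Sum>x\<in>bonds l. c i j - c (swap_site x i) (swap_site x j)))"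
    by (intro ext) (simp add: neg_gen_finite)
  then show ?thesis by (simp only: dot_add_left dot_cmult_left dot_sum_left)
qed

lemma neg_gen_symmetric: "dot l (neg_gen (bonds l) c) d = dot l c (neg_gen (bonds l) d)"
proof -
  have "dot l (\<lambda>i j. c i j - c (swap_site x i) (swap_site x j)) d = dot l (\<lambda>i j. d i j - d (swap_site x i) (swap_site x j)) c"
    if "x \<in> bonds l" for x
    using dot_swap_site[OF that, of c d] by (simp add: dot_diff_left dot_commute)
  moreover have "dot l (\<lambda>i j. if i = j then 0 else c i j) d = dot l (\<lambda>i j. if i = j then 0 else d i j) c"
    by (rule dot_cong) simp
  ultimately show ?thesis
    by (subst (2) dot_commute) (simp add: dot_neg_gen del: Diff_iff)
qed

lemma sum_flip_signs:
  assumes "\<bar>i\<bar> \<le> int l" "\<bar>j\<bar> \<le> int l"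
  shows "(\<Sum>x\<in>box l. flip_sign x i * flip_sign x j - 1) = (if i = j then 0 else - 4)"
proof (cases "i = j")
  case False
  have "flip_sign x i * flip_sign x j - 1 = - 2 * (of_bool (x = i) + of_bool (x = j))" for x
    using False by (auto simp: flip_sign_def)
  then have "(\<Sum>x\<in>box l. flip_sign x i * flip_sign x j - 1) = - 2 * ((\<Sum>x\<in>box l. of_bool (x = i)) + (\<Sum>x\<in>box l. of_bool (x = j)))"
    by (simp only: sum_distrib_left[symmetric] sum.distrib)
  also have "\<dots> = -4" using assms by (simp add: of_bool_def)
  finally show ?thesis using False by simp
next
  case True
  have "flip_sign x i * flip_sign x i = 1" for x by (simp add: flip_sign_def)
  then show ?thesis using True by simp
qed

text \<open>
  A monomial \<open>\<omega> i * \<omega> j\<close> with \<open>i \<noteq> j\<close> changes sign under the flips at \<open>i\<close> and at \<open>j\<close>, each of which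
  therefore takes away twice the monomial; this is the factor \<open>4 * \<gamma>\<close>.
\<close>

lemma generator_quad: "generator \<gamma> lam l (\<lambda>m. quad l (c m)) m \<omega> = - quad l (neg_gen (bonds l) (c m)) \<omega>"
proof -
  have "\<gamma> * (\<Sum>x\<in>box l. quad l (c m) (flip x \<omega>) - quad l (c m) \<omega>)
      = quad l (\<lambda>i j. \<gamma> * (\<Sum>x\<in>box l. flip_sign x i * flip_sign x j * c m i j - c m i j)) \<omega>"
    by (simp only: quad_flip quad_diff quad_sum quad_cmult)
  also have "\<dots> = quad l (\<lambda>i j. - (if i = j then 0 else 4 * \<gamma> * c m i j)) \<omega>"
  proof (rule quad_cong)
    fix i j assume "\<bar>i\<bar> \<le> int l" "\<bar>j\<bar> \<le> int l"
    have "(\<Sum>x\<in>box l. flip_sign x i * flip_sign x j * c m i j - c m i j) = (\<Sum>x\<in>box l. flip_sign x i * flip_sign x j - 1) * c m i j"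
      by (simp add: sum_distrib_right left_diff_distrib)
    then show "\<gamma> * (\<Sum>x\<in>box l. flip_sign x i * flip_sign x j * c m i j - c m i j) = - (if i = j then 0 else 4 * \<gamma> * c m i j)"
      using sum_flip_signs[OF \<open>\<bar>i\<bar> \<le> int l\<close> \<open>\<bar>j\<bar> \<le> int l\<close>] by simp
  qed
  finally have fl: "\<gamma> * (\<Sum>x\<in>box l. quad l (c m) (flip x \<omega>) - quad l (c m) \<omega>) = \<dots>" .
  have "(\<Sum>x\<in>bonds l. quad l (c m) (exchange x \<omega>) - quad l (c m) \<omega>)
      = (\<Sum>x\<in>bonds l. quad l (\<lambda>i j. c m (swap_site x i) (swap_site x j)) \<omega> - quad l (c m) \<omega>)"
    by (intro sum.cong) (simp_all only: quad_exchange)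
  then have ex: "lam * (\<Sum>x\<in>bonds l. quad l (c m) (exchange x \<omega>) - quad l (c m) \<omega>)
      = quad l (\<lambda>i j. lam * (\<Sum>x\<in>bonds l. c m (swap_site x i) (swap_site x j) - c m i j)) \<omega>"
    by (simp only: quad_diff quad_sum quad_cmult)
  have "generator \<gamma> lam l (\<lambda>m. quad l (c m)) m \<omega> = quad l (\<lambda>i j. - (if i = j then 0 else 4 * \<gamma> * c m i j)
     + lam * (\<Sum>x\<in>bonds l. c m (swap_site x i) (swap_site x j) - c m i j)) \<omega>"
    by (simp only: generator_def grad_flip_def grad_exch_def fl ex quad_add)
  also have "\<dots> = - quad l (neg_gen (bonds l) (c m)) \<omega>"
    unfolding quad_minus
  proof (rule quad_cong)
    fix i j
    have "(\<Sum>x\<in>bonds l. c m (swap_site x i) (swap_site x j) - c m i j) = - (\<Sum>x\<in>bonds l. c m i j - c m (swap_site x i) (swap_site x j))"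
      by (simp only: sum_negf[symmetric] minus_diff_eq)
    then show "- (if i = j then 0 else 4 * \<gamma> * c m i j) + lam * (\<Sum>x\<in>bonds l. c m (swap_site x i) (swap_site x j) - c m i j)
        = - neg_gen (bonds l) (c m) i j"
      by (simp add: neg_gen_finite)
  qed
  finally show ?thesis .
qed

text \<open>
  The number \<open>rate\<close> bounds the diagonal part of \<open>neg_gen X\<close> off the diagonal of the matrix: a pair is
  killed at rate \<open>4 * \<gamma>\<close> and moved by at most four bonds.  Dividing by it leaves in \<open>relax X\<close> a
  substochastic operator whose rows sum to \<open>r\<close>.
\<close>

definition rate :: real where "rate = 4 * \<gamma> + 4 * lam"
definition r :: real where "r = lam / (\<gamma> + lam)"

definition relax :: "int set \<Rightarrow> matrix \<Rightarrow> matrix" where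
  "relax X c i j = c i j - neg_gen X c i j / rate"

lemma rate_pos: "rate > 0" and r_bounds: "0 \<le> r" "r < 1" and rate_r: "rate * (1 - r) = 4 * \<gamma>"
  using \<gamma>_pos lam_pos by (auto simp: rate_def r_def field_simps)

lemma supported_relaxI: "supported R c \<Longrightarrow> supported R (neg_gen X c) \<Longrightarrow> supported R (relax X c)"
  unfolding relax_def supported_def by (metis diff_zero div_0)

lemma supported_relax: "supported R c \<Longrightarrow> supported (Suc R) (relax UNIV c)"
  using supported_neg_gen[of R c] supported_mono[of R c "Suc R"] by (intro supported_relaxI) auto

lemma supported_relax_bonds: "supported l c \<Longrightarrow> supported l (relax (bonds l) c)"
  using supported_neg_gen_bonds[of l c] by (intro supported_relaxI) auto

lemma symm_relax: "symm c \<Longrightarrow> symm (relax X c)"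
  using symm_neg_gen[of c X] unfolding relax_def symm_def by metis

lemma hollow_relax: "hollow c \<Longrightarrow> hollow (relax X c)"
  using hollow_neg_gen[of c X] unfolding relax_def hollow_def by simp

text \<open>
  Off the diagonal \<open>rate * relax X c i j\<close> is a combination of entries of \<open>c\<close> with nonnegative weights
  of total \<open>4 * lam\<close>.
\<close>

lemma relax_bound:
  assumes h: "hollow c" and K: "\<And>i j. \<bar>c i j\<bar> \<le> K"
  shows "\<bar>relax X c i j\<bar> \<le> r * K"
proof (cases "i = j")
  case True
  have "0 \<le> K" using K[of 0 0] by linarith
  then show ?thesis using True hollow_relax[OF h, of X] r_bounds by (simp add: hollow_def)
next
  case False
  define N where "N = card (X \<inter> touching i j)"
  have "N \<le> card (touching i j)" unfolding N_def by (intro card_mono) auto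
  also have "\<dots> \<le> 4" using card_length[of "[i - 1, i, j - 1, j]"] by (simp add: touching_def)
  finally have N: "real N \<le> 4" by simp
  have "rate * relax X c i j = (4 * lam - lam * N) * c i j + lam * (\<Sum>x\<in>X \<inter> touching i j. c (swap_site x i) (swap_site x j))"
    using False rate_pos by (simp add: relax_def neg_gen_def N_def sum_subtractf field_simps) (simp add: rate_def algebra_simps)
  then have "\<bar>rate * relax X c i j\<bar> \<le> \<bar>(4 * lam - lam * N) * c i j\<bar> + \<bar>lam * (\<Sum>x\<in>X \<inter> touching i j. c (swap_site x i) (swap_site x j))\<bar>"
    by simp
  also have "\<dots> \<le> (4 * lam - lam * N) * K + lam * (N * K)"
  proof (rule add_mono)
    have "0 \<le> 4 * lam - lam * N" using lam_pos N by simp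
    then show "\<bar>(4 * lam - lam * N) * c i j\<bar> \<le> (4 * lam - lam * N) * K"
      unfolding abs_mult using K[of i j] by (simp only: abs_of_nonneg) (rule mult_left_mono)
    have "\<bar>\<Sum>x\<in>X \<inter> touching i j. c (swap_site x i) (swap_site x j)\<bar> \<le> (\<Sum>x\<in>X \<inter> touching i j. K)"
      by (rule order_trans[OF sum_abs]) (intro sum_mono K)
    then show "\<bar>lam * (\<Sum>x\<in>X \<inter> touching i j. c (swap_site x i) (swap_site x j))\<bar> \<le> lam * (N * K)"
      using lam_pos by (simp add: abs_mult N_def)
  qed
  also have "\<dots> = rate * (r * K)"
    using \<gamma>_pos lam_pos by (simp add: rate_def r_def field_simps)
  finally show ?thesis using rate_pos by (simp add: abs_mult)
qed

lemma relax_power_props: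
  "symm c \<Longrightarrow> symm ((relax X ^^ n) c)"
  "hollow c \<Longrightarrow> hollow ((relax X ^^ n) c)"
  "supported l c \<Longrightarrow> supported l ((relax (bonds l) ^^ n) c)"
  "supported R c \<Longrightarrow> supported (R + n) ((relax UNIV ^^ n) c)"
  by (induction n) (auto simp: symm_relax hollow_relax supported_relax_bonds supported_relax simp del: Diff_iff)

lemma relax_power_bound:
  assumes h: "hollow c" and K: "\<And>i j. \<bar>c i j\<bar> \<le> K"
  shows "\<bar>(relax X ^^ n) c i j\<bar> \<le> r ^ n * K"
proof (induction n arbitrary: i j)
  case (Suc n)
  have "\<bar>relax X ((relax X ^^ n) c) i j\<bar> \<le> r * (r ^ n * K)"
    by (rule relax_bound[OF relax_power_props(2)[OF h]]) (rule Suc.IH)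
  then show ?case by (simp add: mult.assoc)
qed (simp add: K)

text \<open>
  The partial sums of the Neumann series on the infinite lattice: a local approximate inverse.
\<close>

definition neumann_sum :: "nat \<Rightarrow> matrix \<Rightarrow> matrix" where
  "neumann_sum n c i j = (\<Sum>k<n. (relax UNIV ^^ k) c i j) / rate"

lemma neg_gen_eq_relax: "neg_gen X c i j = rate * (c i j - relax X c i j)"
  using rate_pos by (simp add: relax_def)

lemma neg_gen_neumann_sum: "neg_gen UNIV (neumann_sum n c) i j = c i j - (relax UNIV ^^ n) c i j"
proof -
  have "neumann_sum n c = (\<lambda>i j. 1 / rate * (\<Sum>k<n. (relax UNIV ^^ k) c i j))"
    by (intro ext) (simp add: neumann_sum_def)
  then have "neg_gen UNIV (neumann_sum n c) i j = 1 / rate * (\<Sum>k<n. neg_gen UNIV ((relax UNIV ^^ k) c) i j)"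
    by (simp only: neg_gen_cmult neg_gen_sum)
  also have "\<dots> = (\<Sum>k<n. (relax UNIV ^^ k) c i j - (relax UNIV ^^ Suc k) c i j)"
    using rate_pos by (simp add: neg_gen_eq_relax sum_distrib_left[symmetric])
  also have "\<dots> = c i j - (relax UNIV ^^ n) c i j"
    by (subst sum_lessThan_telescope') simp
  finally show ?thesis .
qed

lemma symm_neumann_sum: "symm c \<Longrightarrow> symm (neumann_sum n c)"
  using relax_power_props(1)[where X = UNIV and c = c] unfolding neumann_sum_def symm_def by simp

lemma hollow_neumann_sum: "hollow c \<Longrightarrow> hollow (neumann_sum n c)"
  using relax_power_props(2)[where X = UNIV and c = c] unfolding neumann_sum_def hollow_def by simp

lemma supported_neumann_sum:
  assumes "supported R c"
  shows "supported (R + n) (neumann_sum n c)"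
  unfolding supported_def
proof (intro allI impI)
  fix i j assume "neumann_sum n c i j \<noteq> 0"
  then obtain k where "k < n" "(relax UNIV ^^ k) c i j \<noteq> 0"
    unfolding neumann_sum_def by (metis (no_types, lifting) div_0 lessThan_iff sum.neutral)
  then show "\<bar>i\<bar> \<le> int (R + n) \<and> \<bar>j\<bar> \<le> int (R + n)"
    using supported_mono[OF relax_power_props(4)[OF assms, of k], of "R + n"] unfolding supported_def by simp
qed

lemma geometric_bound: "(\<Sum>k<n. r ^ k) / rate \<le> 1 / (4 * \<gamma>)"
proof -
  have "(\<Sum>k<n. r ^ k) * (1 - r) = 1 - r ^ n"
    using one_diff_power_eq[of r n] by (simp add: mult.commute)
  also have "\<dots> \<le> 1" using r_bounds by simp
  finally have "(\<Sum>k<n. r ^ k) * (1 - r) \<le> 1" .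
  then have "(\<Sum>k<n. r ^ k) * (1 - r) * rate \<le> rate" using rate_pos by simp
  moreover have "(\<Sum>k<n. r ^ k) * (1 - r) * rate = (\<Sum>k<n. r ^ k) * (4 * \<gamma>)"
    by (simp only: mult.assoc mult.commute[of "1 - r"] rate_r)
  ultimately have "(\<Sum>k<n. r ^ k) * (4 * \<gamma>) \<le> rate" by simp
  then show ?thesis using rate_pos \<gamma>_pos by (simp add: field_simps)
qed

lemma neumann_sum_bound:
  assumes h: "hollow c" and K: "\<And>i j. \<bar>c i j\<bar> \<le> K"
  shows "\<bar>neumann_sum n c i j\<bar> \<le> K / (4 * \<gamma>)"
proof -
  have K0: "0 \<le> K" using K[of 0 0] by linarith
  have "\<bar>neumann_sum n c i j\<bar> \<le> (\<Sum>k<n. \<bar>(relax UNIV ^^ k) c i j\<bar>) / rate"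
    unfolding neumann_sum_def using rate_pos by (simp add: divide_right_mono)
  also have "\<dots> \<le> (\<Sum>k<n. r ^ k * K) / rate"
    using rate_pos relax_power_bound[OF h K] by (intro divide_right_mono sum_mono) auto
  also have "\<dots> = (\<Sum>k<n. r ^ k) / rate * K" by (simp add: sum_distrib_right)
  also have "\<dots> \<le> 1 / (4 * \<gamma>) * K"
    by (intro mult_right_mono geometric_bound K0)
  finally show ?thesis by simp
qed

text \<open>
  The inverse of \<open>neg_gen X\<close> on bounded matrices with zero diagonal.
\<close>

definition neumann_series :: "int set \<Rightarrow> matrix \<Rightarrow> matrix" where
  "neumann_series X c i j = (\<Sum>k. (relax X ^^ k) c i j) / rate"

lemma summable_relax_power:
  assumes h: "hollow c" and K: "\<And>i j. \<bar>c i j\<bar> \<le> K"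
  shows "summable (\<lambda>k. (relax X ^^ k) c i j)"
proof (rule summable_comparison_test)
  show "\<exists>N. \<forall>n\<ge>N. norm ((relax X ^^ n) c i j) \<le> r ^ n * K"
    using relax_power_bound[OF h K] by auto
  show "summable (\<lambda>n. r ^ n * K)"
    using r_bounds by (intro summable_mult2 summable_geometric) auto
qed

lemma neg_gen_neumann_series:
  assumes h: "hollow c" and K: "\<And>i j. \<bar>c i j\<bar> \<le> K"
  shows "neg_gen X (neumann_series X c) i j = c i j"
proof -
  note sm = summable_relax_power[OF h K, where X = X]
  have sA: "neg_gen X (\<lambda>i j. \<Sum>k. (relax X ^^ k) c i j) i j = (\<Sum>k. neg_gen X ((relax X ^^ k) c) i j)"
  proof -
    have s1: "summable (\<lambda>k. \<Sum>x\<in>X \<inter> touching i j. (relax X ^^ k) c i j - (relax X ^^ k) c (swap_site x i) (swap_site x j))"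
      by (intro summable_sum summable_diff sm)
    have "(\<Sum>k. \<Sum>x\<in>X \<inter> touching i j. (relax X ^^ k) c i j - (relax X ^^ k) c (swap_site x i) (swap_site x j))
       = (\<Sum>x\<in>X \<inter> touching i j. (\<Sum>k. (relax X ^^ k) c i j) - (\<Sum>k. (relax X ^^ k) c (swap_site x i) (swap_site x j)))"
      by (subst suminf_sum) (auto intro: summable_diff sm simp: suminf_diff[OF sm sm])
    then show ?thesis
      using s1 by (cases "i = j")
        (simp_all add: neg_gen_def suminf_mult sm suminf_add[symmetric] summable_mult)
  qed
  have "neumann_series X c = (\<lambda>i j. 1 / rate * (\<Sum>k. (relax X ^^ k) c i j))"
    by (intro ext) (simp add: neumann_series_def)
  then have "neg_gen X (neumann_series X c) i j = 1 / rate * (\<Sum>k. neg_gen X ((relax X ^^ k) c) i j)"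
    by (simp only: neg_gen_cmult sA)
  also have "(\<lambda>k. neg_gen X ((relax X ^^ k) c) i j) = (\<lambda>k. rate * ((relax X ^^ k) c i j - (relax X ^^ Suc k) c i j))"
    by (simp add: neg_gen_eq_relax)
  also have "suminf \<dots> = rate * c i j"
  proof -
    have "(\<lambda>k. (relax X ^^ k) c i j) \<longlonglongrightarrow> 0" by (rule summable_LIMSEQ_zero[OF sm])
    then have "(\<lambda>k. (relax X ^^ k) c i j - (relax X ^^ Suc k) c i j) sums ((relax X ^^ 0) c i j - 0)"
      by (rule telescope_sums')
    from sums_mult[OF this, of rate] show ?thesis by (simp add: sums_iff)
  qed
  finally show ?thesis using rate_pos by simp
qed

lemma neumann_series_bound:
  assumes h: "hollow c" and K: "\<And>i j. \<bar>c i j\<bar> \<le> K"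
  shows "\<bar>neumann_series X c i j\<bar> \<le> K / (4 * \<gamma>)"
proof -
  have K0: "0 \<le> K" using K[of 0 0] by linarith
  have geo: "(\<lambda>n. r ^ n * K) sums (1 / (1 - r) * K)"
    using r_bounds by (intro sums_mult2 geometric_sums) auto
  have sabs: "summable (\<lambda>k. \<bar>(relax X ^^ k) c i j\<bar>)"
    by (rule summable_comparison_test[of _ "\<lambda>k. r ^ k * K"])
      (use relax_power_bound[OF h K] geo in \<open>auto simp: sums_iff\<close>)
  have "\<bar>\<Sum>k. (relax X ^^ k) c i j\<bar> \<le> (\<Sum>k. \<bar>(relax X ^^ k) c i j\<bar>)"
    by (rule summable_rabs[OF sabs])
  also have "\<dots> \<le> (\<Sum>k. r ^ k * K)"
    by (rule suminf_le[OF _ sabs]) (use relax_power_bound[OF h K] geo in \<open>auto simp: sums_iff\<close>)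
  also have "\<dots> = K / (1 - r)" using geo by (simp add: sums_iff)
  finally have "\<bar>neumann_series X c i j\<bar> \<le> K / (1 - r) / rate"
    using rate_pos by (simp add: neumann_series_def divide_right_mono del: divide_divide_eq_left)
  also have "\<dots> = K / (4 * \<gamma>)" using rate_r by (simp add: mult.commute)
  finally show ?thesis .
qed

lemma neumann_series_props:
  "symm c \<Longrightarrow> symm (neumann_series X c)"
  "hollow c \<Longrightarrow> hollow (neumann_series X c)"
  "supported l c \<Longrightarrow> supported l (neumann_series (bonds l) c)"
proof -
  show "symm (neumann_series X c)" if "symm c"
    unfolding symm_def neumann_series_def
  proof (intro allI)
    fix i j
    have "(\<lambda>k. (relax X ^^ k) c i j) = (\<lambda>k. (relax X ^^ k) c j i)"
      using relax_power_props(1)[OF that] unfolding symm_def by metis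
    then show "(\<Sum>k. (relax X ^^ k) c i j) / rate = (\<Sum>k. (relax X ^^ k) c j i) / rate" by simp
  qed
  show "hollow (neumann_series X c)" if "hollow c"
    using relax_power_props(2)[OF that] unfolding hollow_def neumann_series_def by simp
  show "supported l (neumann_series (bonds l) c)" if "supported l c"
    unfolding supported_def
  proof (intro allI impI, rule ccontr)
    fix i j assume ne: "neumann_series (bonds l) c i j \<noteq> 0" and out: "\<not> (\<bar>i\<bar> \<le> int l \<and> \<bar>j\<bar> \<le> int l)"
    have "(relax (bonds l) ^^ k) c i j = 0" for k
      using relax_power_props(3)[OF that, of k] out unfolding supported_def by blast
    then show False using ne by (simp add: neumann_series_def)
  qed
qed

end

section \<open>Matrix fields and their lattice sums\<close>

lemma infsum_finite_support:
  fixes f :: "'a \<Rightarrow> real"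
  assumes "finite S" "\<And>x. x \<notin> S \<Longrightarrow> f x = 0"
  shows "infsum f UNIV = sum f S"
proof -
  have "infsum f UNIV = infsum f S"
    by (rule infsum_cong_neutral) (use assms in auto)
  then show ?thesis using assms(1) by simp
qed

lemma shift_shift: "shift x (shift y m) = shift (x + y) m"
  by (simp add: shift_def fun_eq_iff algebra_simps)

lemma shift_0 [simp]: "shift 0 m = m"
  by (simp add: shift_def fun_eq_iff)

type_synonym mfield = "config \<Rightarrow> matrix"

text \<open>
  If \<open>c\<close> is the coefficient matrix of \<open>f\<close>, then \<open>tau x c\<close> is that of \<open>translate x f\<close>, and \<open>Gam c\<close> is that
  of the formal sum \<open>\<Gamma>\<^sub>f\<close>.  The latter is an infinite band matrix whose entries are finite sums.
\<close>

definition tau :: "int \<Rightarrow> mfield \<Rightarrow> mfield" where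
  "tau x c m i j = c (shift x m) (i - x) (j - x)"

definition Gam :: "mfield \<Rightarrow> mfield" where
  "Gam c m i j = (\<Sum>\<^sub>\<infinity>x. tau x c m i j)"

lemma supported_tau:
  assumes "\<And>m. supported R (c m)"
  shows "supported (R + nat \<bar>x\<bar>) (tau x c m)"
  unfolding supported_def
proof (intro allI impI)
  fix i j assume "tau x c m i j \<noteq> 0"
  then have "\<bar>i - x\<bar> \<le> int R \<and> \<bar>j - x\<bar> \<le> int R"
    using assms unfolding supported_def tau_def by blast
  then show "\<bar>i\<bar> \<le> int (R + nat \<bar>x\<bar>) \<and> \<bar>j\<bar> \<le> int (R + nat \<bar>x\<bar>)" by auto
qed

lemma tau_zero:
  assumes "\<And>m. supported R (c m)" "\<bar>i - x\<bar> > int R \<or> \<bar>j - x\<bar> > int R"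
  shows "tau x c m i j = 0"
  using assms unfolding supported_def tau_def by (metis linorder_not_less)

lemma Gam_eq:
  assumes "\<And>m. supported R (c m)" "finite S" "{i - int R..i + int R} \<subseteq> S \<or> {j - int R..j + int R} \<subseteq> S"
  shows "Gam c m i j = (\<Sum>x\<in>S. tau x c m i j)"
  unfolding Gam_def
proof (rule infsum_finite_support)
  fix x assume "x \<notin> S"
  then have "x \<notin> {i - int R..i + int R} \<or> x \<notin> {j - int R..j + int R}" using assms(3) by blast
  then show "tau x c m i j = 0" by (intro tau_zero[OF assms(1)]) auto
qed (rule assms)

lemma Gam_shift:
  assumes "\<And>m. supported R (c m)"
  shows "Gam c (shift y m) (i - y) (j - y) = Gam c m i j"
proof -
  have "Gam c (shift y m) (i - y) (j - y) = (\<Sum>x\<in>{i - y - int R..i - y + int R}. tau x c (shift y m) (i - y) (j - y))"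
    by (rule Gam_eq[OF assms]) auto
  also have "\<dots> = (\<Sum>x\<in>{i - int R..i + int R}. tau x c m i j)"
    by (rule sum.reindex_bij_witness[where i = "\<lambda>x. x - y" and j = "\<lambda>x. x + y"])
      (auto simp: tau_def shift_shift algebra_simps)
  also have "\<dots> = Gam c m i j"
    by (rule Gam_eq[OF assms, symmetric]) auto
  finally show ?thesis .
qed

lemma Gam_shift':
  assumes "\<And>m. supported R (c m)"
  shows "Gam c (shift y m) i j = Gam c m (i + y) (j + y)"
  using Gam_shift[OF assms, where y = y and m = m and i = "i + y" and j = "j + y"] by simp

lemma symm_Gam: "(\<And>m. symm (c m)) \<Longrightarrow> symm (Gam c m)"
  unfolding symm_def Gam_def tau_def by simp

lemma Gam_bound:
  assumes "\<And>m. supported R (c m)" and K: "\<And>x i j. \<bar>tau x c m i j\<bar> \<le> K"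
  shows "\<bar>Gam c m i j\<bar> \<le> (2 * real R + 1) * K"
proof -
  have "\<bar>Gam c m i j\<bar> = \<bar>\<Sum>x\<in>{i - int R..i + int R}. tau x c m i j\<bar>"
    by (subst Gam_eq[OF assms(1), where S = "{i - int R..i + int R}"]) auto
  also have "\<dots> \<le> (\<Sum>x\<in>{i - int R..i + int R}. K)"
    by (rule order_trans[OF sum_abs]) (intro sum_mono K)
  finally show ?thesis by simp
qed

lemma dot_translate:
  assumes c: "supported R c" and N: "R + nat \<bar>x\<bar> \<le> N"
  shows "dot N c (\<lambda>i j. d (i - x) (j - x)) = dot N (\<lambda>i j. c (i + x) (j + x)) d"
proof -
  have z: "c i j = 0" if "\<bar>i\<bar> > int R \<or> \<bar>j\<bar> > int R" for i j
    using that c unfolding supported_def by fastforce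
  have inner: "(\<Sum>j\<in>box N. c i j * d (i - x) (j - x)) = (\<Sum>j\<in>box N. c i (j + x) * d (i - x) j)" for i
    by (rule sum.reindex_bij_witness_not_neutral[where i = "\<lambda>j. j + x" and j = "\<lambda>j. j - x"
          and S' = "{j\<in>box N. \<bar>j\<bar> > int R}" and T' = "{j\<in>box N. \<bar>j + x\<bar> > int R}"])
      (use N in \<open>auto simp: z intro: finite_subset[OF _ finite_box[of N]]\<close>)
  show ?thesis unfolding dot_def inner
    by (rule sum.reindex_bij_witness_not_neutral[where i = "\<lambda>j. j + x" and j = "\<lambda>j. j - x"
          and S' = "{j\<in>box N. \<bar>j\<bar> > int R}" and T' = "{j\<in>box N. \<bar>j + x\<bar> > int R}"])
      (use N in \<open>auto simp: z intro: finite_subset[OF _ finite_box[of N]]\<close>)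
qed

text \<open>
  Minus the gradients on the level of matrices.  A flip acts by the signs \<open>s\<close>, an exchange by the
  permutation \<open>p\<close>; both are written relative to the site \<open>x\<close>, which makes the covariance under
  translations evident and lets one argument serve for both moves.
\<close>

definition defect :: "(int \<Rightarrow> real) \<Rightarrow> (int \<Rightarrow> int) \<Rightarrow> int \<Rightarrow> matrix \<Rightarrow> matrix" where
  "defect s p x c i j = c i j - s (i - x) * s (j - x) * c (x + p (i - x)) (x + p (j - x))"

definition local_move :: "(int \<Rightarrow> real) \<Rightarrow> (int \<Rightarrow> int) \<Rightarrow> bool" where
  "local_move s p \<longleftrightarrow> (\<forall>i. i \<notin> {0, 1} \<longrightarrow> p i = i \<and> s i = 1) \<and> p ` {0, 1} \<subseteq> {0, 1}"

abbreviation "flip_defect \<equiv> defect (flip_sign 0) (\<lambda>i. i)"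
abbreviation "exchange_defect \<equiv> defect (\<lambda>_. 1) (swap_site 0)"

lemma local_moveD:
  assumes "local_move s p"
  shows "i \<noteq> 0 \<Longrightarrow> i \<noteq> 1 \<Longrightarrow> p i = i" "i \<noteq> 0 \<Longrightarrow> i \<noteq> 1 \<Longrightarrow> s i = 1"
    "i = 0 \<or> i = 1 \<Longrightarrow> p i = 0 \<or> p i = 1"
  using assms unfolding local_move_def by blast+

lemma local_move_displacement: "local_move s p \<Longrightarrow> \<bar>p i - i\<bar> \<le> 1"
  using local_moveD[of s p i] by (cases "i = 0 \<or> i = 1") auto

lemma local_move_flip: "local_move (flip_sign 0) (\<lambda>i. i)"
  by (auto simp: local_move_def flip_sign_def)

lemma local_move_exchange: "local_move (\<lambda>_. 1) (swap_site 0)"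
  by (auto simp: local_move_def swap_site_def)

lemma defect_flip: "flip_defect x c i j = c i j - flip_sign x i * flip_sign x j * c i j"
  by (simp add: defect_def flip_sign_def)

lemma defect_exchange: "exchange_defect x c i j = c i j - c (swap_site x i) (swap_site x j)"
proof -
  have "x + swap_site 0 (i - x) = swap_site x i" for i by (auto simp: swap_site_def)
  then show ?thesis by (simp add: defect_def)
qed

lemma supported_defect:
  assumes m: "local_move s p" and c: "supported R c"
  shows "supported (Suc R) (defect s p x c)"
  unfolding supported_def
proof (intro allI impI)
  fix i j assume "defect s p x c i j \<noteq> 0"
  then have "c i j \<noteq> 0 \<or> c (x + p (i - x)) (x + p (j - x)) \<noteq> 0" by (auto simp: defect_def)
  then have "(\<bar>i\<bar> \<le> int R \<and> \<bar>j\<bar> \<le> int R) \<or> (\<bar>x + p (i - x)\<bar> \<le> int R \<and> \<bar>x + p (j - x)\<bar> \<le> int R)"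
    using c unfolding supported_def by blast
  then show "\<bar>i\<bar> \<le> int (Suc R) \<and> \<bar>j\<bar> \<le> int (Suc R)"
    using local_move_displacement[OF m, of "i - x"] local_move_displacement[OF m, of "j - x"] by linarith
qed

lemma defect_sum: "defect s p x (\<lambda>i j. \<Sum>a\<in>S. c a i j) i j = (\<Sum>a\<in>S. defect s p x (c a) i j)"
  by (simp add: defect_def sum_subtractf sum_distrib_left)

lemma defect_far:
  assumes "local_move s p" "\<not> (i = x \<or> i = x + 1 \<or> j = x \<or> j = x + 1)"
  shows "defect s p x c i j = 0"
proof -
  have "p (i - x) = i - x" "p (j - x) = j - x" "s (i - x) = 1" "s (j - x) = 1"
    using assms(2) by (auto intro!: local_moveD[OF assms(1)])
  then show ?thesis by (simp add: defect_def)
qed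

text \<open>
  The lattice sum is a band matrix, and a move at the origin only affects the rows and columns \<open>0\<close>
  and \<open>1\<close>; what remains is a finite matrix.
\<close>

lemma supported_defect_Gam:
  assumes m: "local_move s p" and c: "\<And>m. supported R (c m)"
  shows "supported (2 * R + 2) (defect s p 0 (Gam c m))"
  unfolding supported_def
proof (intro allI impI)
  fix i j assume ne: "defect s p 0 (Gam c m) i j \<noteq> 0"
  have band: "\<bar>i - j\<bar> \<le> 2 * int R" if "Gam c m i j \<noteq> 0" for i j
  proof (rule ccontr)
    assume "\<not> ?thesis"
    then have "tau x c m i j = 0" for x by (intro tau_zero[OF c]) linarith
    then show False using that by (simp add: Gam_def)
  qed
  from ne have "Gam c m i j \<noteq> 0 \<or> Gam c m (p i) (p j) \<noteq> 0" by (auto simp: defect_def)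
  then have "\<bar>i - j\<bar> \<le> 2 * int R \<or> \<bar>p i - p j\<bar> \<le> 2 * int R" using band by blast
  moreover from ne defect_far[OF m, of i 0 j] have ij: "i = 0 \<or> i = 1 \<or> j = 0 \<or> j = 1" by auto
  ultimately show "\<bar>i\<bar> \<le> int (2 * R + 2) \<and> \<bar>j\<bar> \<le> int (2 * R + 2)"
    using local_moveD[OF m, of i] local_moveD[OF m, of j] by (cases "i = 0 \<or> i = 1"; cases "j = 0 \<or> j = 1") auto
qed

lemma defect_sum_tau:
  assumes mv: "local_move s p" and c: "\<And>m. supported R (c m)"
    and S: "finite S" "{- int R..int R + 1} \<subseteq> S"
  shows "(\<Sum>x\<in>S. defect s p 0 (tau x c m) i j) = defect s p 0 (Gam c m) i j"
proof (cases "i = 0 \<or> i = 1 \<or> j = 0 \<or> j = 1")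
  case False
  then have "defect s p 0 d i j = 0" for d by (intro defect_far[OF mv]) auto
  then show ?thesis by simp
next
  case True
  have G: "(\<Sum>x\<in>S. tau x c m i j) = Gam c m i j" if "i = 0 \<or> i = 1 \<or> j = 0 \<or> j = 1" for i j
    by (rule Gam_eq[OF c S(1), symmetric]) (use S(2) that in \<open>auto simp: subset_iff\<close>)
  have "p i = 0 \<or> p i = 1 \<or> p j = 0 \<or> p j = 1"
    using True local_moveD(3)[OF mv] by blast
  then show ?thesis
    using True by (simp add: defect_sum[symmetric]) (simp add: defect_def G)
qed

section \<open>The Dirichlet form of a lattice sum\<close>

context disorder begin

definition cont :: "mfield \<Rightarrow> bool" where
  "cont c \<longleftrightarrow> (\<forall>i j. continuous_on D (\<lambda>m. c m i j))"

text \<open>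
  Locality refers to the indices of the matrix; dependence on finitely many sites of the disorder is
  the separate notion \<open>depends_on_box\<close>.
\<close>

definition local_field :: "nat \<Rightarrow> mfield \<Rightarrow> bool" where
  "local_field R c \<longleftrightarrow> cont c \<and> (\<forall>m. symm (c m) \<and> supported R (c m))"

lemma local_fieldD:
  assumes "local_field R c"
  shows "cont c" "\<And>m. symm (c m)" "\<And>m. supported R (c m)"
  using assms by (simp_all add: local_field_def)

lemma contD: "cont c \<Longrightarrow> continuous_on D (\<lambda>m. c m i j)"
  by (simp add: cont_def)

lemma cont_tau: "cont c \<Longrightarrow> cont (tau x c)"
  unfolding cont_def tau_def using continuous_shift by blast

lemma local_field_tau: "local_field R c \<Longrightarrow> local_field (R + nat \<bar>x\<bar>) (tau x c)"
  using cont_tau supported_tau by (simp add: local_field_def symm_def tau_def)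

lemma cont_Gam:
  assumes "local_field R c"
  shows "cont (Gam c)"
  unfolding cont_def
proof (intro allI)
  fix i j
  have eq: "(\<lambda>m. Gam c m i j) = (\<lambda>m. \<Sum>x\<in>{i - int R..i + int R}. tau x c m i j)"
    by (rule ext, rule Gam_eq[OF local_fieldD(3)[OF assms]]) auto
  show "continuous_on D (\<lambda>m. Gam c m i j)"
    unfolding eq by (intro continuous_on_sum contD[OF cont_tau[OF local_fieldD(1)[OF assms]]])
qed

lemma cont_defect: "cont c \<Longrightarrow> cont (\<lambda>m. defect s p x (c m))"
  unfolding cont_def defect_def by (auto intro!: continuous_intros)

lemma continuous_dot: "cont c \<Longrightarrow> cont d \<Longrightarrow> continuous_on D (\<lambda>m. dot N (c m) (d m))"
  unfolding dot_def cont_def by (intro continuous_on_sum continuous_on_mult) auto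

lemma mean_dot_sum:
  assumes "\<And>x. x \<in> S \<Longrightarrow> cont (c x)" "cont d"
  shows "mean (\<lambda>m. dot N (\<lambda>i j. \<Sum>x\<in>S. c x m i j) (d m)) = (\<Sum>x\<in>S. mean (\<lambda>m. dot N (c x m) (d m)))"
  using assms by (simp add: dot_sum_left) (intro mean_sum continuous_dot)

lemma mean_dot_tau:
  assumes c: "cont c" "\<And>m. supported R (c m)" and e: "cont e" and N: "R + nat \<bar>x\<bar> \<le> N"
  shows "mean (\<lambda>m. dot N (c m) (tau x e m)) = mean (\<lambda>m. dot N (tau (- x) c m) (e m))"
proof -
  have "mean (\<lambda>m. dot N (c m) (tau x e m)) = mean (\<lambda>m. dot N (c (shift (- x) m)) (tau x e (shift (- x) m)))"
    by (rule mean_shift[symmetric]) (intro continuous_dot c cont_tau e)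
  also have "(\<lambda>m. dot N (c (shift (- x) m)) (tau x e (shift (- x) m))) = (\<lambda>m. dot N (tau (- x) c m) (e m))"
  proof
    fix m
    have "dot N (c (shift (- x) m)) (tau x e (shift (- x) m)) = dot N (c (shift (- x) m)) (\<lambda>i j. e m (i - x) (j - x))"
      by (simp add: tau_def[abs_def] shift_shift)
    also have "\<dots> = dot N (\<lambda>i j. c (shift (- x) m) (i + x) (j + x)) (e m)"
      by (rule dot_translate[OF c(2) N])
    finally show "dot N (c (shift (- x) m)) (tau x e (shift (- x) m)) = dot N (tau (- x) c m) (e m)"
      by (simp add: tau_def[abs_def])
  qed
  finally show ?thesis .
qed

text \<open>
  The pairing \<open>\<ll>g,h\<gg>\<close> is symmetric: the term of the translation by \<open>x\<close> on one side is the term of the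
  translation by \<open>- x\<close> on the other.
\<close>

lemma Gam_symmetric:
  assumes c: "local_field R c" and d: "local_field R' d"
  shows "mean (\<lambda>m. dot R (c m) (Gam d m)) = mean (\<lambda>m. dot R' (d m) (Gam c m))"
proof -
  define S where "S = {- int (R + R')..int (R + R')}"
  define N where "N = R + R' + R + R'"
  note c' = local_fieldD[OF c] and d' = local_fieldD[OF d]
  have "mean (\<lambda>m. dot R (c m) (Gam d m)) = mean (\<lambda>m. dot R (\<lambda>i j. \<Sum>x\<in>S. tau x d m i j) (c m))"
    by (subst dot_commute, rule Bochner_Integration.integral_cong[OF refl], rule dot_cong,
        subst Gam_eq[OF d'(3), where S = S]) (auto simp: S_def)
  also have "\<dots> = (\<Sum>x\<in>S. mean (\<lambda>m. dot R (c m) (tau x d m)))"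
    by (subst mean_dot_sum) (simp_all add: cont_tau c' d' dot_commute)
  also have "\<dots> = (\<Sum>x\<in>S. mean (\<lambda>m. dot N (c m) (tau x d m)))"
    by (subst dot_mono[OF c'(3), where R' = N]) (simp_all add: N_def)
  also have "\<dots> = (\<Sum>x\<in>S. mean (\<lambda>m. dot N (tau (- x) c m) (d m)))"
    by (intro sum.cong refl mean_dot_tau[where R = R] c' d') (auto simp: N_def S_def)
  also have "\<dots> = (\<Sum>x\<in>S. mean (\<lambda>m. dot N (tau x c m) (d m)))"
    by (rule sum.reindex_bij_witness[where i = uminus and j = uminus]) (auto simp: S_def)
  also have "\<dots> = (\<Sum>x\<in>S. mean (\<lambda>m. dot R' (tau x c m) (d m)))"
    by (subst (1 2) dot_commute, subst dot_mono[OF d'(3), where R' = N]) (simp_all add: N_def)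
  also have "\<dots> = mean (\<lambda>m. dot R' (\<lambda>i j. \<Sum>x\<in>S. tau x c m i j) (d m))"
    by (subst mean_dot_sum) (simp_all add: cont_tau c' d')
  also have "\<dots> = mean (\<lambda>m. dot R' (d m) (Gam c m))"
    by (subst dot_commute, rule Bochner_Integration.integral_cong[OF refl], rule dot_cong,
        subst Gam_eq[OF c'(3), where S = S]) (auto simp: S_def)
  finally show ?thesis .
qed

lemma defect_Gam:
  assumes "\<And>m. supported R (c m)"
  shows "defect s p x (Gam c m) = tau x (\<lambda>m. defect s p 0 (Gam c m)) m"
  by (intro ext) (simp add: defect_def tau_def Gam_shift'[OF assms] algebra_simps)

lemma tau_defect: "tau (- x) (\<lambda>m. defect s p x (c m)) m = defect s p 0 (tau (- x) c m)"
  by (intro ext) (simp add: defect_def tau_def algebra_simps)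

text \<open>
  Translating the term with the move at \<open>x\<close> back to the origin turns \<open>c\<close> into \<open>tau (- x) c\<close> and
  leaves \<open>Gam c\<close> alone.  Summing over \<open>x\<close> then rebuilds \<open>Gam c\<close> in the first argument.  The bonds
  \<open>{- R - 1..R}\<close> are all those that meet the support of \<open>c\<close>.
\<close>

lemma sum_defect_pairing:
  assumes mv: "local_move s p" and c: "local_field R c" and S: "finite S" "{- int R - 1..int R} \<subseteq> S"
    and N: "Suc R \<le> N"
  shows "(\<Sum>x\<in>S. mean (\<lambda>m. dot N (defect s p x (c m)) (defect s p x (Gam c m))))
       = mean (\<lambda>m. dot (2 * R + 2) (defect s p 0 (Gam c m)) (defect s p 0 (Gam c m)))"
proof -
  note c' = local_fieldD[OF c]
  define e where "e m = defect s p 0 (Gam c m)" for m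
  have e: "cont e" unfolding e_def by (rule cont_defect[OF cont_Gam[OF c]])
  define M where "M = Max ((\<lambda>x. nat \<bar>x\<bar>) ` S) + 2 * R + 2"
  have M: "Suc R + nat \<bar>x\<bar> \<le> M" if "x \<in> S" for x
  proof -
    have "nat \<bar>x\<bar> \<le> Max ((\<lambda>x. nat \<bar>x\<bar>) ` S)" using S(1) that by simp
    then show ?thesis by (simp add: M_def)
  qed
  have sd: "supported (Suc R) (defect s p x (c m))" for x m
    by (rule supported_defect[OF mv c'(3)])
  have se: "supported (2 * R + 2) (e m)" for m
    unfolding e_def by (rule supported_defect_Gam[OF mv c'(3)])
  have dg: "defect s p x (Gam c m) = tau x e m" for x m
    unfolding e_def[abs_def] by (rule defect_Gam[OF c'(3)])
  have "mean (\<lambda>m. dot N (defect s p x (c m)) (defect s p x (Gam c m)))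
      = mean (\<lambda>m. dot M (defect s p 0 (tau (- x) c m)) (e m))" if x: "x \<in> S" for x
  proof -
    have "mean (\<lambda>m. dot N (defect s p x (c m)) (defect s p x (Gam c m)))
       = mean (\<lambda>m. dot M (defect s p x (c m)) (tau x e m))"
      using M[OF x] by (simp add: dg dot_mono[OF sd N] dot_mono[OF sd, of M])
    also have "\<dots> = mean (\<lambda>m. dot M (tau (- x) (\<lambda>m. defect s p x (c m)) m) (e m))"
      by (rule mean_dot_tau[OF cont_defect[OF c'(1)] sd e M[OF x]])
    finally show ?thesis by (simp add: tau_defect)
  qed
  then have "(\<Sum>x\<in>S. mean (\<lambda>m. dot N (defect s p x (c m)) (defect s p x (Gam c m))))
      = mean (\<lambda>m. dot M (\<lambda>i j. \<Sum>x\<in>S. defect s p 0 (tau (- x) c m) i j) (e m))"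
    by (subst mean_dot_sum) (simp_all add: cont_defect cont_tau c' e)
  also have "\<dots> = mean (\<lambda>m. dot M (e m) (e m))"
  proof (rule Bochner_Integration.integral_cong[OF refl], rule dot_cong)
    fix m i j
    show "(\<Sum>x\<in>S. defect s p 0 (tau (- x) c m) i j) * e m i j = e m i j * e m i j"
    proof (cases "i = 0 \<or> i = 1 \<or> j = 0 \<or> j = 1")
      case False
      then have "e m i j = 0" unfolding e_def by (intro defect_far[OF mv]) auto
      then show ?thesis by simp
    next
      case True
      have "(\<Sum>x\<in>S. defect s p 0 (tau (- x) c m) i j) = (\<Sum>x\<in>uminus ` S. defect s p 0 (tau x c m) i j)"
        by (simp add: sum.reindex)
      also have "\<dots> = e m i j"
        unfolding e_def
      proof (rule defect_sum_tau[OF mv c'(3)])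
        have "x \<in> uminus ` S" if "- int R \<le> x" "x \<le> int R + 1" for x
          using S(2) that by (intro image_eqI[of _ _ "- x"]) auto
        then show "{- int R..int R + 1} \<subseteq> uminus ` S" by auto
      qed (use S in simp)
      finally have "(\<Sum>x\<in>S. defect s p 0 (tau (- x) c m) i j) = e m i j" .
      then show ?thesis by simp
    qed
  qed
  also have "\<dots> = mean (\<lambda>m. dot (2 * R + 2) (e m) (e m))"
    by (subst dot_mono[OF se]) (simp_all add: M_def)
  finally show ?thesis by (simp add: e_def)
qed

end

locale model = disorder C \<nu> + rates \<gamma> lam for C \<nu> \<gamma> lam
begin

lemma dot_defect_flip:
  "dot N (flip_defect x c) d = dot N (flip_defect x c) (flip_defect x d) / 2"
proof -
  have "dot N (flip_defect x c) (flip_defect x d)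
      = dot N (\<lambda>i j. 2 * flip_defect x c i j) d"
    by (rule dot_cong) (simp add: defect_flip flip_sign_def)
  then show ?thesis by (simp add: dot_cmult_left)
qed

lemma dot_defect_exchange:
  assumes "x \<in> bonds N"
  shows "dot N (exchange_defect x c) d
     = dot N (exchange_defect x c) (exchange_defect x d) / 2"
proof -
  define c' where "c' = (\<lambda>i j. c i j - c (swap_site x i) (swap_site x j))"
  have "dot N c' (\<lambda>i j. d (swap_site x i) (swap_site x j)) = dot N (\<lambda>i j. - c' i j) d"
    unfolding dot_swap_site[OF assms, symmetric] by (simp add: c'_def)
  also have "\<dots> = - dot N c' d" using dot_cmult_left[of N "-1" c' d] by simp
  finally have "dot N c' (\<lambda>i j. d i j - d (swap_site x i) (swap_site x j)) = 2 * dot N c' d"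
    by (subst dot_commute, simp only: dot_diff_left, subst (1 2) dot_commute) simp
  then show ?thesis by (simp add: defect_exchange[abs_def] c'_def)
qed

text \<open>
  Each move is an involution that preserves the scalar product, so pairing a defect with \<open>Gam c\<close>
  gives half its pairing with the defect of \<open>Gam c\<close>; then \<open>sum_defect_pairing\<close> moves all bonds to the origin.
\<close>

theorem Dirichlet_Gam:
  assumes c: "local_field R c" and N: "R + 2 \<le> N"
  shows "mean (\<lambda>m. dot N (neg_gen UNIV (c m)) (Gam c m)) =
    \<gamma> / 2 * mean (\<lambda>m. dot (2 * R + 2) (flip_defect 0 (Gam c m)) (flip_defect 0 (Gam c m)))
  + lam / 2 * mean (\<lambda>m. dot (2 * R + 2) (exchange_defect 0 (Gam c m)) (exchange_defect 0 (Gam c m)))"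
proof -
  note c' = local_fieldD[OF c]
  let ?f = "\<lambda>x m. dot N (flip_defect x (c m)) (flip_defect x (Gam c m))"
  let ?e = "\<lambda>x m. dot N (exchange_defect x (c m)) (exchange_defect x (Gam c m))"
  have "dot N (neg_gen UNIV (c m)) (Gam c m) = \<gamma> / 2 * (\<Sum>x\<in>box N. ?f x m) + lam / 2 * (\<Sum>x\<in>bonds N. ?e x m)" for m
  proof -
    have "dot N (neg_gen UNIV (c m)) (Gam c m) = dot N (neg_gen (bonds N) (c m)) (Gam c m)"
      using neg_gen_bonds[OF c'(3), of N] N by simp
    also have "\<dots> = \<gamma> * dot N (\<lambda>i j. \<Sum>x\<in>box N. flip_defect x (c m) i j) (Gam c m)
        + lam * (\<Sum>x\<in>bonds N. dot N (exchange_defect x (c m)) (Gam c m))"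
    proof -
      have "dot N (\<lambda>i j. \<Sum>x\<in>box N. flip_defect x (c m) i j) (Gam c m)
          = dot N (\<lambda>i j. 4 * (if i = j then 0 else c m i j)) (Gam c m)"
      proof (rule dot_cong)
        fix i j assume ij: "\<bar>i\<bar> \<le> int N" "\<bar>j\<bar> \<le> int N"
        have "(\<Sum>x\<in>box N. flip_defect x (c m) i j) = - (\<Sum>x\<in>box N. flip_sign x i * flip_sign x j - 1) * c m i j"
          unfolding defect_flip sum_negf[symmetric] sum_distrib_right
          by (intro sum.cong) (auto simp: algebra_simps)
        then show "(\<Sum>x\<in>box N. flip_defect x (c m) i j) * Gam c m i j
            = 4 * (if i = j then 0 else c m i j) * Gam c m i j"
          using sum_flip_signs[OF ij] by simp
      qed
      then show ?thesis
        by (simp add: dot_neg_gen dot_cmult_left defect_exchange[abs_def])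
    qed
    also have "\<dots> = \<gamma> / 2 * (\<Sum>x\<in>box N. ?f x m) + lam / 2 * (\<Sum>x\<in>bonds N. ?e x m)"
    proof -
      have "(\<Sum>x\<in>box N. dot N (flip_defect x (c m)) (Gam c m)) = (\<Sum>x\<in>box N. ?f x m) / 2"
        unfolding sum_divide_distrib by (intro sum.cong refl dot_defect_flip)
      moreover have "(\<Sum>x\<in>bonds N. dot N (exchange_defect x (c m)) (Gam c m)) = (\<Sum>x\<in>bonds N. ?e x m) / 2"
        unfolding sum_divide_distrib by (intro sum.cong refl dot_defect_exchange)
      ultimately show ?thesis
        by (simp only: dot_sum_left)
    qed
    finally show ?thesis .
  qed
  then have "mean (\<lambda>m. dot N (neg_gen UNIV (c m)) (Gam c m))
      = \<gamma> / 2 * mean (\<lambda>m. \<Sum>x\<in>box N. ?f x m) + lam / 2 * mean (\<lambda>m. \<Sum>x\<in>bonds N. ?e x m)"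
    by (simp only:) (subst Bochner_Integration.integral_add,
      (intro integrable_continuous_disorder continuous_intros continuous_dot cont_defect c' cont_Gam[OF c])+, simp)
  also have "mean (\<lambda>m. \<Sum>x\<in>box N. ?f x m) = (\<Sum>x\<in>box N. mean (?f x))"
    by (intro mean_sum continuous_dot cont_defect c' cont_Gam[OF c])
  also have "\<dots> = mean (\<lambda>m. dot (2 * R + 2) (flip_defect 0 (Gam c m)) (flip_defect 0 (Gam c m)))"
    using N by (intro sum_defect_pairing[OF local_move_flip c]) auto
  also have "mean (\<lambda>m. \<Sum>x\<in>bonds N. ?e x m) = (\<Sum>x\<in>bonds N. mean (?e x))"
    by (intro mean_sum continuous_dot cont_defect c' cont_Gam[OF c])
  also have "\<dots> = mean (\<lambda>m. dot (2 * R + 2) (exchange_defect 0 (Gam c m)) (exchange_defect 0 (Gam c m)))"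
    using N by (intro sum_defect_pairing[OF local_move_exchange c]) auto
  finally show ?thesis .
qed

end

section \<open>Expectations of quadratic observables\<close>

lemma quad_dot: "quad l c \<omega> = dot l c (\<lambda>i j. \<omega> i * \<omega> j)"
  by (simp add: quad_def dot_def mult.assoc)

lemma translate_quad:
  assumes c: "\<And>m. supported R (c m)" and N: "R + nat \<bar>x\<bar> \<le> N"
  shows "translate x (\<lambda>m. quad R (c m)) m \<omega> = quad N (tau x c m) \<omega>"
proof -
  have "translate x (\<lambda>m. quad R (c m)) m \<omega> = dot R (c (shift x m)) (\<lambda>i j. \<omega> (i + x) * \<omega> (j + x))"
    by (simp add: translate_def quad_dot shift_def add.commute)
  also have "\<dots> = dot N (c (shift x m)) (\<lambda>i j. \<omega> (i + x) * \<omega> (j + x))"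
    by (rule dot_mono[symmetric, OF c]) (use N in simp)
  also have "\<dots> = dot N (tau x c m) (\<lambda>i j. \<omega> i * \<omega> j)"
    using dot_translate[OF c, of "- x" N "shift x m" "\<lambda>i j. \<omega> i * \<omega> j"] N by (simp add: tau_def[abs_def])
  finally show ?thesis by (simp add: quad_dot)
qed

lemma defect_tau_zero:
  assumes mv: "local_move s p" and c: "\<And>m. supported R (c m)" and x: "\<bar>x\<bar> > int R + 1"
  shows "defect s p 0 (tau x c m) i j = 0"
proof (cases "i = 0 \<or> i = 1 \<or> j = 0 \<or> j = 1")
  case False
  then show ?thesis by (intro defect_far[OF mv]) auto
next
  case True
  have z: "tau x c m i j = 0" if "i = 0 \<or> i = 1 \<or> j = 0 \<or> j = 1" for i j
    by (rule tau_zero[OF c]) (use x that in auto)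
  have "p i = 0 \<or> p i = 1 \<or> p j = 0 \<or> p j = 1"
    using True local_moveD(3)[OF mv] by blast
  then show ?thesis using True by (simp add: defect_def z)
qed

lemma sum_defect_quad:
  assumes mv: "local_move s p" and c: "\<And>m. supported R (c m)"
  shows "(\<Sum>\<^sub>\<infinity>x. - quad (2 * R + 2 + nat \<bar>x\<bar>) (defect s p 0 (tau x c m)) \<omega>)
     = - quad (2 * R + 2) (defect s p 0 (Gam c m)) \<omega>"
proof -
  have "quad (2 * R + 2 + nat \<bar>x\<bar>) (defect s p 0 (tau x c m)) \<omega> = 0" if "x \<notin> box (Suc R)" for x
    using defect_tau_zero[OF mv c, where x = x and m = m] that by (simp add: quad_def)
  then have "(\<Sum>\<^sub>\<infinity>x. - quad (2 * R + 2 + nat \<bar>x\<bar>) (defect s p 0 (tau x c m)) \<omega>)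
      = (\<Sum>x\<in>box (Suc R). - quad (2 * R + 2 + nat \<bar>x\<bar>) (defect s p 0 (tau x c m)) \<omega>)"
    by (intro infsum_finite_support) auto
  also have "\<dots> = (\<Sum>x\<in>box (Suc R). - quad (2 * R + 2) (defect s p 0 (tau x c m)) \<omega>)"
  proof (intro sum.cong refl arg_cong[where f = uminus] quad_mono)
    fix x assume "x \<in> box (Suc R)"
    then have "Suc (R + nat \<bar>x\<bar>) \<le> 2 * R + 2" by simp
    then show "supported (2 * R + 2) (defect s p 0 (tau x c m))"
      using supported_mono[OF supported_defect[OF mv supported_tau[where c = c and x = x, OF c]]] by simp
  qed simp
  also have "\<dots> = - quad (2 * R + 2) (\<lambda>i j. \<Sum>x\<in>box (Suc R). defect s p 0 (tau x c m) i j) \<omega>"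
    by (simp add: sum_negf quad_sum)
  also have "(\<lambda>i j. \<Sum>x\<in>box (Suc R). defect s p 0 (tau x c m) i j) = defect s p 0 (Gam c m)"
    by (intro ext defect_sum_tau[OF mv c]) auto
  finally show ?thesis .
qed

context disorder begin

lemma E_star_quad:
  assumes "cont c" "cont d" "\<And>m. symm (d m)" "\<And>m. (\<Sum>i\<in>box N. c m i i) = 0"
  shows "E_star \<nu> (\<lambda>m \<omega>. quad N (c m) \<omega> * quad N (d m) \<omega>) = 2 * mean (\<lambda>m. dot N (c m) (d m))"
  unfolding quad_def dot_def
  by (rule E_star_quadratics) (use assms in \<open>auto simp: cont_def symm_def\<close>)

lemma sq_integrable_quad:
  assumes "cont c"
  shows "sq_integrable J (\<lambda>z. quad N (c (fst z)) (snd z))"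
  unfolding sq_integrable_def
proof
  have [measurable]: "(\<lambda>z. c (fst z) i j) \<in> borel_measurable (P \<Otimes>\<^sub>M gauss_law)" for i j
    by (rule measurable_compose[OF measurable_fst measurable_continuous_disorder[OF contD[OF assms]]])
  have [measurable]: "(\<lambda>z. snd z i) \<in> borel_measurable (P \<Otimes>\<^sub>M gauss_law)" for i
    by (rule measurable_compose[OF measurable_snd measurable_coordinate_gauss])
  show "(\<lambda>z. quad N (c (fst z)) (snd z)) \<in> borel_measurable J"
    unfolding quad_def joint_law_def by measurable
  show "integrable J (\<lambda>z. (quad N (c (fst z)) (snd z))\<^sup>2)"
    using integrable_quadratics[of "box N" c c] assms by (simp add: quad_def power2_eq_square cont_def)
qed

lemma translate_cong:
  assumes "\<And>m \<omega>. m \<in> D \<Longrightarrow> f m \<omega> = g m \<omega>" "m \<in> D"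
  shows "translate x f m \<omega> = translate x g m \<omega>"
  using assms by (simp add: translate_def)

lemma pairing_star_quad:
  assumes \<alpha>: "local_field s \<alpha>" and tr: "\<And>m. (\<Sum>i\<in>box s. \<alpha> m i i) = 0" and c: "local_field R c"
    and \<phi>: "\<And>m \<omega>. m \<in> D \<Longrightarrow> \<phi> m \<omega> = quad s (\<alpha> m) \<omega>" and g: "\<And>m \<omega>. m \<in> D \<Longrightarrow> g m \<omega> = quad R (c m) \<omega>"
  shows "pairing_star \<nu> \<phi> g = 2 * mean (\<lambda>m. dot s (\<alpha> m) (Gam c m))"
proof -
  note \<alpha>' = local_fieldD[OF \<alpha>] and c' = local_fieldD[OF c]
  have zs: "\<alpha> m i i = 0" if "\<bar>i\<bar> > int s" for m i
    using \<alpha>'(3)[of m] that unfolding supported_def by force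
  have E: "E_star \<nu> (\<lambda>m \<omega>. \<phi> m \<omega> * translate x g m \<omega>) = 2 * mean (\<lambda>m. dot s (\<alpha> m) (tau x c m))" for x
  proof -
    define N where "N = s + R + nat \<bar>x\<bar>"
    have "E_star \<nu> (\<lambda>m \<omega>. \<phi> m \<omega> * translate x g m \<omega>) = E_star \<nu> (\<lambda>m \<omega>. quad N (\<alpha> m) \<omega> * quad N (tau x c m) \<omega>)"
    proof (rule E_star_cong)
      fix m \<omega> assume m: "m \<in> D"
      have "translate x g m \<omega> = translate x (\<lambda>m. quad R (c m)) m \<omega>"
        by (rule translate_cong[OF g m])
      also have "\<dots> = quad N (tau x c m) \<omega>"
        by (rule translate_quad[OF c'(3)]) (simp add: N_def)
      finally show "\<phi> m \<omega> * translate x g m \<omega> = quad N (\<alpha> m) \<omega> * quad N (tau x c m) \<omega>"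
        using \<phi>[OF m] quad_mono[OF \<alpha>'(3), of N m \<omega>] by (simp add: N_def)
    qed
    also have "\<dots> = 2 * mean (\<lambda>m. dot N (\<alpha> m) (tau x c m))"
    proof (rule E_star_quad)
      show "(\<Sum>i\<in>box N. \<alpha> m i i) = 0" for m
        using sum_box_mono[of s N "\<lambda>i. \<alpha> m i i"] tr[of m] zs by (simp add: N_def)
      show "symm (tau x c m)" for m using local_fieldD(2)[OF local_field_tau[OF c]] .
    qed (intro \<alpha>' c' cont_tau)+
    also have "\<dots> = 2 * mean (\<lambda>m. dot s (\<alpha> m) (tau x c m))"
      using dot_mono[OF \<alpha>'(3), of N] by (simp add: N_def)
    finally show ?thesis .
  qed
  have "pairing_star \<nu> \<phi> g = (\<Sum>\<^sub>\<infinity>x. 2 * mean (\<lambda>m. dot s (\<alpha> m) (tau x c m)))"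
    by (simp add: pairing_star_def E)
  also have "\<dots> = (\<Sum>x\<in>box (s + R). 2 * mean (\<lambda>m. dot s (\<alpha> m) (tau x c m)))"
  proof (rule infsum_finite_support)
    fix x assume x: "x \<notin> box (s + R)"
    have "dot s (\<alpha> m) (tau x c m) = 0" for m
      unfolding dot_def
    proof (intro sum.neutral ballI)
      fix i j assume "i \<in> box s"
      then have "tau x c m i j = 0" by (intro tau_zero[OF c'(3)]) (use x in auto)
      then show "\<alpha> m i j * tau x c m i j = 0" by simp
    qed
    then show "2 * mean (\<lambda>m. dot s (\<alpha> m) (tau x c m)) = 0" by simp
  qed simp
  also have "\<dots> = 2 * mean (\<lambda>m. dot s (\<lambda>i j. \<Sum>x\<in>box (s + R). tau x c m i j) (\<alpha> m))"
    by (subst mean_dot_sum) (simp_all add: cont_tau c' \<alpha>' dot_commute sum_distrib_left)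
  also have "\<dots> = 2 * mean (\<lambda>m. dot s (\<alpha> m) (Gam c m))"
    by (subst dot_commute, rule arg_cong[where f = "(*) 2"], rule Bochner_Integration.integral_cong[OF refl],
        rule dot_cong, subst Gam_eq[OF c'(3), where S = "box (s + R)"]) auto
  finally show ?thesis .
qed

lemma grad_flip_Gamma_quad:
  assumes c: "local_field R c" and g: "\<And>m \<omega>. m \<in> D \<Longrightarrow> g m \<omega> = quad R (c m) \<omega>" and m: "m \<in> D"
  shows "grad_flip_Gamma g m \<omega> = - quad (2 * R + 2) (flip_defect 0 (Gam c m)) \<omega>"
proof -
  note c' = local_fieldD[OF c]
  have "grad_flip 0 (translate x g) m \<omega> = - quad (2 * R + 2 + nat \<bar>x\<bar>) (flip_defect 0 (tau x c m)) \<omega>" for x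
  proof -
    let ?N = "2 * R + 2 + nat \<bar>x\<bar>"
    have t: "translate x g m \<omega> = quad ?N (tau x c m) \<omega>" for \<omega>
      using translate_cong[of g "\<lambda>m. quad R (c m)", OF g m] translate_quad[OF c'(3), of x ?N] by simp
    show ?thesis
      by (simp add: grad_flip_def t quad_flip quad_diff quad_minus defect_flip[abs_def])
  qed
  then show ?thesis
    using sum_defect_quad[OF local_move_flip c'(3)] by (simp add: grad_flip_Gamma_def)
qed

lemma grad_exch_Gamma_quad:
  assumes c: "local_field R c" and g: "\<And>m \<omega>. m \<in> D \<Longrightarrow> g m \<omega> = quad R (c m) \<omega>" and m: "m \<in> D"
  shows "grad_exch_Gamma g m \<omega> = - quad (2 * R + 2) (exchange_defect 0 (Gam c m)) \<omega>"
proof -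
  note c' = local_fieldD[OF c]
  have "grad_exch 0 (translate x g) m \<omega> = - quad (2 * R + 2 + nat \<bar>x\<bar>) (exchange_defect 0 (tau x c m)) \<omega>" for x
  proof -
    let ?N = "2 * R + 2 + nat \<bar>x\<bar>"
    have t: "translate x g m \<omega> = quad ?N (tau x c m) \<omega>" for \<omega>
      using translate_cong[of g "\<lambda>m. quad R (c m)", OF g m] translate_quad[OF c'(3), of x ?N] by simp
    have "0 \<in> bonds ?N" by auto
    then show ?thesis
      by (simp only: grad_exch_def t quad_exchange quad_diff quad_minus defect_exchange[abs_def] minus_diff_eq)
  qed
  then show ?thesis
    using sum_defect_quad[OF local_move_exchange c'(3)] by (simp add: grad_exch_Gamma_def)
qed

lemma symm_defect: "symm c \<Longrightarrow> symm (defect s p x c)"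
  by (simp add: symm_def defect_def mult.commute)

text \<open>
  The gradients of \<open>\<Gamma>\<^sub>g\<close> are trace-free: a flip does not touch the diagonal, and an exchange permutes
  it.  So their second moments are twice the squared norms of their matrices.
\<close>

lemma E_star_grad_Gamma:
  assumes c: "local_field R c" and g: "\<And>m \<omega>. m \<in> D \<Longrightarrow> g m \<omega> = quad R (c m) \<omega>"
  shows "E_star \<nu> (\<lambda>m \<omega>. (grad_flip_Gamma g m \<omega>)\<^sup>2) =
      2 * mean (\<lambda>m. dot (2 * R + 2) (flip_defect 0 (Gam c m)) (flip_defect 0 (Gam c m)))" (is ?F)
    and "E_star \<nu> (\<lambda>m \<omega>. (grad_exch_Gamma g m \<omega>)\<^sup>2) =
      2 * mean (\<lambda>m. dot (2 * R + 2) (exchange_defect 0 (Gam c m)) (exchange_defect 0 (Gam c m)))" (is ?E)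
proof -
  note c' = local_fieldD[OF c]
  have "E_star \<nu> (\<lambda>m \<omega>. (grad_flip_Gamma g m \<omega>)\<^sup>2) = E_star \<nu> (\<lambda>m \<omega>.
      quad (2 * R + 2) (flip_defect 0 (Gam c m)) \<omega> * quad (2 * R + 2) (flip_defect 0 (Gam c m)) \<omega>)"
    by (rule E_star_cong) (simp add: grad_flip_Gamma_quad[OF c g] power2_eq_square)
  also have "\<dots> = 2 * mean (\<lambda>m. dot (2 * R + 2) (flip_defect 0 (Gam c m)) (flip_defect 0 (Gam c m)))"
    by (rule E_star_quad) (auto intro!: cont_defect cont_Gam[OF c] symm_defect symm_Gam c' sum.neutral simp: defect_flip flip_sign_def)
  finally show ?F .
  have tr: "(\<Sum>i\<in>box (2 * R + 2). exchange_defect 0 d i i) = 0" for d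
    using sum_swap_site[of 0 "2 * R + 2" "\<lambda>i. d i i"] by (simp add: defect_exchange sum_subtractf)
  have "E_star \<nu> (\<lambda>m \<omega>. (grad_exch_Gamma g m \<omega>)\<^sup>2) = E_star \<nu> (\<lambda>m \<omega>.
      quad (2 * R + 2) (exchange_defect 0 (Gam c m)) \<omega> * quad (2 * R + 2) (exchange_defect 0 (Gam c m)) \<omega>)"
    by (rule E_star_cong) (simp add: grad_exch_Gamma_quad[OF c g] power2_eq_square)
  also have "\<dots> = 2 * mean (\<lambda>m. dot (2 * R + 2) (exchange_defect 0 (Gam c m)) (exchange_defect 0 (Gam c m)))"
    by (rule E_star_quad) (auto intro!: cont_defect cont_Gam[OF c] symm_defect symm_Gam c' simp only: tr)
  finally show ?E .
qed

lemma bracket_star_star_quad: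
  assumes \<alpha>: "local_field s \<alpha>" and tr: "\<And>m. (\<Sum>i\<in>box s. \<alpha> m i i) = 0"
    and \<phi>: "\<And>m \<omega>. m \<in> D \<Longrightarrow> \<phi> m \<omega> = quad s (\<alpha> m) \<omega>"
  shows "bracket_star_star \<nu> \<phi> = 2 * mean (\<lambda>m. \<Sum>x\<in>box s. of_int x * \<alpha> m x x)"
proof -
  note \<alpha>' = local_fieldD[OF \<alpha>]
  have zs: "\<alpha> m i i = 0" if "\<bar>i\<bar> > int s" for m i
    using \<alpha>'(3)[of m] that unfolding supported_def by force
  have E: "E_star \<nu> (\<lambda>m \<omega>. \<phi> m \<omega> * (\<omega> x)\<^sup>2) = 2 * mean (\<lambda>m. \<alpha> m x x)" for x
  proof -
    define N where "N = s + nat \<bar>x\<bar>"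
    define e where "e = (\<lambda>i j. kron x i * kron x j)"
    have de: "dot N d e = d x x" for d
      unfolding dot_def e_def mult.assoc[symmetric]
      by (subst kron_sum, simp_all add: N_def)+
    have qe: "quad N e \<omega> = (\<omega> x)\<^sup>2" for \<omega>
      using de[of "\<lambda>i j. \<omega> i * \<omega> j"] by (simp add: quad_dot dot_commute power2_eq_square)
    have qN: "quad N (\<alpha> m) \<omega> = quad s (\<alpha> m) \<omega>" for m \<omega>
      by (rule quad_mono[OF \<alpha>'(3)]) (simp add: N_def)
    have "E_star \<nu> (\<lambda>m \<omega>. \<phi> m \<omega> * (\<omega> x)\<^sup>2) = E_star \<nu> (\<lambda>m \<omega>. quad N (\<alpha> m) \<omega> * quad N e \<omega>)"
      by (rule E_star_cong) (simp add: \<phi> qe qN)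
    also have "\<dots> = 2 * mean (\<lambda>m. dot N (\<alpha> m) e)"
    proof (rule E_star_quad)
      show "(\<Sum>i\<in>box N. \<alpha> m i i) = 0" for m
        using sum_box_mono[of s N "\<lambda>i. \<alpha> m i i"] tr[of m] zs by (simp add: N_def)
    qed (use \<alpha>' in \<open>auto simp: cont_def symm_def e_def\<close>)
    finally show ?thesis by (simp add: de)
  qed
  have "bracket_star_star \<nu> \<phi> = (\<Sum>\<^sub>\<infinity>x. real_of_int x * (2 * mean (\<lambda>m. \<alpha> m x x)))"
    by (simp add: bracket_star_star_def E)
  also have "\<dots> = (\<Sum>x\<in>box s. real_of_int x * (2 * mean (\<lambda>m. \<alpha> m x x)))"
    by (rule infsum_finite_support) (simp_all add: zs)
  also have "\<dots> = 2 * mean (\<lambda>m. \<Sum>x\<in>box s. of_int x * \<alpha> m x x)"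
    by (subst mean_sum) (intro continuous_on_mult continuous_on_const contD[OF \<alpha>'(1)], simp add: sum_distrib_left mult_ac)
  finally show ?thesis .
qed

end

section \<open>The coefficients of the functions in Q0\<close>

definition unit :: "int \<Rightarrow> config" where
  "unit i = (\<lambda>z. if z = i then 1 else 0)"

lemma homogeneous_quadraticI:
  "finite A \<Longrightarrow> (\<And>\<omega>. p \<omega> = (\<Sum>i\<in>A. \<Sum>j\<in>A. a i j * \<omega> i * \<omega> j)) \<Longrightarrow> homogeneous_quadratic p"
  unfolding homogeneous_quadratic_def by blast

lemma homogeneous_quadratic_flip:
  assumes "homogeneous_quadratic p"
  shows "homogeneous_quadratic (\<lambda>\<omega>. p (flip x \<omega>))"
proof -
  obtain A a where A: "finite A" "\<And>\<omega>. p \<omega> = (\<Sum>i\<in>A. \<Sum>j\<in>A. a i j * \<omega> i * \<omega> j)"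
    using assms unfolding homogeneous_quadratic_def by blast
  show ?thesis
    by (rule homogeneous_quadraticI[OF A(1), where a = "\<lambda>i j. a i j * flip_sign x i * flip_sign x j"])
      (simp add: A(2) flip_eq_sign mult_ac)
qed

lemma homogeneous_quadratic_exchange:
  assumes "homogeneous_quadratic p"
  shows "homogeneous_quadratic (\<lambda>\<omega>. p (exchange x \<omega>))"
proof -
  obtain A a where A: "finite A" "\<And>\<omega>. p \<omega> = (\<Sum>i\<in>A. \<Sum>j\<in>A. a i j * \<omega> i * \<omega> j)"
    using assms unfolding homogeneous_quadratic_def by blast
  have inj: "inj_on (swap_site x) A" by (simp add: inj_on_def)
  show ?thesis
    by (rule homogeneous_quadraticI[of "swap_site x ` A", where a = "\<lambda>i j. a (swap_site x i) (swap_site x j)"])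
      (simp_all add: A exchange_swap_site sum.reindex[OF inj])
qed

lemma homogeneous_quadratic_combine:
  assumes "homogeneous_quadratic p" "homogeneous_quadratic q"
  shows "homogeneous_quadratic (\<lambda>\<omega>. p \<omega> + t * q \<omega>)"
proof -
  obtain A a where A: "finite A" "\<And>\<omega>. p \<omega> = (\<Sum>i\<in>A. \<Sum>j\<in>A. a i j * \<omega> i * \<omega> j)"
    using assms(1) unfolding homogeneous_quadratic_def by blast
  obtain B b where B: "finite B" "\<And>\<omega>. q \<omega> = (\<Sum>i\<in>B. \<Sum>j\<in>B. b i j * \<omega> i * \<omega> j)"
    using assms(2) unfolding homogeneous_quadratic_def by blast
  define ext where "ext S c = (\<lambda>i j. if i \<in> S \<and> j \<in> S then c i j else 0)"
    for S :: "int set" and c :: "int \<Rightarrow> int \<Rightarrow> real"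
  have ext: "(\<Sum>i\<in>S. \<Sum>j\<in>S. c i j * \<omega> i * \<omega> j) = (\<Sum>i\<in>A \<union> B. \<Sum>j\<in>A \<union> B. ext S c i j * \<omega> i * \<omega> j)"
    if "S \<subseteq> A \<union> B" for S c \<omega>
  proof -
    have "(\<Sum>j\<in>S. c i j * \<omega> i * \<omega> j) = (\<Sum>j\<in>A \<union> B. ext S c i j * \<omega> i * \<omega> j)" if "i \<in> S" for i
      by (rule sum.mono_neutral_cong_left) (use \<open>S \<subseteq> A \<union> B\<close> that A(1) B(1) in \<open>auto simp: ext_def\<close>)
    then show ?thesis
      by (intro sum.mono_neutral_cong_left) (use that A(1) B(1) in \<open>auto simp: ext_def\<close>)
  qed
  show ?thesis
  proof (rule homogeneous_quadraticI[of "A \<union> B", where a = "\<lambda>i j. ext A a i j + t * ext B b i j"])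
    show "finite (A \<union> B)" using A(1) B(1) by simp
    show "p \<omega> + t * q \<omega> = (\<Sum>i\<in>A \<union> B. \<Sum>j\<in>A \<union> B. (ext A a i j + t * ext B b i j) * \<omega> i * \<omega> j)" for \<omega>
      unfolding A(2) B(2) ext[OF Un_upper1, of a] ext[OF Un_upper2, of b]
      by (simp only: sum_distrib_left sum.distrib[symmetric] distrib_right mult.assoc)
  qed
qed

lemma homogeneous_quadratic_sum:
  assumes "\<And>x. x \<in> S \<Longrightarrow> homogeneous_quadratic (p x)"
  shows "homogeneous_quadratic (\<lambda>\<omega>. \<Sum>x\<in>S. p x \<omega>)"
  using assms
proof (induction S rule: infinite_finite_induct)
  case (insert x S)
  then show ?case
    using homogeneous_quadratic_combine[of "p x" "\<lambda>\<omega>. \<Sum>x\<in>S. p x \<omega>" 1] by simp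
qed (auto intro: homogeneous_quadraticI[of "{}"])

text \<open>
  The coefficients are recovered from finitely many values of the form.  In this way they inherit
  locality and continuity in the disorder, although the representation as a homogeneous
  polynomial is only given separately for each disorder.
\<close>

definition polarization :: "nat \<Rightarrow> (config \<Rightarrow> real) \<Rightarrow> matrix" where
  "polarization s p i j = (if \<bar>i\<bar> \<le> int s \<and> \<bar>j\<bar> \<le> int s then
     (if i = j then p (unit i) else (p (\<lambda>z. unit i z + unit j z) - p (unit i) - p (unit j)) / 2) else 0)"

text \<open>
  Restricting the configuration to the box removes the coefficients outside, and the remaining
  form is determined by its values at the unit vectors and their sums.
\<close>

lemma homogeneous_quadratic_polarization:
  assumes p: "homogeneous_quadratic p" and loc: "\<And>\<omega>. p \<omega> = p (\<lambda>z. if \<bar>z\<bar> \<le> int s then \<omega> z else 0)"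
  shows "p \<omega> = quad s (polarization s p) \<omega>"
proof -
  obtain A a where A: "finite A" "\<And>\<omega>. p \<omega> = (\<Sum>i\<in>A. \<Sum>j\<in>A. a i j * \<omega> i * \<omega> j)"
    using p unfolding homogeneous_quadratic_def by blast
  define a' where "a' = (\<lambda>i j. if i \<in> A \<and> j \<in> A then a i j else 0)"
  define q where "q \<omega> \<eta> = dot s a' (\<lambda>i j. \<omega> i * \<eta> j)" for \<omega> \<eta> :: config
  have pq: "p \<omega> = q \<omega> \<omega>" for \<omega>
  proof -
    let ?w = "\<lambda>z. if \<bar>z\<bar> \<le> int s then \<omega> z else 0"
    have inner: "(\<Sum>j\<in>A. a i j * ?w i * ?w j) = (\<Sum>j\<in>box s. a' i j * (\<omega> i * \<omega> j))" if "i \<in> A" "i \<in> box s" for i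
      using that A(1)
      by (intro sum.mono_neutral_cong) (auto simp: a'_def)
    have "p \<omega> = (\<Sum>i\<in>A. \<Sum>j\<in>A. a i j * ?w i * ?w j)"
      by (subst loc) (simp only: A(2))
    also have "\<dots> = (\<Sum>i\<in>box s. \<Sum>j\<in>box s. a' i j * (\<omega> i * \<omega> j))"
      using A(1) by (intro sum.mono_neutral_cong inner) (auto simp: a'_def)
    finally show ?thesis by (simp add: q_def dot_def)
  qed
  have qu: "q (unit i) (unit j) = a' i j" if "\<bar>i\<bar> \<le> int s" "\<bar>j\<bar> \<le> int s" for i j
  proof -
    have "unit i z = kron i z" for i z by (auto simp: unit_def)
    then have "q (unit i) (unit j) = (\<Sum>k\<in>box s. \<Sum>l\<in>box s. a' k l * kron i k * kron j l)"
      by (simp only: q_def dot_def mult.assoc)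
    also have "\<dots> = a' i j"
      using that by (subst kron_sum, simp_all)+
    finally show ?thesis .
  qed
  have qadd: "q (\<lambda>z. \<omega> z + \<eta> z) (\<lambda>z. \<omega> z + \<eta> z) = q \<omega> \<omega> + q \<omega> \<eta> + q \<eta> \<omega> + q \<eta> \<eta>" for \<omega> \<eta>
    by (simp add: q_def dot_def sum.distrib[symmetric] algebra_simps)
  have "quad s (polarization s p) \<omega> = quad s (\<lambda>i j. (a' i j + a' j i) / 2) \<omega>"
    by (rule quad_cong) (simp add: polarization_def pq qadd qu)
  also have "\<dots> = (q \<omega> \<omega> + q \<omega> \<omega>) / 2"
  proof -
    have "dot s (\<lambda>i j. a' j i) (\<lambda>i j. \<omega> i * \<omega> j) = q \<omega> \<omega>"
      unfolding dot_def q_def by (subst sum.swap) (simp add: mult_ac)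
    then show ?thesis
      using dot_cmult_left[of s "1/2" "\<lambda>i j. a' i j + a' j i" "\<lambda>i j. \<omega> i * \<omega> j"]
      by (simp add: quad_dot dot_add_left q_def)
  qed
  finally show ?thesis by (simp add: pq)
qed

context disorder begin

definition depends_on_box :: "nat \<Rightarrow> (config \<Rightarrow> 'a) \<Rightarrow> bool" where
  "depends_on_box R f \<longleftrightarrow> (\<forall>m\<in>D. \<forall>m'\<in>D. (\<forall>x\<in>box R. m x = m' x) \<longrightarrow> f m = f m')"

lemma depends_only_on_mono: "depends_only_on C f A \<Longrightarrow> A \<subseteq> B \<Longrightarrow> depends_only_on C f B"
  unfolding depends_only_on_def by (meson subset_iff)

lemma depends_only_on_grad_flip:
  assumes "depends_only_on C f A" shows "depends_only_on C (grad_flip x f) A"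
  using assms unfolding depends_only_on_def grad_flip_def
  by (smt (verit, ccfv_threshold) flip_eq_sign)

lemma depends_only_on_grad_exch:
  assumes "depends_only_on C f A" shows "depends_only_on C (grad_exch x f) (A \<union> swap_site x ` A)"
  unfolding depends_only_on_def grad_exch_def
proof (intro ballI allI impI)
  fix m m' \<omega> \<omega>' :: config
  assume m: "m \<in> D" "m' \<in> D" and eq: "\<forall>y\<in>A \<union> swap_site x ` A. m y = m' y \<and> \<omega> y = \<omega>' y"
  have "f m (exchange x \<omega>) = f m' (exchange x \<omega>')"
    using assms m eq unfolding depends_only_on_def by (simp add: exchange_swap_site)
  moreover have "f m \<omega> = f m' \<omega>'"
    using assms m eq unfolding depends_only_on_def by simp
  ultimately show "f m (exchange x \<omega>) - f m \<omega> = f m' (exchange x \<omega>') - f m' \<omega>'" by simp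
qed

lemma class_Q0_cyl_radius:
  assumes "\<phi> \<in> class_Q0 C \<nu>"
  shows "0 < cyl_radius C \<phi>" "depends_only_on C \<phi> (box (cyl_radius C \<phi>))"
proof -
  obtain \<Lambda> F G where L: "finite \<Lambda>" "\<And>x. x \<in> \<Lambda> \<Longrightarrow> quadratic_potential C \<nu> (F x) \<and> quadratic_potential C \<nu> (G x)"
    and \<phi>: "\<And>m \<omega>. m \<in> D \<Longrightarrow> \<phi> m \<omega> = (\<Sum>x\<in>\<Lambda>. grad_flip x (F x) m \<omega> + grad_exch x (G x) m \<omega>)"
    using assms unfolding class_Q0_def by blast
  have "\<forall>x\<in>\<Lambda>. \<exists>A B. finite A \<and> finite B \<and> depends_only_on C (F x) A \<and> depends_only_on C (G x) B"
    using L(2) unfolding quadratic_potential_def cylinder_def by meson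
  then obtain A B where AB: "\<And>x. x \<in> \<Lambda> \<Longrightarrow> finite (A x) \<and> finite (B x) \<and> depends_only_on C (F x) (A x) \<and> depends_only_on C (G x) (B x)"
    by metis
  define U where "U = (\<Union>x\<in>\<Lambda>. A x \<union> (B x \<union> swap_site x ` B x))"
  have "finite U" using L(1) AB by (auto simp: U_def)
  define t where "t = Suc (nat (Max (insert 0 (abs ` U))))"
  have "U \<subseteq> box t"
  proof
    fix z assume "z \<in> U"
    then have "\<bar>z\<bar> \<le> Max (insert 0 (abs ` U))" using \<open>finite U\<close> by (intro Max_ge) auto
    then have "\<bar>z\<bar> \<le> int t" unfolding t_def by linarith
    then show "z \<in> box t" by simp
  qed
  have "depends_only_on C (grad_flip x (F x)) (box t)" "depends_only_on C (grad_exch x (G x)) (box t)" if "x \<in> \<Lambda>" for x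
    using AB[OF that] \<open>U \<subseteq> box t\<close> that
    by (auto intro!: depends_only_on_mono[OF depends_only_on_grad_flip, of "F x" "A x"]
        depends_only_on_mono[OF depends_only_on_grad_exch, of "G x" "B x"] simp: U_def simp del: mem_box)
  then have loc: "grad_flip x (F x) m \<omega> = grad_flip x (F x) m' \<omega>'" "grad_exch x (G x) m \<omega> = grad_exch x (G x) m' \<omega>'"
    if "x \<in> \<Lambda>" "m \<in> D" "m' \<in> D" "\<forall>y\<in>box t. m y = m' y \<and> \<omega> y = \<omega>' y" for x m m' \<omega> \<omega>'
    using that unfolding depends_only_on_def by blast+
  have "depends_only_on C \<phi> (box t)"
    unfolding depends_only_on_def
  proof (intro ballI allI impI)
    fix m m' \<omega> \<omega>' :: config
    assume m: "m \<in> D" "m' \<in> D" and eq: "\<forall>y\<in>box t. m y = m' y \<and> \<omega> y = \<omega>' y"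
    show "\<phi> m \<omega> = \<phi> m' \<omega>'"
      unfolding \<phi>[OF m(1)] \<phi>[OF m(2)] using loc[OF _ m eq] by (intro sum.cong) simp_all
  qed
  then have "0 < t \<and> depends_only_on C \<phi> (box t)" by (simp add: t_def)
  then have "0 < cyl_radius C \<phi> \<and> depends_only_on C \<phi> (box (cyl_radius C \<phi>))"
    unfolding cyl_radius_def by (rule LeastI)
  then show "0 < cyl_radius C \<phi>" "depends_only_on C \<phi> (box (cyl_radius C \<phi>))" by auto
qed

text \<open>
  The trace is the sum of the values at the unit vectors.  An exchange permutes these within
  a large box, and a flip changes at most the sign of one, to which an even function is blind; so the
  trace of a sum of gradients is zero.
\<close>

theorem class_Q0_coefficients:
  assumes \<phi>Q: "\<phi> \<in> class_Q0 C \<nu>"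
  defines "s \<equiv> cyl_radius C \<phi>"
  obtains \<alpha> where "local_field s \<alpha>" "depends_on_box s \<alpha>" "\<And>m. (\<Sum>i\<in>box s. \<alpha> m i i) = 0"
    "\<And>m \<omega>. m \<in> D \<Longrightarrow> \<phi> m \<omega> = quad s (\<alpha> m) \<omega>"
proof -
  have dep: "depends_only_on C \<phi> (box s)"
    using class_Q0_cyl_radius[OF \<phi>Q] by (simp add: s_def)
  obtain \<Lambda> F G where L: "finite \<Lambda>" "\<And>x. x \<in> \<Lambda> \<Longrightarrow> quadratic_potential C \<nu> (F x) \<and> quadratic_potential C \<nu> (G x)"
    and \<phi>: "\<And>m \<omega>. m \<in> D \<Longrightarrow> \<phi> m \<omega> = (\<Sum>x\<in>\<Lambda>. grad_flip x (F x) m \<omega> + grad_exch x (G x) m \<omega>)"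
    using \<phi>Q unfolding class_Q0_def by blast
  have hF: "homogeneous_quadratic (F x m)" and hG: "homogeneous_quadratic (G x m)"
    and cF: "continuous_on D (\<lambda>m. F x m \<omega>)" and cG: "continuous_on D (\<lambda>m. G x m \<omega>)"
    if "x \<in> \<Lambda>" "m \<in> D" for x m \<omega>
    using L(2)[OF that(1)] that(2) by (auto simp: quadratic_potential_def)
  have c\<phi>: "continuous_on D (\<lambda>m. \<phi> m \<omega>)" for \<omega>
  proof -
    have "continuous_on D (\<lambda>m. \<Sum>x\<in>\<Lambda>. grad_flip x (F x) m \<omega> + grad_exch x (G x) m \<omega>)"
      unfolding grad_flip_def grad_exch_def
      using L(2) by (intro continuous_intros) (auto simp: quadratic_potential_def)
    then show ?thesis by (simp add: \<phi> cong: continuous_on_cong)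
  qed
  have h\<phi>: "homogeneous_quadratic (\<phi> m)" if m: "m \<in> D" for m
  proof -
    have "homogeneous_quadratic (\<lambda>\<omega>. grad_flip x (F x) m \<omega> + grad_exch x (G x) m \<omega>)" if x: "x \<in> \<Lambda>" for x
      using homogeneous_quadratic_combine[OF
          homogeneous_quadratic_combine[OF homogeneous_quadratic_flip[OF hF[OF x m], of x] hF[OF x m], of "-1"]
          homogeneous_quadratic_combine[OF homogeneous_quadratic_exchange[OF hG[OF x m], of x] hG[OF x m], of "-1"], of 1]
      by (simp add: grad_flip_def grad_exch_def)
    from homogeneous_quadratic_sum[of \<Lambda>, OF this] have "homogeneous_quadratic (\<lambda>\<omega>. \<Sum>x\<in>\<Lambda>. grad_flip x (F x) m \<omega> + grad_exch x (G x) m \<omega>)" by simp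
    moreover have "\<phi> m = (\<lambda>\<omega>. \<Sum>x\<in>\<Lambda>. grad_flip x (F x) m \<omega> + grad_exch x (G x) m \<omega>)"
      using \<phi>[OF m] by blast
    ultimately show ?thesis by simp
  qed
  define \<alpha> where "\<alpha> m = (if m \<in> D then polarization s (\<phi> m) else (\<lambda>i j. 0))" for m
  have rep: "\<phi> m \<omega> = quad s (\<alpha> m) \<omega>" if m: "m \<in> D" for m \<omega>
  proof -
    have "\<phi> m \<omega> = \<phi> m (\<lambda>z. if \<bar>z\<bar> \<le> int s then \<omega> z else 0)" for \<omega>
      using dep m unfolding depends_only_on_def by simp
    then show ?thesis
      using homogeneous_quadratic_polarization[OF h\<phi>[OF m], of s \<omega>] m by (simp add: \<alpha>_def)
  qed
  have \<alpha>_local: "local_field s \<alpha>"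
    unfolding local_field_def
  proof (intro conjI allI)
    show "cont \<alpha>"
      unfolding cont_def
    proof (intro allI)
      fix i j
      have "continuous_on D (\<lambda>m. polarization s (\<phi> m) i j)"
        unfolding polarization_def
        by (cases "\<bar>i\<bar> \<le> int s \<and> \<bar>j\<bar> \<le> int s"; cases "i = j") (auto intro!: continuous_intros c\<phi>)
      then show "continuous_on D (\<lambda>m. \<alpha> m i j)" by (simp add: \<alpha>_def cong: continuous_on_cong)
    qed
    show "symm (\<alpha> m)" for m
      by (auto simp: symm_def \<alpha>_def polarization_def add.commute algebra_simps)
    show "supported s (\<alpha> m)" for m
      by (auto simp: supported_def \<alpha>_def polarization_def)
  qed
  have dp: "depends_on_box s \<alpha>"
    unfolding depends_on_box_def
  proof (intro ballI impI)
    fix m m' assume m: "m \<in> D" "m' \<in> D" "\<forall>x\<in>box s. m x = m' x"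
    then have "\<phi> m = \<phi> m'" using dep unfolding depends_only_on_def by blast
    then show "\<alpha> m = \<alpha> m'" using m by (simp add: \<alpha>_def)
  qed
  have tr: "(\<Sum>i\<in>box s. \<alpha> m i i) = 0" for m
  proof (cases "m \<in> D")
    case m: True
    \<comment> \<open>large enough for the exchanges over the bonds in \<open>\<Lambda>\<close> to permute the sites of the box\<close>
    define Z where "Z = Suc (s + nat (Max (insert 0 (abs ` \<Lambda>))))"
    have Z: "x \<in> bonds Z" if "x \<in> \<Lambda>" for x
    proof -
      have "\<bar>x\<bar> \<le> Max (insert 0 (abs ` \<Lambda>))" using L(1) that by (intro Max_ge) auto
      then have "\<bar>x\<bar> < int Z" unfolding Z_def by linarith
      then show ?thesis by auto
    qed
    have out: "\<phi> m (unit i) = 0" if "\<bar>i\<bar> > int s" for i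
    proof -
      have "\<phi> m (unit i) = \<phi> m (\<lambda>_. 0)"
        by (rule dep[unfolded depends_only_on_def, rule_format, OF m m]) (use that in \<open>auto simp: unit_def\<close>)
      also have "\<dots> = 0" using rep[OF m] by (simp add: quad_def)
      finally show ?thesis .
    qed
    have "(\<Sum>i\<in>box s. \<alpha> m i i) = (\<Sum>i\<in>box s. \<phi> m (unit i))"
      by (rule sum.cong) (simp_all add: \<alpha>_def m polarization_def)
    also have "\<dots> = (\<Sum>i\<in>box Z. \<phi> m (unit i))"
      by (rule sum_box_mono[symmetric]) (simp_all add: Z_def out)
    also have "\<dots> = (\<Sum>x\<in>\<Lambda>. \<Sum>i\<in>box Z. grad_flip x (F x) m (unit i) + grad_exch x (G x) m (unit i))"
      unfolding \<phi>[OF m] by (rule sum.swap)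
    also have "\<dots> = 0"
    proof (rule sum.neutral, rule ballI)
      fix x assume x: "x \<in> \<Lambda>"
      have "grad_flip x (F x) m (unit i) = 0" for i
      proof (cases "i = x")
        case True
        obtain A a where A: "\<And>\<omega>. F x m \<omega> = (\<Sum>i\<in>A. \<Sum>j\<in>A. a i j * \<omega> i * \<omega> j)"
          using hF[OF x m] unfolding homogeneous_quadratic_def by blast
        have "flip x (unit x) = (\<lambda>z. - unit x z)" by (auto simp: flip_def unit_def)
        then show ?thesis using True by (simp add: grad_flip_def A)
      next
        case False
        then have "flip x (unit i) = unit i" by (auto simp: flip_def unit_def)
        then show ?thesis by (simp add: grad_flip_def)
      qed
      moreover have "(\<Sum>i\<in>box Z. grad_exch x (G x) m (unit i)) = 0"
      proof -
        have "exchange x (unit i) = unit (swap_site x i)" for i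
          by (auto simp: exchange_swap_site unit_def fun_eq_iff)
        then show ?thesis
          using sum_swap_site[OF Z[OF x], of "\<lambda>i. G x m (unit i)"] by (simp add: grad_exch_def sum_subtractf)
      qed
      ultimately show "(\<Sum>i\<in>box Z. grad_flip x (F x) m (unit i) + grad_exch x (G x) m (unit i)) = 0"
        by simp
    qed
    finally show ?thesis .
  qed (simp add: \<alpha>_def)
  show thesis by (rule that[OF \<alpha>_local dp tr rep])
qed

end

section \<open>The resolvent of a box\<close>

definition off :: "matrix \<Rightarrow> matrix" where
  "off c i j = (if i = j then 0 else c i j)"

text \<open>
  The coefficient matrix of \<open>translate_sum L f\<close>.
\<close>

definition box_sum :: "int \<Rightarrow> mfield \<Rightarrow> mfield" where
  "box_sum L c m i j = (\<Sum>x\<in>{- L..L}. tau x c m i j)"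

lemma supported_box_sum:
  assumes c: "\<And>m. supported R (c m)" and l: "int R + L \<le> int l"
  shows "supported l (box_sum L c m)"
  unfolding supported_def
proof (intro allI impI, rule ccontr)
  fix i j assume ne: "box_sum L c m i j \<noteq> 0" and out: "\<not> (\<bar>i\<bar> \<le> int l \<and> \<bar>j\<bar> \<le> int l)"
  have "tau x c m i j = 0" if "x \<in> {- L..L}" for x
    by (rule tau_zero[OF c]) (use that out l in auto)
  then show False using ne by (simp add: box_sum_def)
qed

lemma symm_box_sum: "(\<And>m. symm (c m)) \<Longrightarrow> symm (box_sum L c m)"
  unfolding symm_def box_sum_def tau_def by simp

lemma hollow_box_sum: "(\<And>m. hollow (c m)) \<Longrightarrow> hollow (box_sum L c m)"
  unfolding hollow_def box_sum_def tau_def by simp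

lemma sum_window_le:
  fixes f :: "int \<Rightarrow> real"
  assumes S: "finite S" and f: "\<And>x. \<bar>x - y\<bar> > int R \<Longrightarrow> f x = 0" "\<And>x. x \<in> S \<Longrightarrow> f x \<le> K" and K: "0 \<le> K"
  shows "(\<Sum>x\<in>S. f x) \<le> (2 * real R + 1) * K"
proof -
  have "(\<Sum>x\<in>S. f x) = (\<Sum>x\<in>S \<inter> {y - int R..y + int R}. f x)"
  proof (rule sum.mono_neutral_right)
    show "\<forall>x\<in>S - S \<inter> {y - int R..y + int R}. f x = 0" by (intro ballI f(1)) auto
  qed (use S in auto)
  also have "\<dots> \<le> (\<Sum>x\<in>S \<inter> {y - int R..y + int R}. K)"
    by (intro sum_mono f(2)) auto
  also have "\<dots> = card (S \<inter> {y - int R..y + int R}) * K" by simp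
  also have "\<dots> \<le> (2 * real R + 1) * K"
  proof (rule mult_right_mono[OF _ K])
    have "card (S \<inter> {y - int R..y + int R}) \<le> card {y - int R..y + int R}"
      by (intro card_mono) auto
    then show "real (card (S \<inter> {y - int R..y + int R})) \<le> 2 * real R + 1" by simp
  qed
  finally show ?thesis .
qed

text \<open>
  At most \<open>(2 * R + 1)\<^sup>2\<close> entries of the translated matrix are different from zero.
\<close>

lemma l1_translate_le:
  assumes d: "supported R d" and K: "\<And>i j. \<bar>d i j\<bar> \<le> K"
  shows "(\<Sum>i\<in>box l. \<Sum>j\<in>box l. \<bar>d (i - x) (j - x)\<bar>) \<le> (2 * real R + 1)\<^sup>2 * K"
proof -
  have K0: "0 \<le> K" using K[of 0 0] by linarith
  have z: "d i j = 0" if "\<bar>i\<bar> > int R \<or> \<bar>j\<bar> > int R" for i j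
    using that d unfolding supported_def by fastforce
  have inner: "(\<Sum>j\<in>box l. \<bar>d (i - x) (j - x)\<bar>) \<le> (2 * real R + 1) * K" for i
    by (rule sum_window_le[where y = x and R = R]) (simp_all add: z K K0)
  have "(\<Sum>i\<in>box l. \<Sum>j\<in>box l. \<bar>d (i - x) (j - x)\<bar>) \<le> (2 * real R + 1) * ((2 * real R + 1) * K)"
    by (rule sum_window_le[where y = x and R = R]) (simp_all add: z inner K0)
  then show ?thesis by (simp add: power2_eq_square)
qed

lemma sum_by_parts:
  fixes f b :: "int \<Rightarrow> real"
  assumes "b (- int l - 1) = 0" "b (int l) = 0"
  shows "(\<Sum>i\<in>box l. f i * (b (i - 1) - b i)) = (\<Sum>i\<in>box l. (f (i + 1) - f i) * b i)"
proof -
  have "(\<Sum>i\<in>box l. f i * b (i - 1)) = (\<Sum>i\<in>{- int l - 1..int l - 1}. f (i + 1) * b i)"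
    by (rule sum.reindex_bij_witness[where i = "\<lambda>i. i + 1" and j = "\<lambda>i. i - 1"]) auto
  also have "\<dots> = (\<Sum>i\<in>{- int l - 1..int l}. f (i + 1) * b i)"
    by (rule sum.mono_neutral_left) (use assms in \<open>auto simp: not_le dest: order_antisym\<close>)
  also have "\<dots> = (\<Sum>i\<in>box l. f (i + 1) * b i)"
  proof (rule sum.mono_neutral_right)
    show "\<forall>i\<in>{- int l - 1..int l} - box l. f (i + 1) * b i = 0"
    proof
      fix i assume "i \<in> {- int l - 1..int l} - box l"
      then have "i = - int l - 1" by auto
      then show "f (i + 1) * b i = 0" using assms by simp
    qed
  qed auto
  finally show ?thesis by (simp add: algebra_simps sum_subtractf)
qed

context model begin

lemma cont_neg_gen: "cont c \<Longrightarrow> cont (\<lambda>m. neg_gen X (c m))"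
  unfolding cont_def
proof (intro allI)
  fix i j assume c: "\<forall>i j. continuous_on D (\<lambda>m. c m i j)"
  show "continuous_on D (\<lambda>m. neg_gen X (c m) i j)"
    using c by (cases "i = j") (auto simp: neg_gen_def intro!: continuous_intros)
qed

lemma cont_relax: "cont c \<Longrightarrow> cont (\<lambda>m. relax X (c m))"
  using cont_neg_gen[of c X] rate_pos unfolding cont_def relax_def by (auto intro!: continuous_intros)

lemma cont_relax_power: "cont c \<Longrightarrow> cont (\<lambda>m. (relax X ^^ n) (c m))"
  by (induction n) (simp_all add: cont_relax)

lemma cont_neumann_sum:
  assumes "cont c" shows "cont (\<lambda>m. neumann_sum n (c m))"
  unfolding cont_def neumann_sum_def
  using contD[OF cont_relax_power[OF assms]] rate_pos by (auto intro!: continuous_intros)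

text \<open>
  Uniform limit of continuous functions, by the geometric bound on the terms.
\<close>

lemma cont_neumann_series:
  assumes c: "cont c" and h: "\<And>m. hollow (c m)" and K: "\<And>m i j. m \<in> D \<Longrightarrow> \<bar>c m i j\<bar> \<le> K"
  shows "cont (\<lambda>m. neumann_series X (c m))"
  unfolding cont_def
proof (intro allI)
  fix i j
  have "uniform_limit D (\<lambda>n m. \<Sum>k<n. (relax X ^^ k) (c m) i j) (\<lambda>m. \<Sum>k. (relax X ^^ k) (c m) i j) sequentially"
  proof (rule Weierstrass_m_test)
    show "norm ((relax X ^^ n) (c m) i j) \<le> r ^ n * K" if "m \<in> D" for n m
      using relax_power_bound[OF h K[OF that]] by simp
    show "summable (\<lambda>n. r ^ n * K)"
      using r_bounds by (intro summable_mult2 summable_geometric) auto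
  qed
  then have "continuous_on D (\<lambda>m. \<Sum>k. (relax X ^^ k) (c m) i j)"
    by (rule uniform_limit_theorem[rotated])
      (auto intro!: always_eventually continuous_on_sum contD[OF cont_relax_power[OF c]])
  then show "continuous_on D (\<lambda>m. neumann_series X (c m) i j)"
    unfolding neumann_series_def using rate_pos by (auto intro!: continuous_intros)
qed

lemma cont_box_sum: "cont c \<Longrightarrow> cont (box_sum L c)"
  using cont_tau[of c] unfolding cont_def box_sum_def by (auto intro!: continuous_on_sum)

lemma neg_gen_box_sum: "neg_gen UNIV (box_sum L c m) i j = box_sum L (\<lambda>m. neg_gen UNIV (c m)) m i j"
proof -
  have "box_sum L c m = (\<lambda>i j. \<Sum>x\<in>{- L..L}. tau x c m i j)"
    by (intro ext) (simp add: box_sum_def)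
  then have "neg_gen UNIV (box_sum L c m) i j = (\<Sum>x\<in>{- L..L}. neg_gen UNIV (tau x c m) i j)"
    by (simp only: neg_gen_sum)
  also have "\<dots> = box_sum L (\<lambda>m. neg_gen UNIV (c m)) m i j"
    unfolding box_sum_def tau_def[abs_def] by (simp add: neg_gen_translate)
  finally show ?thesis .
qed

end

text \<open>
  The estimates only see the coefficients of the function; \<open>K0\<close> bounds them uniformly in the disorder.
\<close>

locale coefficients = model +
  fixes s :: nat and \<alpha> :: mfield and K0 :: real
  assumes \<alpha>_local: "local_field s \<alpha>" and dep: "depends_on_box s \<alpha>"
    and trace: "\<And>m. (\<Sum>i\<in>box s. \<alpha> m i i) = 0"
    and bound: "\<And>m i j. m \<in> D \<Longrightarrow> \<bar>\<alpha> m i j\<bar> \<le> K0"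
begin

lemmas \<alpha>_props = local_fieldD[OF \<alpha>_local]

lemma K0_nonneg: "0 \<le> K0"
proof -
  have "(\<lambda>_. 1) \<in> D" using C_gt_1 by (simp add: disorder_set_def)
  from bound[OF this, of 0 0] show ?thesis by linarith
qed

definition \<alpha>off :: mfield where "\<alpha>off m = off (\<alpha> m)"

lemma \<alpha>off_local: "local_field s \<alpha>off"
  unfolding local_field_def
proof (intro conjI allI)
  show "cont \<alpha>off"
    unfolding cont_def
  proof (intro allI)
    show "continuous_on D (\<lambda>m. \<alpha>off m i j)" for i j
      using contD[OF \<alpha>_props(1)] by (cases "i = j") (simp_all add: \<alpha>off_def off_def)
  qed
  show "symm (\<alpha>off m)" for m using \<alpha>_props(2)[of m] by (auto simp: symm_def \<alpha>off_def off_def)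
  show "supported s (\<alpha>off m)" for m using \<alpha>_props(3)[of m] unfolding supported_def \<alpha>off_def off_def by presburger
qed

lemmas \<alpha>off_props = local_fieldD[OF \<alpha>off_local]

lemma \<alpha>off_hollow: "hollow (\<alpha>off m)"
  by (simp add: hollow_def \<alpha>off_def off_def)

lemma \<alpha>off_bound: "m \<in> D \<Longrightarrow> \<bar>\<alpha>off m i j\<bar> \<le> K0"
  using bound K0_nonneg by (simp add: \<alpha>off_def off_def)

text \<open>
  The diagonal part of the function is \<open>\<Sum>i. primitive m i * (\<omega> (i + 1)\<^sup>2 - \<omega> i\<^sup>2)\<close>.  Summation starts
  at \<open>- s\<close>, below which the coefficients vanish; by the trace condition the primitive vanishes
  again from \<open>s\<close> on.
\<close>

definition primitive :: "config \<Rightarrow> int \<Rightarrow> real" where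
  "primitive m i = - (\<Sum>k\<in>{- int s..i}. \<alpha> m k k)"

lemma \<alpha>_diag_zero: "\<bar>i\<bar> > int s \<Longrightarrow> \<alpha> m i j = 0"
  using \<alpha>_props(3)[of m] unfolding supported_def by fastforce

lemma primitive_zero: "i < - int s \<or> i \<ge> int s \<Longrightarrow> primitive m i = 0"
proof -
  assume "i < - int s \<or> i \<ge> int s"
  then show ?thesis
  proof
    assume i: "i \<ge> int s"
    have "(\<Sum>k\<in>{- int s..i}. \<alpha> m k k) = (\<Sum>k\<in>box s. \<alpha> m k k)"
      by (rule sum.mono_neutral_right) (use i \<alpha>_diag_zero in \<open>auto simp: box_def not_le\<close>)
    then show ?thesis using trace by (simp add: primitive_def)
  qed (simp add: primitive_def)
qed

lemma \<alpha>_diag: "\<alpha> m i i = primitive m (i - 1) - primitive m i"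
proof (cases "i < - int s")
  case True
  then show ?thesis using \<alpha>_diag_zero[of i m i] by (simp add: primitive_zero)
next
  case False
  then have "{- int s..i} = insert i {- int s..i - 1}" by auto
  then show ?thesis by (simp add: primitive_def)
qed

lemma cont_primitive: "continuous_on D (\<lambda>m. primitive m i)"
  unfolding primitive_def by (intro continuous_intros contD[OF \<alpha>_props(1)])

definition Kb :: real where "Kb = (2 * real s + 1) * K0"

lemma Kb_nonneg: "0 \<le> Kb" using K0_nonneg by (simp add: Kb_def)

lemma primitive_bound: "m \<in> D \<Longrightarrow> \<bar>primitive m i\<bar> \<le> Kb"
proof -
  assume m: "m \<in> D"
  have "\<bar>primitive m i\<bar> \<le> (\<Sum>k\<in>{- int s..i}. \<bar>\<alpha> m k k\<bar>)" by (simp add: primitive_def)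
  also have "\<dots> \<le> (2 * real s + 1) * K0"
    by (rule sum_window_le[where y = 0 and R = s]) (simp_all add: \<alpha>_diag_zero bound[OF m] K0_nonneg)
  finally show ?thesis by (simp add: Kb_def)
qed

text \<open>
  The diagonal part of the formal sum of the translates is
  \<open>\<Sum>y. B (shift y m) * (\<omega> (y + 1)\<^sup>2 - \<omega> y\<^sup>2)\<close>, and \<open>box_current\<close> is the corresponding coefficient for the
  sum of the translates by \<open>{- L..L}\<close>.
\<close>

definition B :: "config \<Rightarrow> real" where
  "B m = (\<Sum>i\<in>box s. primitive (shift (- i) m) i)"

definition KB :: real where "KB = (2 * real s + 1) * Kb"

lemma cont_B: "continuous_on D B"
  unfolding B_def[abs_def] by (intro continuous_on_sum continuous_shift cont_primitive)

lemma KB_nonneg: "0 \<le> KB" using Kb_nonneg by (simp add: KB_def)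

definition box_current :: "int \<Rightarrow> config \<Rightarrow> int \<Rightarrow> real" where
  "box_current L m y = (\<Sum>x\<in>{- L..L}. primitive (shift x m) (y - x))"

lemma box_current_bound: "m \<in> D \<Longrightarrow> \<bar>box_current L m y\<bar> \<le> KB"
proof -
  assume m: "m \<in> D"
  have "\<bar>box_current L m y\<bar> \<le> (\<Sum>x\<in>{- L..L}. \<bar>primitive (shift x m) (y - x)\<bar>)" by (simp add: box_current_def)
  also have "\<dots> \<le> (2 * real s + 1) * Kb"
    by (rule sum_window_le[where y = y and R = s]) (auto intro!: primitive_zero primitive_bound shift_disorder m Kb_nonneg)
  finally show ?thesis by (simp add: KB_def)
qed

lemma box_current_bulk:
  assumes "\<bar>y\<bar> + int s \<le> L"
  shows "box_current L m y = B (shift y m)"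
proof -
  have "box_current L m y = (\<Sum>x\<in>{y - int s..y + int s}. primitive (shift x m) (y - x))"
    unfolding box_current_def by (rule sum.mono_neutral_right) (use assms in \<open>auto intro!: primitive_zero\<close>)
  also have "\<dots> = (\<Sum>i\<in>box s. primitive (shift (- i) (shift y m)) i)"
    by (rule sum.reindex_bij_witness[where i = "\<lambda>i. y - i" and j = "\<lambda>x. y - x"])
      (auto simp: shift_shift)
  finally show ?thesis by (simp add: B_def)
qed

lemma B_eq_box_current: "B m = box_current (int s) m 0"
  using box_current_bulk[of 0 "int s" m] by simp

lemma B_bound: "m \<in> D \<Longrightarrow> \<bar>B m\<bar> \<le> KB"
  by (simp add: B_eq_box_current box_current_bound)

lemma cont_box_current: "continuous_on D (\<lambda>m. box_current L m y)"
  unfolding box_current_def by (intro continuous_on_sum continuous_shift cont_primitive)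

lemma box_sum_diag: "box_sum L \<alpha> m y y = box_current L m (y - 1) - box_current L m y"
  unfolding box_sum_def box_current_def tau_def sum_subtractf[symmetric]
  by (intro sum.cong refl) (simp add: \<alpha>_diag algebra_simps)

lemma box_current_zero: "\<lbrakk>y < - L - int s \<or> y \<ge> L + int s\<rbrakk> \<Longrightarrow> box_current L m y = 0"
  unfolding box_current_def by (intro sum.neutral ballI primitive_zero) auto

text \<open>
  On diagonal matrices \<open>neg_gen (bonds l)\<close> is \<open>lam\<close> times minus the Neumann Laplacian of the box, and the
  right-hand side is the discrete derivative of the current; so the increments of the solution are
  the current divided by \<open>lam\<close>.
\<close>

definition diag_solution :: "nat \<Rightarrow> int \<Rightarrow> mfield" where
  "diag_solution l L m i j = (if i = j \<and> \<bar>i\<bar> \<le> int l then (\<Sum>z\<in>{- int l..i - 1}. box_current L m z) / lam else 0)"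

lemma neg_gen_diag_solution:
  assumes L: "L + int s < int l"
  shows "neg_gen (bonds l) (diag_solution l L m) i j = (if i = j then box_sum L \<alpha> m i i else 0)"
proof (cases "i = j")
  case False
  then show ?thesis by (simp add: neg_gen_def diag_solution_def)
next
  case True
  define f where "f i = (\<Sum>z\<in>{- int l..i - 1}. box_current L m z) / lam" for i
  have step: "lam * (f i - f (i + 1)) = - box_current L m i" if "- int l \<le> i" for i
  proof -
    have "{- int l..i + 1 - 1} = insert i {- int l..i - 1}" using that by auto
    then show ?thesis using lam_pos by (simp add: f_def field_simps)
  qed
  \<comment> \<open>the currents through both ends of the box vanish, which is compatible with the Neumann condition\<close>
  have z: "box_current L m (int l) = 0" "box_current L m (- int l - 1) = 0" using L by (auto intro!: box_current_zero)
  have Aii: "neg_gen (bonds l) h i i = lam * ((if - int l \<le> i - 1 \<and> i - 1 < int l then h i i - h (i - 1) (i - 1) else 0)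
      + (if - int l \<le> i \<and> i < int l then h i i - h (i + 1) (i + 1) else 0))" for h
  proof -
    have "bonds l \<inter> touching i i = (if - int l \<le> i - 1 \<and> i - 1 < int l then {i - 1} else {})
        \<union> (if - int l \<le> i \<and> i < int l then {i} else {})"
      by (auto simp: touching_def)
    then show ?thesis by (simp add: neg_gen_def swap_site_def)
  qed
  have hdf: "diag_solution l L m k k = (if \<bar>k\<bar> \<le> int l then f k else 0)" for k by (simp add: diag_solution_def f_def)
  have "neg_gen (bonds l) (diag_solution l L m) i i = box_sum L \<alpha> m i i"
  proof (cases "\<bar>i\<bar> \<le> int l")
    case False
    then have "box_current L m (i - 1) = 0" "box_current L m i = 0" using L by (auto intro!: box_current_zero)
    then show ?thesis using False by (auto simp: Aii hdf box_sum_diag)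
  next
    case i: True
    have up: "lam * (if - int l \<le> i \<and> i < int l then diag_solution l L m i i - diag_solution l L m (i + 1) (i + 1) else 0) = - box_current L m i"
    proof (cases "i = int l")
      case False
      then have "- int l \<le> i" "i < int l" "\<bar>i + 1\<bar> \<le> int l" using i by linarith+
      then show ?thesis using i step[of i] by (simp add: hdf)
    qed (simp add: z)
    have down: "lam * (if - int l \<le> i - 1 \<and> i - 1 < int l then diag_solution l L m i i - diag_solution l L m (i - 1) (i - 1) else 0) = box_current L m (i - 1)"
    proof (cases "i = - int l")
      case False
      then have "- int l \<le> i - 1" "i - 1 < int l" "\<bar>i - 1\<bar> \<le> int l" using i by linarith+
      then show ?thesis using i step[of "i - 1"] by (simp add: hdf right_diff_distrib)
    qed (simp add: z)
    show ?thesis unfolding Aii distrib_left up down box_sum_diag by simp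
  qed
  then show ?thesis using True by simp
qed

lemma box_sum_off: "box_sum L \<alpha>off m i j = (if i = j then 0 else box_sum L \<alpha> m i j)"
  by (simp add: box_sum_def tau_def \<alpha>off_def off_def)

lemma box_sum_\<alpha>off_bound: "m \<in> D \<Longrightarrow> \<bar>box_sum L \<alpha>off m i j\<bar> \<le> Kb"
proof -
  assume m: "m \<in> D"
  have "\<bar>box_sum L \<alpha>off m i j\<bar> \<le> (\<Sum>x\<in>{- L..L}. \<bar>tau x \<alpha>off m i j\<bar>)" by (simp add: box_sum_def)
  also have "\<dots> \<le> (2 * real s + 1) * K0"
  proof (rule sum_window_le[where y = i and R = s])
    show "\<bar>tau x \<alpha>off m i j\<bar> = 0" if "\<bar>x - i\<bar> > int s" for x
      using tau_zero[where c = \<alpha>off and x = x and i = i, OF \<alpha>off_props(3)] that by (simp add: abs_minus_commute)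
    show "\<bar>tau x \<alpha>off m i j\<bar> \<le> K0" for x by (simp add: tau_def \<alpha>off_bound m)
  qed (simp_all add: K0_nonneg)
  finally show ?thesis by (simp add: Kb_def)
qed

definition off_solution :: "nat \<Rightarrow> int \<Rightarrow> mfield" where
  "off_solution l L m = neumann_series (bonds l) (box_sum L \<alpha>off m)"

lemma cont_off_solution: "cont (off_solution l L)"
  unfolding off_solution_def[abs_def]
  by (rule cont_neumann_series[OF cont_box_sum[OF \<alpha>off_props(1)] hollow_box_sum[OF \<alpha>off_hollow] box_sum_\<alpha>off_bound])

lemma off_solution_hollow: "hollow (off_solution l L m)"
  unfolding off_solution_def by (intro neumann_series_props hollow_box_sum \<alpha>off_hollow)

lemma neg_gen_off_solution: "m \<in> D \<Longrightarrow> neg_gen (bonds l) (off_solution l L m) i j = box_sum L \<alpha>off m i j"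
  unfolding off_solution_def by (rule neg_gen_neumann_series[OF hollow_box_sum[OF \<alpha>off_hollow] box_sum_\<alpha>off_bound])

lemma off_solution_bound: "m \<in> D \<Longrightarrow> \<bar>off_solution l L m i j\<bar> \<le> Kb / (4 * \<gamma>)"
  unfolding off_solution_def by (rule neumann_series_bound[OF hollow_box_sum[OF \<alpha>off_hollow] box_sum_\<alpha>off_bound])

text \<open>
  The explicit preimage is the sum of \<open>diag_solution\<close> and \<open>off_solution\<close>.  A summation by parts turns
  the diagonal part of the pairing into the square of the current.
\<close>

theorem resolvent_pairing:
  assumes L: "L + int s < int l" and \<phi>: "\<And>m \<omega>. m \<in> D \<Longrightarrow> \<phi> m \<omega> = quad s (\<alpha> m) \<omega>"
  shows "E_star \<nu> (\<lambda>m \<omega>. neg_generator_inv \<nu> \<gamma> lam l (translate_sum L \<phi>) m \<omega> * translate_sum L \<phi> m \<omega>)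
     = 2 / lam * mean (\<lambda>m. \<Sum>y\<in>box l. (box_current L m y)\<^sup>2) + 2 * mean (\<lambda>m. dot l (off_solution l L m) (box_sum L \<alpha>off m))"
proof -
  define h where "h m i j = diag_solution l L m i j + off_solution l L m i j" for m i j
  define \<Phi> where "\<Phi> = translate_sum L \<phi>"
  have \<Phi>: "\<Phi> m \<omega> = quad l (box_sum L \<alpha> m) \<omega>" if m: "m \<in> D" for m \<omega>
  proof -
    have "\<Phi> m \<omega> = (\<Sum>x\<in>{- L..L}. quad l (tau x \<alpha> m) \<omega>)"
      unfolding \<Phi>_def translate_sum_def
    proof (intro sum.cong refl)
      fix x assume x: "x \<in> {- L..L}"
      have "translate x \<phi> m \<omega> = translate x (\<lambda>m. quad s (\<alpha> m)) m \<omega>"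
        by (rule translate_cong[OF \<phi> m])
      also have "\<dots> = quad l (tau x \<alpha> m) \<omega>"
        by (rule translate_quad[OF \<alpha>_props(3)]) (use x L in auto)
      finally show "translate x \<phi> m \<omega> = quad l (tau x \<alpha> m) \<omega>" .
    qed
    then show ?thesis by (simp add: quad_sum box_sum_def[abs_def])
  qed
  have cont_diag_solution: "cont (diag_solution l L)"
    unfolding cont_def
  proof (intro allI)
    show "continuous_on D (\<lambda>m. diag_solution l L m i j)" for i j
      using lam_pos by (cases "i = j"; cases "\<bar>i\<bar> \<le> int l") (auto simp: diag_solution_def intro!: continuous_intros cont_box_current)
  qed
  have cont_h: "cont h"
    using cont_diag_solution cont_off_solution unfolding cont_def h_def by (auto intro!: continuous_intros)
  have Ah: "neg_gen (bonds l) (h m) i j = box_sum L \<alpha> m i j" if m: "m \<in> D" for m i j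
    unfolding h_def[abs_def] by (simp only: neg_gen_add neg_gen_diag_solution[OF L] neg_gen_off_solution[OF m]) (simp add: box_sum_off)
  have "E_star \<nu> (\<lambda>m \<omega>. neg_generator_inv \<nu> \<gamma> lam l \<Phi> m \<omega> * \<Phi> m \<omega>)
      = E_star \<nu> (\<lambda>m \<omega>. quad l (h m) \<omega> * \<Phi> m \<omega>)"
  proof (rule neg_generator_inv_pairing)
    show "sq_integrable J (\<lambda>z. quad l (h (fst z)) (snd z))" by (rule sq_integrable_quad[OF cont_h])
    show "- generator \<gamma> lam l (\<lambda>m. quad l (h m)) m \<omega> = \<Phi> m \<omega>" if m: "m \<in> D" for m \<omega>
    proof -
      have "neg_gen (bonds l) (h m) = box_sum L \<alpha> m" by (intro ext Ah[OF m])
      then show ?thesis by (simp only: generator_quad \<Phi>[OF m] minus_minus)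
    qed
  qed
  also have "\<dots> = E_star \<nu> (\<lambda>m \<omega>. quad l (box_sum L \<alpha> m) \<omega> * quad l (h m) \<omega>)"
    by (rule E_star_cong) (simp add: \<Phi> mult.commute)
  also have "\<dots> = 2 * mean (\<lambda>m. dot l (box_sum L \<alpha> m) (h m))"
  proof (rule E_star_quad[OF cont_box_sum[OF \<alpha>_props(1)] cont_h])
    show "symm (h m)" for m
      using neumann_series_props(1)[OF symm_box_sum[OF \<alpha>off_props(2)]] unfolding symm_def h_def diag_solution_def off_solution_def by simp
    show "(\<Sum>i\<in>box l. box_sum L \<alpha> m i i) = 0" for m
      using sum_by_parts[of "box_current L m" l "\<lambda>_. 1"] L by (simp add: box_sum_diag box_current_zero)
  qed
  also have "(\<lambda>m. dot l (box_sum L \<alpha> m) (h m)) = (\<lambda>m. (\<Sum>y\<in>box l. (box_current L m y)\<^sup>2) / lam + dot l (off_solution l L m) (box_sum L \<alpha>off m))"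
  proof
    fix m
    define f where "f i = (\<Sum>z\<in>{- int l..i - 1}. box_current L m z) / lam" for i
    have "dot l (box_sum L \<alpha> m) (diag_solution l L m) = (\<Sum>i\<in>box l. f i * (box_current L m (i - 1) - box_current L m i))"
      by (simp add: dot_def diag_solution_def f_def box_sum_diag if_distrib mult.commute cong: if_cong)
    also have "\<dots> = (\<Sum>i\<in>box l. (f (i + 1) - f i) * box_current L m i)"
      by (rule sum_by_parts) (use L in \<open>auto intro!: box_current_zero\<close>)
    also have "\<dots> = (\<Sum>i\<in>box l. (box_current L m i)\<^sup>2 / lam)"
    proof (intro sum.cong refl)
      fix i assume "i \<in> box l"
      then have "{- int l..i + 1 - 1} = insert i {- int l..i - 1}" by auto
      then have "f (i + 1) - f i = box_current L m i / lam" by (simp add: f_def add_divide_distrib)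
      then show "(f (i + 1) - f i) * box_current L m i = (box_current L m i)\<^sup>2 / lam" by (simp add: power2_eq_square)
    qed
    finally have "dot l (box_sum L \<alpha> m) (diag_solution l L m) = (\<Sum>i\<in>box l. (box_current L m i)\<^sup>2) / lam"
      by (simp add: sum_divide_distrib)
    moreover have "dot l (box_sum L \<alpha> m) (off_solution l L m) = dot l (off_solution l L m) (box_sum L \<alpha>off m)"
      using off_solution_hollow[of l L m] by (subst dot_commute) (rule dot_cong, auto simp: box_sum_off hollow_def)
    ultimately show "dot l (box_sum L \<alpha> m) (h m) = (\<Sum>y\<in>box l. (box_current L m y)\<^sup>2) / lam + dot l (off_solution l L m) (box_sum L \<alpha>off m)"
      by (simp add: h_def[abs_def] dot_def distrib_left sum.distrib)
  qed
  also have "2 * mean \<dots> = 2 / lam * mean (\<lambda>m. \<Sum>y\<in>box l. (box_current L m y)\<^sup>2) + 2 * mean (\<lambda>m. dot l (off_solution l L m) (box_sum L \<alpha>off m))"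
    using lam_pos by (subst Bochner_Integration.integral_add)
      (auto intro!: integrable_continuous_disorder continuous_intros continuous_dot cont_box_current cont_off_solution cont_box_sum \<alpha>off_props)
  finally show ?thesis by (simp add: \<Phi>_def)
qed

text \<open>
  By stationarity every site in the bulk contributes \<open>\<langle>B\<^sup>2\<rangle>\<close>; at most \<open>4 * s + 2\<close> sites near the ends
  do not belong to the bulk.
\<close>

lemma diagonal_bound:
  assumes l: "2 * s + 1 \<le> l"
  shows "mean (\<lambda>m. \<Sum>y\<in>box l. (box_current (int l - int s - 1) m y)\<^sup>2)
    \<le> (2 * real l + 1) * mean (\<lambda>m. (B m)\<^sup>2) + (4 * real s + 2) * KB\<^sup>2"
proof -
  interpret prob_space P by (rule prob_disorder)
  define L where "L = int l - int s - 1"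
  have "mean (\<lambda>m. \<Sum>y\<in>box l. (box_current L m y)\<^sup>2) = (\<Sum>y\<in>box l. mean (\<lambda>m. (box_current L m y)\<^sup>2))"
    by (rule mean_sum) (intro continuous_intros cont_box_current)
  also have "\<dots> \<le> (\<Sum>y\<in>box l. mean (\<lambda>m. (B m)\<^sup>2) + (if \<bar>y\<bar> + int s \<le> L then 0 else KB\<^sup>2))"
  proof (rule sum_mono)
    fix y
    show "mean (\<lambda>m. (box_current L m y)\<^sup>2) \<le> mean (\<lambda>m. (B m)\<^sup>2) + (if \<bar>y\<bar> + int s \<le> L then 0 else KB\<^sup>2)"
    proof (cases "\<bar>y\<bar> + int s \<le> L")
      case True
      have "mean (\<lambda>m. (B (shift y m))\<^sup>2) = mean (\<lambda>m. (B m)\<^sup>2)"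
        by (rule mean_shift[of "\<lambda>m. (B m)\<^sup>2"]) (intro continuous_intros cont_B)
      then show ?thesis using True by (simp add: box_current_bulk)
    next
      case False
      have "mean (\<lambda>m. (box_current L m y)\<^sup>2) \<le> mean (\<lambda>m. KB\<^sup>2)"
      proof (rule integral_mono)
        show "(box_current L m y)\<^sup>2 \<le> KB\<^sup>2" if "m \<in> space P" for m
          using box_current_bound[of m L y] that KB_nonneg by (simp add: space_disorder abs_le_square_iff[symmetric])
      qed (auto intro!: integrable_continuous_disorder continuous_intros cont_box_current)
      then have "mean (\<lambda>m. (box_current L m y)\<^sup>2) \<le> KB\<^sup>2" by (simp add: prob_space)
      moreover have "0 \<le> mean (\<lambda>m. (B m)\<^sup>2)" by simp
      ultimately show ?thesis unfolding if_not_P[OF False] by linarith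
    qed
  qed
  also have "\<dots> = (2 * real l + 1) * mean (\<lambda>m. (B m)\<^sup>2) + real (card {y \<in> box l. \<not> \<bar>y\<bar> + int s \<le> L}) * KB\<^sup>2"
    by (simp add: sum.distrib sum.If_cases Int_def conj_commute)
  also have "\<dots> \<le> (2 * real l + 1) * mean (\<lambda>m. (B m)\<^sup>2) + (4 * real s + 2) * KB\<^sup>2"
  proof (intro add_left_mono mult_right_mono)
    have "{y \<in> box l. \<not> \<bar>y\<bar> + int s \<le> L} \<subseteq> {- int l..int s - L - 1} \<union> {L - int s + 1..int l}" by auto
    then have "card {y \<in> box l. \<not> \<bar>y\<bar> + int s \<le> L} \<le> card ({- int l..int s - L - 1} \<union> {L - int s + 1..int l})"
      by (intro card_mono) auto
    also have "\<dots> \<le> card {- int l..int s - L - 1} + card {L - int s + 1..int l}" by (rule card_Un_le)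
    also have "\<dots> = 4 * s + 2" using l by (simp add: L_def)
    finally show "real (card {y \<in> box l. \<not> \<bar>y\<bar> + int s \<le> L}) \<le> 4 * real s + 2" by linarith
  qed simp
  finally show ?thesis by (simp add: L_def)
qed

text \<open>
  The corrector inverts the generator on the off-diagonal part up to the residual, and \<open>\<theta> n\<close> is
  half the pairing \<open>\<ll>\<alpha>off, corrector n\<gg>\<close>; the whole pairing approximates the off-diagonal
  contribution per site to the resolvent.
\<close>

definition corrector :: "nat \<Rightarrow> mfield" where "corrector n m = neumann_sum n (\<alpha>off m)"

definition residual :: "nat \<Rightarrow> mfield" where "residual n m = (relax UNIV ^^ n) (\<alpha>off m)"

definition \<theta> :: "nat \<Rightarrow> real" where "\<theta> n = mean (\<lambda>m. dot (s + n) (corrector n m) (Gam \<alpha>off m))"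

lemma corrector_local: "local_field (s + n) (corrector n)"
  unfolding local_field_def corrector_def[abs_def]
  using cont_neumann_sum[OF \<alpha>off_props(1)] symm_neumann_sum[OF \<alpha>off_props(2)] supported_neumann_sum[OF \<alpha>off_props(3)] by auto

lemma corrector_hollow: "hollow (corrector n m)"
  unfolding corrector_def by (intro hollow_neumann_sum \<alpha>off_hollow)

lemma corrector_bound: "m \<in> D \<Longrightarrow> \<bar>corrector n m i j\<bar> \<le> K0 / (4 * \<gamma>)"
  unfolding corrector_def by (rule neumann_sum_bound[OF \<alpha>off_hollow \<alpha>off_bound])

lemma residual_local: "local_field (s + n) (residual n)"
  unfolding local_field_def residual_def[abs_def]
  using cont_relax_power[OF \<alpha>off_props(1)] relax_power_props(1)[OF \<alpha>off_props(2)] relax_power_props(4)[OF \<alpha>off_props(3)] by auto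

lemma residual_bound: "m \<in> D \<Longrightarrow> \<bar>residual n m i j\<bar> \<le> r ^ n * K0"
  unfolding residual_def by (rule relax_power_bound[OF \<alpha>off_hollow \<alpha>off_bound])

lemma neg_gen_corrector: "neg_gen UNIV (corrector n m) i j = \<alpha>off m i j - residual n m i j"
  unfolding corrector_def residual_def by (rule neg_gen_neumann_sum)

text \<open>
  The translates of the corrector are kept at distance \<open>2 * s + n\<close> from the boundary of the box of
  translates of \<open>\<alpha>off\<close>.  There the two sums cannot be distinguished, and all terms are equal
  by stationarity.
\<close>

lemma Gam_dot_box_sum:
  assumes l: "3 * s + n + 1 \<le> l"
  defines "L \<equiv> int l - int s - 1" and "L' \<equiv> int l - 3 * int s - int n - 1"
  shows "mean (\<lambda>m. dot l (box_sum L' (corrector n) m) (box_sum L \<alpha>off m)) = (2 * real_of_int L' + 1) * \<theta> n"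
proof -
  note g' = local_fieldD[OF corrector_local[of n]]
  have L': "0 \<le> L'" using l by (simp add: L'_def)
  have "mean (\<lambda>m. dot l (box_sum L' (corrector n) m) (box_sum L \<alpha>off m))
      = mean (\<lambda>m. dot l (\<lambda>i j. \<Sum>x\<in>{- L'..L'}. tau x (corrector n) m i j) (box_sum L \<alpha>off m))"
    by (simp add: box_sum_def[abs_def])
  also have "\<dots> = (\<Sum>x\<in>{- L'..L'}. mean (\<lambda>m. dot l (tau x (corrector n) m) (box_sum L \<alpha>off m)))"
    by (intro mean_dot_sum cont_tau g' cont_box_sum \<alpha>off_props)
  also have "\<dots> = (\<Sum>x\<in>{- L'..L'}. \<theta> n)"
  proof (intro sum.cong refl)
    fix x assume x: "x \<in> {- L'..L'}"
    have "dot l (tau x (corrector n) m) (box_sum L \<alpha>off m) = dot l (Gam \<alpha>off m) (tau x (corrector n) m)" for m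
    proof (subst dot_commute, rule dot_cong)
      fix i j
      show "box_sum L \<alpha>off m i j * tau x (corrector n) m i j = Gam \<alpha>off m i j * tau x (corrector n) m i j"
      proof (cases "tau x (corrector n) m i j = 0")
        case False
        then have i: "\<bar>i - x\<bar> \<le> int (s + n)"
          using tau_zero[where c = "corrector n" and x = x and i = i and j = j and m = m, OF g'(3)] by (meson not_le)
        have "Gam \<alpha>off m i j = box_sum L \<alpha>off m i j"
          unfolding box_sum_def by (rule Gam_eq[OF \<alpha>off_props(3)]) (use i x in \<open>auto simp: L_def L'_def\<close>)
        then show ?thesis by simp
      qed simp
    qed
    then have "mean (\<lambda>m. dot l (tau x (corrector n) m) (box_sum L \<alpha>off m)) = mean (\<lambda>m. dot l (Gam \<alpha>off m) (tau x (corrector n) m))"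
      by simp
    also have "\<dots> = mean (\<lambda>m. dot l (tau (- (- x)) (corrector n) m) (Gam \<alpha>off m))"
      by (simp add: dot_commute)
    also have "\<dots> = mean (\<lambda>m. dot l (corrector n m) (tau (- x) (Gam \<alpha>off) m))"
    proof (rule mean_dot_tau[symmetric, where R = "s + n"])
      have "\<bar>x\<bar> \<le> L'" using x by auto
      then have "int (s + n + nat \<bar>- x\<bar>) \<le> int l" by (simp add: L'_def)
      then show "s + n + nat \<bar>- x\<bar> \<le> l" by (simp only: of_nat_le_iff)
    qed (intro g' cont_Gam[OF \<alpha>off_local])+
    also have "(\<lambda>m. dot l (corrector n m) (tau (- x) (Gam \<alpha>off) m)) = (\<lambda>m. dot (s + n) (corrector n m) (Gam \<alpha>off m))"
    proof
      fix m
      have "tau (- x) (Gam \<alpha>off) m = Gam \<alpha>off m"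
        by (intro ext) (simp only: tau_def Gam_shift[OF \<alpha>off_props(3)])
      then show "dot l (corrector n m) (tau (- x) (Gam \<alpha>off) m) = dot (s + n) (corrector n m) (Gam \<alpha>off m)"
        using dot_mono[OF g'(3), of l] l by simp
    qed
    also have "mean \<dots> = \<theta> n" by (simp add: \<theta>_def)
    finally show "mean (\<lambda>m. dot l (tau x (corrector n) m) (box_sum L \<alpha>off m)) = \<theta> n" .
  qed
  also have "\<dots> = (2 * real_of_int L' + 1) * \<theta> n" using L' by simp
  finally show ?thesis .
qed

lemma l1_tau_le:
  assumes c: "supported R (c (shift x m))" and K: "\<And>i j. \<bar>c (shift x m) i j\<bar> \<le> K"
  shows "(\<Sum>i\<in>box l. \<Sum>j\<in>box l. \<bar>tau x c m i j\<bar>) \<le> (2 * real R + 1)\<^sup>2 * K"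
  unfolding tau_def by (rule l1_translate_le[OF c K])

lemma l1_sum_le:
  assumes "\<And>x. x \<in> S \<Longrightarrow> (\<Sum>i\<in>box l. \<Sum>j\<in>box l. \<bar>f x i j\<bar>) \<le> (K::real)"
  shows "(\<Sum>i\<in>box l. \<Sum>j\<in>box l. \<bar>\<Sum>x\<in>S. f x i j\<bar>) \<le> real (card S) * K"
proof -
  have "(\<Sum>i\<in>box l. \<Sum>j\<in>box l. \<bar>\<Sum>x\<in>S. f x i j\<bar>) \<le> (\<Sum>i\<in>box l. \<Sum>j\<in>box l. \<Sum>x\<in>S. \<bar>f x i j\<bar>)"
    by (intro sum_mono sum_abs)
  also have "\<dots> = (\<Sum>i\<in>box l. \<Sum>x\<in>S. \<Sum>j\<in>box l. \<bar>f x i j\<bar>)"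
    by (intro sum.cong refl) (rule sum.swap)
  also have "\<dots> = (\<Sum>x\<in>S. \<Sum>i\<in>box l. \<Sum>j\<in>box l. \<bar>f x i j\<bar>)" by (rule sum.swap)
  also have "\<dots> \<le> (\<Sum>x\<in>S. K)" by (intro sum_mono assms)
  finally show ?thesis by simp
qed

text \<open>
  The error per site: the sum of the absolute values of the entries of the residual, times the bound
  \<open>Kb / (4 * \<gamma>)\<close> for the solution in the box.
\<close>

definition \<epsilon> :: "nat \<Rightarrow> real" where
  "\<epsilon> n = (2 * real (s + n) + 1)\<^sup>2 * (r ^ n * K0) * (Kb / (4 * \<gamma>))"

text \<open>
  Write \<open>k\<close> for the solution in the box, \<open>\<Phi>\<close> for the right-hand side and \<open>u\<close> for the sum of the
  correctors.  By symmetry \<open>dot l (k - u) \<Phi> = dot l (\<Phi> - A u) k\<close> with \<open>A = neg_gen (bonds l)\<close>.  The matrix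
  \<open>\<Phi> - A u\<close> consists of the residuals and of the translates of \<open>\<alpha>off\<close> near the boundary, so its
  sum norm per site is small, while \<open>k\<close> is bounded in the supremum norm.
\<close>

lemma corrector_error:
  assumes l: "3 * s + n + 1 \<le> l" and m: "m \<in> D"
  defines "L \<equiv> int l - int s - 1" and "L' \<equiv> int l - 3 * int s - int n - 1"
  shows "dot l (off_solution l L m) (box_sum L \<alpha>off m) - dot l (box_sum L' (corrector n) m) (box_sum L \<alpha>off m)
    \<le> 2 * real l * \<epsilon> n + (4 * real s + 2 * real n) * ((2 * real s + 1)\<^sup>2 * K0 * (Kb / (4 * \<gamma>)))"
proof -
  note g' = local_fieldD[OF corrector_local[of n]]
  define k where "k = off_solution l L m"
  define u where "u = box_sum L' (corrector n) m"
  define \<Phi> where "\<Phi> = box_sum L \<alpha>off m"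
  define res where "res i j = \<Phi> i j - neg_gen (bonds l) u i j" for i j
  have L': "0 \<le> L'" "L' \<le> L" using l by (simp_all add: L'_def L_def)
  have Ak: "neg_gen (bonds l) k = \<Phi>" unfolding k_def \<Phi>_def by (intro ext neg_gen_off_solution m)
  have "dot l k \<Phi> - dot l u \<Phi> = dot l (\<lambda>i j. k i j - u i j) (neg_gen (bonds l) k)"
    by (simp add: dot_diff_left Ak)
  also have "\<dots> = dot l k (neg_gen (bonds l) k) - dot l u (neg_gen (bonds l) k)"
    by (simp add: dot_diff_left)
  also have "\<dots> = dot l \<Phi> k - dot l (neg_gen (bonds l) u) k"
    using neg_gen_symmetric[of l u k] by (simp add: Ak dot_commute)
  also have "\<dots> = dot l res k" by (simp add: res_def[abs_def] dot_diff_left)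
  also have "\<dots> \<le> \<bar>dot l res k\<bar>" by simp
  also have "\<dots> \<le> (\<Sum>i\<in>box l. \<Sum>j\<in>box l. \<bar>res i j\<bar>) * (Kb / (4 * \<gamma>))"
    by (rule abs_dot_le) (simp add: k_def off_solution_bound[OF m])
  also have "\<dots> \<le> (real (card ({- L..L} - {- L'..L'})) * ((2 * real s + 1)\<^sup>2 * K0)
      + real (card {- L'..L'}) * ((2 * real (s + n) + 1)\<^sup>2 * (r ^ n * K0))) * (Kb / (4 * \<gamma>))"
  proof (rule mult_right_mono)
    have "neg_gen (bonds l) u = neg_gen UNIV u"
    proof (rule neg_gen_bonds[symmetric])
      show "supported (nat (int (s + n) + L')) u"
        unfolding u_def by (rule supported_box_sum[OF g'(3)]) simp
      show "nat (int (s + n) + L') < l" using l by (simp add: L'_def)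
    qed
    then have "neg_gen (bonds l) u i j = box_sum L' \<alpha>off m i j - box_sum L' (residual n) m i j" for i j
      unfolding u_def neg_gen_box_sum by (simp add: neg_gen_box_sum box_sum_def tau_def neg_gen_corrector sum_subtractf)
    moreover have "\<Phi> i j = (\<Sum>x\<in>{- L..L} - {- L'..L'}. tau x \<alpha>off m i j) + box_sum L' \<alpha>off m i j" for i j
      unfolding \<Phi>_def box_sum_def by (rule sum.subset_diff) (use L' in auto)
    ultimately have res: "res i j = (\<Sum>x\<in>{- L..L} - {- L'..L'}. tau x \<alpha>off m i j) + (\<Sum>x\<in>{- L'..L'}. tau x (residual n) m i j)" for i j
      by (simp add: res_def box_sum_def)
    have "(\<Sum>i\<in>box l. \<Sum>j\<in>box l. \<bar>res i j\<bar>) \<le> (\<Sum>i\<in>box l. \<Sum>j\<in>box l.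
        \<bar>\<Sum>x\<in>{- L..L} - {- L'..L'}. tau x \<alpha>off m i j\<bar> + \<bar>\<Sum>x\<in>{- L'..L'}. tau x (residual n) m i j\<bar>)"
      unfolding res by (intro sum_mono abs_triangle_ineq)
    also have "\<dots> = (\<Sum>i\<in>box l. \<Sum>j\<in>box l. \<bar>\<Sum>x\<in>{- L..L} - {- L'..L'}. tau x \<alpha>off m i j\<bar>)
        + (\<Sum>i\<in>box l. \<Sum>j\<in>box l. \<bar>\<Sum>x\<in>{- L'..L'}. tau x (residual n) m i j\<bar>)"
      by (simp only: sum.distrib)
    also have "\<dots> \<le> real (card ({- L..L} - {- L'..L'})) * ((2 * real s + 1)\<^sup>2 * K0)
        + real (card {- L'..L'}) * ((2 * real (s + n) + 1)\<^sup>2 * (r ^ n * K0))"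
      by (intro add_mono l1_sum_le l1_tau_le \<alpha>off_props local_fieldD(3)[OF residual_local] \<alpha>off_bound residual_bound shift_disorder m)
    finally show "(\<Sum>i\<in>box l. \<Sum>j\<in>box l. \<bar>res i j\<bar>) \<le> real (card ({- L..L} - {- L'..L'})) * ((2 * real s + 1)\<^sup>2 * K0)
        + real (card {- L'..L'}) * ((2 * real (s + n) + 1)\<^sup>2 * (r ^ n * K0))" .
    show "0 \<le> Kb / (4 * \<gamma>)" using Kb_nonneg \<gamma>_pos by simp
  qed
  also have "card ({- L..L} - {- L'..L'}) = 4 * s + 2 * n"
  proof -
    have "card ({- L..L} - {- L'..L'}) = card {- L..L} - card {- L'..L'}"
      by (rule card_Diff_subset) (use L' in auto)
    also have "\<dots> = 4 * s + 2 * n" using l by (simp add: L_def L'_def nat_diff_distrib)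
    finally show ?thesis .
  qed
  also have "(real (4 * s + 2 * n) * ((2 * real s + 1)\<^sup>2 * K0)
      + real (card {- L'..L'}) * ((2 * real (s + n) + 1)\<^sup>2 * (r ^ n * K0))) * (Kb / (4 * \<gamma>))
     = real (card {- L'..L'}) * \<epsilon> n + (4 * real s + 2 * real n) * ((2 * real s + 1)\<^sup>2 * K0 * (Kb / (4 * \<gamma>)))"
  proof -
    have "(real (4 * s + 2 * n) * a + N * b) * q = N * (b * q) + (4 * real s + 2 * real n) * (a * q)" for a b q N :: real
      by (simp add: algebra_simps)
    then show ?thesis by (simp only: \<epsilon>_def)
  qed
  also have "\<dots> \<le> 2 * real l * \<epsilon> n + (4 * real s + 2 * real n) * ((2 * real s + 1)\<^sup>2 * K0 * (Kb / (4 * \<gamma>)))"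
  proof (intro add_right_mono mult_right_mono)
    have "real (card {- L'..L'}) = 2 * real_of_int L' + 1" using L' by simp
    then show "real (card {- L'..L'}) \<le> 2 * real l" by (simp add: L'_def)
    show "0 \<le> \<epsilon> n" using K0_nonneg Kb_nonneg \<gamma>_pos r_bounds by (simp add: \<epsilon>_def)
  qed
  finally show ?thesis by (simp add: k_def u_def \<Phi>_def)
qed

theorem resolvent_upper_bound:
  assumes \<phi>: "\<And>m \<omega>. m \<in> D \<Longrightarrow> \<phi> m \<omega> = quad s (\<alpha> m) \<omega>"
  shows "\<exists>K. \<forall>l\<ge>3 * s + n + 1.
    E_star \<nu> (\<lambda>m \<omega>. neg_generator_inv \<nu> \<gamma> lam l (translate_sum (int l - int s - 1) \<phi>) m \<omega>
        * translate_sum (int l - int s - 1) \<phi> m \<omega>)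
    \<le> 2 * real l * (2 / lam * mean (\<lambda>m. (B m)\<^sup>2) + 2 * (\<theta> n + \<epsilon> n)) + K"
proof -
  define c where "c = (4 * real s + 2 * real n) * ((2 * real s + 1)\<^sup>2 * K0 * (Kb / (4 * \<gamma>)))"
  \<comment> \<open>the contributions that do not grow with \<open>l\<close>: the sites near the boundary\<close>
  define K where "K = 2 / lam * (mean (\<lambda>m. (B m)\<^sup>2) + (4 * real s + 2) * KB\<^sup>2) + 2 * (c - (6 * real s + 2 * real n + 1) * \<theta> n)"
  interpret prob_space P by (rule prob_disorder)
  have "E_star \<nu> (\<lambda>m \<omega>. neg_generator_inv \<nu> \<gamma> lam l (translate_sum (int l - int s - 1) \<phi>) m \<omega>
        * translate_sum (int l - int s - 1) \<phi> m \<omega>)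
    \<le> 2 * real l * (2 / lam * mean (\<lambda>m. (B m)\<^sup>2) + 2 * (\<theta> n + \<epsilon> n)) + K" if l: "3 * s + n + 1 \<le> l" for l
  proof -
    define L where "L = int l - int s - 1"
    define L' where "L' = int l - 3 * int s - int n - 1"
    have c1: "continuous_on D (\<lambda>m. dot l (off_solution l L m) (box_sum L \<alpha>off m))"
      by (intro continuous_dot cont_off_solution cont_box_sum \<alpha>off_props)
    have c2: "continuous_on D (\<lambda>m. dot l (box_sum L' (corrector n) m) (box_sum L \<alpha>off m))"
      by (intro continuous_dot cont_box_sum \<alpha>off_props local_fieldD(1)[OF corrector_local])
    have "mean (\<lambda>m. dot l (off_solution l L m) (box_sum L \<alpha>off m)) - mean (\<lambda>m. dot l (box_sum L' (corrector n) m) (box_sum L \<alpha>off m))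
       = mean (\<lambda>m. dot l (off_solution l L m) (box_sum L \<alpha>off m) - dot l (box_sum L' (corrector n) m) (box_sum L \<alpha>off m))"
      by (rule Bochner_Integration.integral_diff[symmetric]) (intro integrable_continuous_disorder c1 c2)+
    also have "\<dots> \<le> mean (\<lambda>m. 2 * real l * \<epsilon> n + c)"
    proof (rule integral_mono)
      show "dot l (off_solution l L m) (box_sum L \<alpha>off m) - dot l (box_sum L' (corrector n) m) (box_sum L \<alpha>off m) \<le> 2 * real l * \<epsilon> n + c" if "m \<in> space P" for m
        using corrector_error[OF l, of m] that by (simp add: space_disorder L_def L'_def c_def)
    qed (intro integrable_continuous_disorder continuous_intros c1 c2)+
    finally have "mean (\<lambda>m. dot l (off_solution l L m) (box_sum L \<alpha>off m)) \<le> (2 * real_of_int L' + 1) * \<theta> n + (2 * real l * \<epsilon> n + c)"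
      using Gam_dot_box_sum[OF l] by (simp add: prob_space L_def L'_def)
    also have "2 * real_of_int L' + 1 = 2 * real l - (6 * real s + 2 * real n + 1)" by (simp add: L'_def)
    finally have o: "mean (\<lambda>m. dot l (off_solution l L m) (box_sum L \<alpha>off m))
      \<le> (2 * real l - (6 * real s + 2 * real n + 1)) * \<theta> n + (2 * real l * \<epsilon> n + c)" .
    have "2 * s + 1 \<le> l" using l by simp
    from diagonal_bound[OF this] have d: "2 / lam * mean (\<lambda>m. \<Sum>y\<in>box l. (box_current L m y)\<^sup>2)
        \<le> 2 / lam * ((2 * real l + 1) * mean (\<lambda>m. (B m)\<^sup>2) + (4 * real s + 2) * KB\<^sup>2)"
      using lam_pos by (intro mult_left_mono) (simp_all add: L_def)
    have "L + int s < int l" by (simp add: L_def)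
    from resolvent_pairing[OF this \<phi>]
    have "E_star \<nu> (\<lambda>m \<omega>. neg_generator_inv \<nu> \<gamma> lam l (translate_sum L \<phi>) m \<omega> * translate_sum L \<phi> m \<omega>)
       = 2 / lam * mean (\<lambda>m. \<Sum>y\<in>box l. (box_current L m y)\<^sup>2) + 2 * mean (\<lambda>m. dot l (off_solution l L m) (box_sum L \<alpha>off m))" by simp
    also have "\<dots> \<le> 2 / lam * ((2 * real l + 1) * mean (\<lambda>m. (B m)\<^sup>2) + (4 * real s + 2) * KB\<^sup>2)
       + 2 * ((2 * real l - (6 * real s + 2 * real n + 1)) * \<theta> n + (2 * real l * \<epsilon> n + c))"
      by (rule add_mono[OF d mult_left_mono[OF o]]) simp
    also have "\<dots> = 2 * real l * (2 / lam * mean (\<lambda>m. (B m)\<^sup>2) + 2 * (\<theta> n + \<epsilon> n)) + K"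
    proof -
      have "w * ((2 * real l + 1) * b + e) + 2 * ((2 * real l - k) * t + (2 * real l * p + c))
          = 2 * real l * (w * b + 2 * (t + p)) + (w * (b + e) + 2 * (c - k * t))" for w b e k t p :: real
        by (simp add: algebra_simps)
      then show ?thesis by (simp only: K_def)
    qed
    finally show ?thesis by (simp add: L_def)
  qed
  then show ?thesis by blast
qed

end

section \<open>The test function\<close>

lemma dot_split: "dot N c d = (\<Sum>i\<in>box N. c i i * d i i) + dot N (off c) d"
proof -
  have "(\<Sum>j\<in>box N. c i j * d i j) = c i i * d i i + (\<Sum>j\<in>box N. off c i j * d i j)" if i: "i \<in> box N" for i
  proof -
    have "(\<Sum>j\<in>box N. c i j * d i j) = c i i * d i i + (\<Sum>j\<in>box N - {i}. c i j * d i j)"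
      by (rule sum.remove) (use i in simp_all)
    also have "(\<Sum>j\<in>box N - {i}. c i j * d i j) = (\<Sum>j\<in>box N. off c i j * d i j)"
      by (rule sum.mono_neutral_cong_left) (auto simp: off_def)
    finally show ?thesis .
  qed
  then show ?thesis by (simp add: dot_def sum.distrib)
qed

text \<open>
  The Green function of the discrete Laplacian for the charge \<open>\<delta>\<^sub>0\<close> minus the uniform distribution on
  \<open>{- N..N}\<close>.  This charge has neither mass nor first moment, so the solution has finite support.
\<close>

definition green :: "nat \<Rightarrow> int \<Rightarrow> real" where
  "green N k = (if \<bar>k\<bar> \<le> int N
     then (real N - of_int \<bar>k\<bar>) * (real N + 1 - of_int \<bar>k\<bar>) / (2 * (2 * real N + 1)) else 0)"

lemma green_laplacian:
  "2 * green N k - green N (k - 1) - green N (k + 1) = of_bool (k = 0) - (if \<bar>k\<bar> \<le> int N then 1 / (2 * real N + 1) else 0)"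
proof -
  \<comment> \<open>the parabola also gives the right value zero at the site N + 1\<close>
  define q where "q x = (real N - x) * (real N + 1 - x) / (2 * (2 * real N + 1))" for x
  have pos: "2 * real N + 1 > 0" by simp
  have q: "green N k = q (of_int \<bar>k\<bar>)" if "\<bar>k\<bar> \<le> int N + 1" for k
  proof (cases "\<bar>k\<bar> \<le> int N")
    case False
    then have "\<bar>k\<bar> = int N + 1" using that by simp
    then show ?thesis using False by (simp add: green_def q_def)
  qed (simp add: green_def q_def)
  have z: "green N k = 0" if "\<bar>k\<bar> \<ge> int N" for k
  proof (cases "\<bar>k\<bar> = int N")
    case False
    then show ?thesis using that by (simp add: green_def)
  qed (simp add: green_def)
  have lap: "2 * q x - q (x - 1) - q (x + 1) = - 1 / (2 * real N + 1)" for x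
  proof -
    have "2 * q x - q (x - 1) - q (x + 1) = (2 * ((real N - x) * (real N + 1 - x))
        - (real N - (x - 1)) * (real N + 1 - (x - 1)) - (real N - (x + 1)) * (real N + 1 - (x + 1))) / (2 * (2 * real N + 1))"
      by (simp only: q_def times_divide_eq_right diff_divide_distrib)
    also have "2 * ((real N - x) * (real N + 1 - x)) - (real N - (x - 1)) * (real N + 1 - (x - 1))
        - (real N - (x + 1)) * (real N + 1 - (x + 1)) = - 2"
      by (simp add: algebra_simps)
    also have "- 2 / (2 * d) = - 1 / d" for d :: real by simp
    finally show ?thesis .
  qed
  have q1: "2 * q 0 - 2 * q 1 = 1 - 1 / (2 * real N + 1)"
  proof -
    have "2 * q 0 - 2 * q 1 = (2 * ((real N - 0) * (real N + 1 - 0)) - 2 * ((real N - 1) * (real N + 1 - 1))) / (2 * (2 * real N + 1))"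
      by (simp only: q_def times_divide_eq_right diff_divide_distrib)
    also have "2 * ((real N - 0) * (real N + 1 - 0)) - 2 * ((real N - 1) * (real N + 1 - 1)) = 2 * (2 * real N + 1) - 2"
      by (simp add: algebra_simps)
    also have "(2 * (2 * real N + 1) - 2) / (2 * (2 * real N + 1)) = 1 - 1 / (2 * real N + 1)"
    proof -
      have "(2 * d - 2) / (2 * d) = 1 - 1 / d" if "d > 0" for d :: real
        using that by (simp add: field_simps)
      then show ?thesis using pos by blast
    qed
    finally show ?thesis .
  qed
  consider "\<bar>k\<bar> > int N" | "k = 0" | "0 < k" "k \<le> int N" | "k < 0" "- int N \<le> k" by linarith
  then show ?thesis
  proof cases
    case 1
    then show ?thesis by (simp add: z)
  next
    case 2
    then show ?thesis using q1 by (simp add: q)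
  next
    case 3
    then show ?thesis using lap[of "of_int k"] by (simp add: q)
  next
    case 4
    then show ?thesis using lap[of "of_int (- k)"] by (simp add: q)
  qed
qed

context disorder begin

lemma depends_on_box_shift:
  assumes "depends_on_box R f" "R + nat \<bar>x\<bar> \<le> R'"
  shows "depends_on_box R' (\<lambda>m. f (shift x m))"
  unfolding depends_on_box_def
proof (intro ballI impI)
  fix m m' assume m: "m \<in> D" "m' \<in> D" and eq: "\<forall>y\<in>box R'. m y = m' y"
  have "\<forall>y\<in>box R. shift x m y = shift x m' y"
    using eq assms(2) by (auto simp: shift_def)
  then show "f (shift x m) = f (shift x m')"
    using assms(1) m unfolding depends_on_box_def by simp
qed

lemma depends_on_box_mono: "depends_on_box R f \<Longrightarrow> R \<le> R' \<Longrightarrow> depends_on_box R' f"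
  using depends_on_box_shift[of R f 0 R'] by simp

lemma depends_on_box_compose:
  assumes "depends_on_box R f"
  shows "depends_on_box R (\<lambda>m. h (f m))"
  unfolding depends_on_box_def
proof (intro ballI impI)
  fix m m' assume "m \<in> D" "m' \<in> D" "\<forall>x\<in>box R. m x = m' x"
  then have "f m = f m'" using assms unfolding depends_on_box_def by blast
  then show "h (f m) = h (f m')" by simp
qed

lemma depends_on_box_cylinder: "depends_on_box R f \<Longrightarrow> cylinder C (\<lambda>m _. f m)"
  unfolding cylinder_def depends_only_on_def depends_on_box_def
  by (intro exI[of _ "box R"] conjI finite_box ballI allI impI) blast

lemma local_field_bounded:
  assumes "local_field R c"
  obtains K where "\<And>m i j. m \<in> D \<Longrightarrow> \<bar>c m i j\<bar> \<le> K"
proof -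
  note c = local_fieldD[OF assms]
  have "\<exists>K. 0 \<le> K \<and> (\<forall>m\<in>D. \<bar>c m i j\<bar> \<le> K)" for i j
    using bounded_continuous_disorder[OF contD[OF c(1)]] by metis
  then obtain k where k: "\<And>i j. 0 \<le> k i j" "\<And>m i j. m \<in> D \<Longrightarrow> \<bar>c m i j\<bar> \<le> k i j" by metis
  define K where "K = (\<Sum>p\<in>box R \<times> box R. k (fst p) (snd p))"
  have K: "0 \<le> K" unfolding K_def by (intro sum_nonneg k)
  have "\<bar>c m i j\<bar> \<le> K" if m: "m \<in> D" for m i j
  proof (cases "c m i j = 0")
    case False
    then have "(i, j) \<in> box R \<times> box R" using c(3)[of m] unfolding supported_def by simp
    then have "k i j \<le> K"
      unfolding K_def using member_le_sum[of "(i, j)" "box R \<times> box R" "\<lambda>p. k (fst p) (snd p)"] k(1) by simp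
    then show ?thesis using k(2)[OF m, of i j] by linarith
  qed (simp add: K)
  then show thesis by (rule that)
qed

end

context coefficients begin

definition current_avg :: "nat \<Rightarrow> config \<Rightarrow> real" where
  "current_avg N m = (\<Sum>k\<in>box N. B (shift k m)) / (2 * real N + 1)"

lemma cont_current_avg: "continuous_on D (current_avg N)"
  unfolding current_avg_def[abs_def] by (intro continuous_intros continuous_shift cont_B) simp

lemma B_depends_on_box: "depends_on_box (2 * s) B"
  unfolding depends_on_box_def
proof (intro ballI impI)
  fix m m' assume m: "m \<in> D" "m' \<in> D" and eq: "\<forall>y\<in>box (2 * s). m y = m' y"
  have "\<alpha> (shift (- i) m) = \<alpha> (shift (- i) m')" if "i \<in> box s" for i
  proof -
    have "depends_on_box (2 * s) (\<lambda>m. \<alpha> (shift (- i) m))"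
      by (rule depends_on_box_shift[OF dep]) (use that in simp)
    then show ?thesis using m eq unfolding depends_on_box_def by blast
  qed
  then show "B m = B m'" unfolding B_def primitive_def by (intro sum.cong) simp_all
qed

lemma mean_B_shift:
  assumes "\<bar>z\<bar> > 4 * int s"
  shows "mean (\<lambda>m. B m * B (shift z m)) = (mean B)\<^sup>2"
proof -
  have "mean (\<lambda>m. B m * B (shift z m)) = mean B * mean (\<lambda>m. B (shift z m))"
  proof (rule mean_mult_independent[where A = "box (2 * s)" and B = "{z - 2 * int s..z + 2 * int s}"])
    show "box (2 * s) \<inter> {z - 2 * int s..z + 2 * int s} = {}" using assms by auto
    show "B m = B m'" if "m \<in> D" "m' \<in> D" "\<forall>x\<in>box (2 * s). m x = m' x" for m m'
      using B_depends_on_box that unfolding depends_on_box_def by blast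
    show "B (shift z m) = B (shift z m')"
      if "m \<in> D" "m' \<in> D" "\<forall>x\<in>{z - 2 * int s..z + 2 * int s}. m x = m' x" for m m'
    proof -
      have "\<forall>x\<in>box (2 * s). shift z m x = shift z m' x"
      proof
        fix x assume "x \<in> box (2 * s)"
        then have "z + x \<in> {z - 2 * int s..z + 2 * int s}" by auto
        then show "shift z m x = shift z m' x" using that(3) unfolding shift_def by blast
      qed
      then show ?thesis using B_depends_on_box that(1,2) unfolding depends_on_box_def by simp
    qed
  qed (intro cont_B continuous_shift)+
  then show ?thesis by (simp add: mean_shift[OF cont_B] power2_eq_square)
qed

text \<open>
  Mean ergodic theorem with a rate: translates of \<open>B\<close> by more than \<open>4 * s\<close> from each other are
  uncorrelated, and each site has at most \<open>8 * s + 1\<close> neighbours for which this fails.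
\<close>

lemma mean_current_avg_sq: "mean (\<lambda>m. (current_avg N m)\<^sup>2) \<le> (mean B)\<^sup>2 + (8 * real s + 1) * KB\<^sup>2 / (2 * real N + 1)"
proof -
  interpret prob_space P by (rule prob_disorder)
  let ?n = "2 * real N + 1"
  have pair: "mean (\<lambda>m. B (shift k m) * B (shift l m)) \<le> (mean B)\<^sup>2 + (if \<bar>l - k\<bar> \<le> 4 * int s then KB\<^sup>2 else 0)" for k l
  proof -
    have "mean (\<lambda>m. B (shift k m) * B (shift l m)) = mean (\<lambda>m. B m * B (shift (l - k) m))"
      using mean_shift[of "\<lambda>m. B m * B (shift (l - k) m)" k]
      by (simp add: shift_shift continuous_intros cont_B continuous_shift)
    also have "\<dots> \<le> (mean B)\<^sup>2 + (if \<bar>l - k\<bar> \<le> 4 * int s then KB\<^sup>2 else 0)"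
    proof (cases "\<bar>l - k\<bar> \<le> 4 * int s")
      case True
      have "mean (\<lambda>m. B m * B (shift (l - k) m)) \<le> mean (\<lambda>m. KB\<^sup>2)"
      proof (rule integral_mono)
        show "B m * B (shift (l - k) m) \<le> KB\<^sup>2" if "m \<in> space P" for m
        proof -
          have "\<bar>B m\<bar> \<le> KB" "\<bar>B (shift (l - k) m)\<bar> \<le> KB"
            using that by (auto intro!: B_bound simp: space_disorder)
          then have "\<bar>B m\<bar> * \<bar>B (shift (l - k) m)\<bar> \<le> KB * KB" by (intro mult_mono KB_nonneg) auto
          then have "\<bar>B m * B (shift (l - k) m)\<bar> \<le> KB\<^sup>2" by (simp add: abs_mult power2_eq_square)
          then show ?thesis by linarith
        qed
      qed (intro integrable_continuous_disorder continuous_intros continuous_shift cont_B)+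
      then show ?thesis using True by (simp add: prob_space add_increasing)
    next
      case False
      then show ?thesis by (simp add: mean_B_shift)
    qed
    finally show ?thesis .
  qed
  have "(current_avg N m)\<^sup>2 = (\<Sum>k\<in>box N. \<Sum>l\<in>box N. B (shift k m) * B (shift l m)) / ?n\<^sup>2" for m
    unfolding current_avg_def power_divide by (simp add: power2_eq_square sum_product)
  then have "mean (\<lambda>m. (current_avg N m)\<^sup>2) = (\<Sum>k\<in>box N. \<Sum>l\<in>box N. mean (\<lambda>m. B (shift k m) * B (shift l m))) / ?n\<^sup>2"
    by (simp, subst mean_sum, intro continuous_on_sum continuous_on_mult continuous_shift cont_B,
        subst mean_sum, intro continuous_on_mult continuous_shift cont_B, simp)
  also have "\<dots> \<le> (\<Sum>k\<in>box N. ?n * (mean B)\<^sup>2 + (2 * real (4 * s) + 1) * KB\<^sup>2) / ?n\<^sup>2"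
  proof (intro divide_right_mono sum_mono)
    fix k
    have "(\<Sum>l\<in>box N. mean (\<lambda>m. B (shift k m) * B (shift l m)))
       \<le> (\<Sum>l\<in>box N. (mean B)\<^sup>2 + (if \<bar>l - k\<bar> \<le> 4 * int s then KB\<^sup>2 else 0))"
      by (intro sum_mono pair)
    also have "\<dots> = ?n * (mean B)\<^sup>2 + (\<Sum>l\<in>box N. if \<bar>l - k\<bar> \<le> 4 * int s then KB\<^sup>2 else 0)"
      by (simp add: sum.distrib)
    also have "\<dots> \<le> ?n * (mean B)\<^sup>2 + (2 * real (4 * s) + 1) * KB\<^sup>2"
      by (intro add_left_mono sum_window_le[where y = k]) auto
    finally show "(\<Sum>l\<in>box N. mean (\<lambda>m. B (shift k m) * B (shift l m))) \<le> ?n * (mean B)\<^sup>2 + (2 * real (4 * s) + 1) * KB\<^sup>2" .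
  qed simp
  also have "\<dots> = (mean B)\<^sup>2 + (8 * real s + 1) * KB\<^sup>2 / ?n"
  proof -
    have "(\<Sum>k\<in>box N. ?n * (mean B)\<^sup>2 + (2 * real (4 * s) + 1) * KB\<^sup>2) = ?n * (?n * (mean B)\<^sup>2 + (8 * real s + 1) * KB\<^sup>2)"
      by simp
    moreover have "?n > 0" by simp
    moreover have "d * (d * a + b) / d\<^sup>2 = a + b / d" if "d > 0" for a b d :: real
      using that by (simp add: power2_eq_square field_simps)
    ultimately show ?thesis by presburger
  qed
  finally show ?thesis .
qed

definition \<Psi> :: "nat \<Rightarrow> config \<Rightarrow> real" where
  "\<Psi> N m = (\<Sum>k\<in>box N. green N k * B (shift k m)) / lam"

lemma cont_\<Psi>: "continuous_on D (\<Psi> N)"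
  unfolding \<Psi>_def[abs_def] using lam_pos by (intro continuous_intros continuous_shift cont_B) simp

lemma \<Psi>_laplacian: "2 * \<Psi> N m - \<Psi> N (shift 1 m) - \<Psi> N (shift (- 1) m) = (B m - current_avg N m) / lam"
proof -
  let ?S = "box (N + 1)"
  have z: "green N k = 0" if "\<bar>k\<bar> > int N" for k using that by (simp add: green_def)
  have s: "lam * \<Psi> N (shift a m) = (\<Sum>k\<in>?S. green N (k - a) * B (shift k m))" if "\<bar>a\<bar> \<le> 1" for a
  proof -
    have "lam * \<Psi> N (shift a m) = (\<Sum>k\<in>box N. green N k * B (shift (k + a) m))"
      using lam_pos by (simp add: \<Psi>_def shift_shift)
    also have "\<dots> = (\<Sum>k\<in>{a - int N..a + int N}. green N (k - a) * B (shift k m))"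
      by (rule sum.reindex_bij_witness[where i = "\<lambda>k. k - a" and j = "\<lambda>k. k + a"]) auto
    also have "\<dots> = (\<Sum>k\<in>?S. green N (k - a) * B (shift k m))"
      by (rule sum.mono_neutral_left) (use that in \<open>auto intro!: z\<close>)
    finally show ?thesis .
  qed
  have "lam * (2 * \<Psi> N m - \<Psi> N (shift 1 m) - \<Psi> N (shift (- 1) m))
      = 2 * (lam * \<Psi> N (shift 0 m)) - lam * \<Psi> N (shift 1 m) - lam * \<Psi> N (shift (- 1) m)"
    by (simp add: algebra_simps)
  also have "\<dots> = (\<Sum>k\<in>?S. (2 * green N k - green N (k - 1) - green N (k + 1)) * B (shift k m))"
    using s[of 0] s[of 1] s[of "- 1"] by (simp add: left_diff_distrib sum_subtractf sum_distrib_left mult.assoc)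
  also have "\<dots> = (\<Sum>k\<in>?S. (if k = 0 then B (shift k m) else 0) - (if \<bar>k\<bar> \<le> int N then B (shift k m) / (2 * real N + 1) else 0))"
    unfolding green_laplacian by (intro sum.cong refl) (simp add: left_diff_distrib)
  also have "\<dots> = B m - current_avg N m"
  proof -
    have "(\<Sum>k\<in>?S. if \<bar>k\<bar> \<le> int N then B (shift k m) / (2 * real N + 1) else 0) = (\<Sum>k\<in>box N. B (shift k m) / (2 * real N + 1))"
      by (rule sum.mono_neutral_cong_right) auto
    then show ?thesis by (simp add: sum_subtractf current_avg_def sum_divide_distrib)
  qed
  finally show ?thesis using lam_pos by (simp add: field_simps)
qed

definition current_fluct :: "nat \<Rightarrow> config \<Rightarrow> real" where
  "current_fluct N m = (B m - current_avg N m) / lam"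

lemma cont_current_fluct: "continuous_on D (current_fluct N)"
  unfolding current_fluct_def[abs_def] using lam_pos by (intro continuous_intros cont_B cont_current_avg) simp

text \<open>
  The matrix of \<open>\<Psi> N m * (\<omega> 1\<^sup>2 - \<omega> 0\<^sup>2)\<close> plus the corrector.
\<close>

definition test_field :: "nat \<Rightarrow> nat \<Rightarrow> mfield" where
  "test_field N n m i j = (if i = j then (if i = 1 then \<Psi> N m else if i = 0 then - \<Psi> N m else 0) else corrector n m i j)"

lemma test_field_local:
  assumes "0 < s"
  shows "local_field (s + n) (test_field N n)"
  unfolding local_field_def
proof (intro conjI allI)
  note g' = local_fieldD[OF corrector_local[of n]]
  show "cont (test_field N n)"
    unfolding cont_def
  proof (intro allI)
    fix i j
    show "continuous_on D (\<lambda>m. test_field N n m i j)"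
      using contD[OF g'(1)] cont_\<Psi>
      by (cases "i = j"; cases "i = 0"; cases "i = 1") (auto simp: test_field_def intro!: continuous_intros)
  qed
  show "symm (test_field N n m)" for m using g'(2)[of m] by (auto simp: symm_def test_field_def)
  show "supported (s + n) (test_field N n m)" for m using g'(3)[of m] assms by (auto simp: supported_def test_field_def split: if_splits)
qed

lemma Gam_test_field_off: "i \<noteq> j \<Longrightarrow> Gam (test_field N n) m i j = Gam (corrector n) m i j"
  by (simp add: Gam_def tau_def test_field_def)

lemma Gam_test_field_diag: "Gam (test_field N n) m i i = \<Psi> N (shift (i - 1) m) - \<Psi> N (shift i m)"
proof -
  have "Gam (test_field N n) m i i = (\<Sum>x\<in>{i - 1, i}. tau x (test_field N n) m i i)"
    unfolding Gam_def by (rule infsum_finite_support) (auto simp: tau_def test_field_def)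
  then show ?thesis by (simp add: tau_def test_field_def)
qed

lemma Gam_corrector_diag: "Gam (corrector n) m i i = 0"
  using corrector_hollow by (simp add: Gam_def tau_def hollow_def)

lemma Gam_test_field_step: "Gam (test_field N n) m (i + 1) (i + 1) - Gam (test_field N n) m i i = current_fluct N (shift i m)"
  unfolding Gam_test_field_diag current_fluct_def \<Psi>_laplacian[symmetric] by (simp add: shift_shift add.commute)

text \<open>
  After summation by parts the diagonal part of \<open>Gam\<close> enters only through its increments, which
  are the translates of \<open>current_fluct\<close>; stationarity collects them in \<open>B\<close>.
\<close>

lemma pairing_test_field:
  "mean (\<lambda>m. dot s (\<alpha> m) (Gam (test_field N n) m)) = mean (\<lambda>m. B m * current_fluct N m) + \<theta> n"
  if "0 < s"
proof -
  have cG: "cont (Gam (corrector n))" by (rule cont_Gam[OF corrector_local])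
  have "dot s (\<alpha> m) (Gam (test_field N n) m) = (\<Sum>i\<in>box s. primitive m i * current_fluct N (shift i m)) + dot s (\<alpha>off m) (Gam (corrector n) m)" for m
  proof -
    have "(\<Sum>i\<in>box s. \<alpha> m i i * Gam (test_field N n) m i i) = (\<Sum>i\<in>box s. Gam (test_field N n) m i i * (primitive m (i - 1) - primitive m i))"
      by (simp add: \<alpha>_diag mult.commute)
    also have "\<dots> = (\<Sum>i\<in>box s. (Gam (test_field N n) m (i + 1) (i + 1) - Gam (test_field N n) m i i) * primitive m i)"
      by (rule sum_by_parts) (simp_all add: primitive_zero)
    also have "\<dots> = (\<Sum>i\<in>box s. primitive m i * current_fluct N (shift i m))"
      unfolding Gam_test_field_step by (simp add: mult.commute)
    finally have "(\<Sum>i\<in>box s. \<alpha> m i i * Gam (test_field N n) m i i) = (\<Sum>i\<in>box s. primitive m i * current_fluct N (shift i m))" .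
    moreover have "dot s (off (\<alpha> m)) (Gam (test_field N n) m) = dot s (\<alpha>off m) (Gam (corrector n) m)"
      by (rule dot_cong) (simp add: \<alpha>off_def off_def Gam_test_field_off)
    ultimately show ?thesis by (simp add: dot_split[of s "\<alpha> m"])
  qed
  then have "mean (\<lambda>m. dot s (\<alpha> m) (Gam (test_field N n) m))
      = mean (\<lambda>m. \<Sum>i\<in>box s. primitive m i * current_fluct N (shift i m)) + mean (\<lambda>m. dot s (\<alpha>off m) (Gam (corrector n) m))"
    by (simp only:) (rule Bochner_Integration.integral_add;
        intro integrable_continuous_disorder continuous_on_sum continuous_on_mult continuous_shift continuous_dot cont_primitive cont_current_fluct \<alpha>off_props cG)
  also have "mean (\<lambda>m. \<Sum>i\<in>box s. primitive m i * current_fluct N (shift i m)) = (\<Sum>i\<in>box s. mean (\<lambda>m. primitive m i * current_fluct N (shift i m)))"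
    by (intro mean_sum continuous_on_mult continuous_shift cont_primitive cont_current_fluct)
  also have "\<dots> = (\<Sum>i\<in>box s. mean (\<lambda>m. primitive (shift (- i) m) i * current_fluct N m))"
  proof (intro sum.cong refl)
    fix i
    have "mean (\<lambda>m. primitive (shift (- i) m) i * current_fluct N (shift i (shift (- i) m))) = mean (\<lambda>m. primitive m i * current_fluct N (shift i m))"
      by (rule mean_shift) (intro continuous_on_mult continuous_shift cont_primitive cont_current_fluct)
    then show "mean (\<lambda>m. primitive m i * current_fluct N (shift i m)) = mean (\<lambda>m. primitive (shift (- i) m) i * current_fluct N m)"
      by (simp add: shift_shift)
  qed
  also have "\<dots> = mean (\<lambda>m. \<Sum>i\<in>box s. primitive (shift (- i) m) i * current_fluct N m)"
    by (intro mean_sum[symmetric] continuous_on_mult continuous_shift[of "\<lambda>m. primitive m _"] cont_primitive cont_current_fluct)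
  also have "\<dots> = mean (\<lambda>m. B m * current_fluct N m)" by (simp add: B_def sum_distrib_right)
  also have "mean (\<lambda>m. dot s (\<alpha>off m) (Gam (corrector n) m)) = \<theta> n"
    unfolding \<theta>_def by (rule Gam_symmetric[OF \<alpha>off_local corrector_local])
  finally show ?thesis .
qed

lemma defect_flip_test_field:
  "dot M (flip_defect 0 (Gam (test_field N n) m)) (flip_defect 0 (Gam (test_field N n) m))
   = dot M (flip_defect 0 (Gam (corrector n) m)) (flip_defect 0 (Gam (corrector n) m))"
proof (rule dot_cong)
  fix i j
  have "flip_defect 0 (Gam (test_field N n) m) i j = flip_defect 0 (Gam (corrector n) m) i j"
    by (cases "i = j") (simp_all add: defect_flip Gam_test_field_off flip_sign_def)
  then show "flip_defect 0 (Gam (test_field N n) m) i j * flip_defect 0 (Gam (test_field N n) m) i j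
     = flip_defect 0 (Gam (corrector n) m) i j * flip_defect 0 (Gam (corrector n) m) i j" by simp
qed

lemma defect_exchange_test_field:
  assumes "0 < M"
  shows "dot M (exchange_defect 0 (Gam (test_field N n) m)) (exchange_defect 0 (Gam (test_field N n) m))
   = 2 * (current_fluct N m)\<^sup>2 + dot M (exchange_defect 0 (Gam (corrector n) m)) (exchange_defect 0 (Gam (corrector n) m))"
proof -
  define e where "e = exchange_defect 0 (Gam (test_field N n) m)"
  define e' where "e' = exchange_defect 0 (Gam (corrector n) m)"
  have eo: "e i j = e' i j" if "i \<noteq> j" for i j
    using that by (simp add: e_def e'_def defect_exchange Gam_test_field_off)
  have e'd: "e' i i = 0" for i by (simp add: e'_def defect_exchange Gam_corrector_diag)
  have step: "Gam (test_field N n) m 1 1 - Gam (test_field N n) m 0 0 = current_fluct N m"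
    using Gam_test_field_step[of N n m 0] by simp
  have e0: "e 0 0 = - current_fluct N m" and e1: "e 1 1 = current_fluct N m"
    using step by (simp_all add: e_def defect_exchange swap_site_def)
  have ed: "e i i = 0" if "i \<noteq> 0" "i \<noteq> 1" for i
    using that by (simp add: e_def defect_exchange swap_site_def)
  have "(\<Sum>i\<in>box M. e i i * e i i) = (\<Sum>i\<in>{0, 1}. e i i * e i i)"
    by (rule sum.mono_neutral_right) (use assms ed in auto)
  also have "\<dots> = 2 * (current_fluct N m)\<^sup>2" by (simp add: e0 e1 power2_eq_square)
  finally have "dot M e e = 2 * (current_fluct N m)\<^sup>2 + dot M (off e) e" by (simp add: dot_split[of M e e])
  also have "dot M (off e) e = dot M e' e'"
    by (rule dot_cong) (simp add: off_def eo e'd)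
  finally show ?thesis by (simp add: e_def e'_def)
qed

text \<open>
  The bound for the pairing of the residual with the lattice sum of the corrector: sum norm of the
  former times supremum norm of the latter.
\<close>

definition \<eta> :: "nat \<Rightarrow> real" where
  "\<eta> n = (2 * real (s + n) + 1)\<^sup>2 * (r ^ n * K0) * ((2 * real (s + n) + 1) * (K0 / (4 * \<gamma>)))"

lemma remainder_bound:
  "- \<eta> n \<le> mean (\<lambda>m. dot N (residual n m) (Gam (corrector n) m))"
proof -
  interpret prob_space P by (rule prob_disorder)
  note z' = local_fieldD[OF residual_local[of n]] and g' = local_fieldD[OF corrector_local[of n]]
  have "mean (\<lambda>m. - \<eta> n) \<le> mean (\<lambda>m. dot N (residual n m) (Gam (corrector n) m))"
  proof (rule integral_mono)
    fix m assume "m \<in> space P"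
    then have m: "m \<in> D" by (simp add: space_disorder)
    have "\<bar>dot N (residual n m) (Gam (corrector n) m)\<bar> \<le> (\<Sum>i\<in>box N. \<Sum>j\<in>box N. \<bar>residual n m i j\<bar>) * ((2 * real (s + n) + 1) * (K0 / (4 * \<gamma>)))"
      by (rule abs_dot_le, rule Gam_bound[OF g'(3)]) (simp add: tau_def corrector_bound m)
    also have "\<dots> \<le> \<eta> n"
      unfolding \<eta>_def
    proof (rule mult_right_mono)
      show "(\<Sum>i\<in>box N. \<Sum>j\<in>box N. \<bar>residual n m i j\<bar>) \<le> (2 * real (s + n) + 1)\<^sup>2 * (r ^ n * K0)"
        using l1_translate_le[OF z'(3) residual_bound[OF m], where l = N and x = 0] by simp
      show "0 \<le> (2 * real (s + n) + 1) * (K0 / (4 * \<gamma>))" using K0_nonneg \<gamma>_pos by simp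
    qed
    finally show "- \<eta> n \<le> dot N (residual n m) (Gam (corrector n) m)" by linarith
  qed (intro integrable_continuous_disorder continuous_on_const continuous_dot z' cont_Gam[OF corrector_local])+
  then show ?thesis by (simp add: prob_space)
qed

text \<open>
  Diagonal and off-diagonal parts decouple.  The diagonal one is
  \<open>4 * \<langle>B * d\<rangle> - 2 * lam * \<langle>d\<^sup>2\<rangle>\<close> with \<open>d = (B - avg) / lam\<close>; the off-diagonal one is
  \<open>4 * \<theta> n\<close> minus twice the scalar product of \<open>neg_gen UNIV\<close> of the corrector with the lattice sum of
  the corrector, and this scalar product equals \<open>\<theta> n\<close> up to the residual.
\<close>

lemma functional_test_field:
  fixes N n :: nat
  assumes s: "0 < s"
    and \<phi>: "\<And>m \<omega>. m \<in> D \<Longrightarrow> \<phi> m \<omega> = quad s (\<alpha> m) \<omega>"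
  defines "g \<equiv> \<lambda>m. quad (s + n) (test_field N n m)"
  shows "2 / lam * (mean (\<lambda>m. (B m)\<^sup>2) - mean (\<lambda>m. (current_avg N m)\<^sup>2)) + 2 * \<theta> n - 2 * \<eta> n
    \<le> 2 * pairing_star \<nu> \<phi> g - \<gamma> / 2 * E_star \<nu> (\<lambda>m \<omega>. (grad_flip_Gamma g m \<omega>)\<^sup>2)
         - lam / 2 * E_star \<nu> (\<lambda>m \<omega>. (grad_exch_Gamma g m \<omega>)\<^sup>2)"
proof -
  note g' = local_fieldD[OF corrector_local[of n]]
  have cG: "cont (Gam (corrector n))" by (rule cont_Gam[OF corrector_local])
  define M where "M = 2 * (s + n) + 2"
  define F where "F = mean (\<lambda>m. dot M (flip_defect 0 (Gam (corrector n) m)) (flip_defect 0 (Gam (corrector n) m)))"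
  define E where "E = mean (\<lambda>m. dot M (exchange_defect 0 (Gam (corrector n) m)) (exchange_defect 0 (Gam (corrector n) m)))"
  define d2 where "d2 = mean (\<lambda>m. (current_fluct N m)\<^sup>2)"
  define bd where "bd = mean (\<lambda>m. B m * current_fluct N m)"
  define ze where "ze = mean (\<lambda>m. dot (s + n + 2) (residual n m) (Gam (corrector n) m))"
  have gr: "g m \<omega> = quad (s + n) (test_field N n m) \<omega>" for m \<omega> by (simp add: g_def)
  have p: "pairing_star \<nu> \<phi> g = 2 * (bd + \<theta> n)"
    using pairing_star_quad[OF \<alpha>_local trace test_field_local[OF s] \<phi> gr] pairing_test_field[OF s] by (simp add: bd_def)
  have f: "E_star \<nu> (\<lambda>m \<omega>. (grad_flip_Gamma g m \<omega>)\<^sup>2) = 2 * F"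
    using E_star_grad_Gamma(1)[OF test_field_local[OF s] gr] by (simp add: defect_flip_test_field F_def M_def)
  have e: "E_star \<nu> (\<lambda>m \<omega>. (grad_exch_Gamma g m \<omega>)\<^sup>2) = 2 * (2 * d2 + E)"
  proof -
    have "E_star \<nu> (\<lambda>m \<omega>. (grad_exch_Gamma g m \<omega>)\<^sup>2) = 2 * mean (\<lambda>m. 2 * (current_fluct N m)\<^sup>2
        + dot M (exchange_defect 0 (Gam (corrector n) m)) (exchange_defect 0 (Gam (corrector n) m)))"
      using E_star_grad_Gamma(2)[OF test_field_local[OF s] gr] defect_exchange_test_field[of M N n] by (simp add: M_def)
    also have "\<dots> = 2 * (2 * d2 + E)"
      unfolding d2_def E_def
      by (subst Bochner_Integration.integral_add)
        (auto intro!: integrable_continuous_disorder continuous_intros cont_current_fluct continuous_dot cont_defect cG)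
    finally show ?thesis .
  qed
  have D: "\<gamma> / 2 * F + lam / 2 * E = \<theta> n - ze"
  proof -
    have "\<gamma> / 2 * F + lam / 2 * E = mean (\<lambda>m. dot (s + n + 2) (neg_gen UNIV (corrector n m)) (Gam (corrector n) m))"
      using Dirichlet_Gam[OF corrector_local, of n "s + n + 2"] by (simp add: F_def E_def M_def)
    also have "\<dots> = mean (\<lambda>m. dot s (\<alpha>off m) (Gam (corrector n) m) - dot (s + n + 2) (residual n m) (Gam (corrector n) m))"
    proof -
      have "neg_gen UNIV (corrector n m) = (\<lambda>i j. \<alpha>off m i j - residual n m i j)" for m by (intro ext neg_gen_corrector)
      moreover have "dot (s + n + 2) (\<alpha>off m) d = dot s (\<alpha>off m) d" for m d
        by (rule dot_mono[OF \<alpha>off_props(3)]) simp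
      ultimately show ?thesis by (simp only: dot_diff_left)
    qed
    also have "\<dots> = mean (\<lambda>m. dot s (\<alpha>off m) (Gam (corrector n) m)) - ze"
      unfolding ze_def by (rule Bochner_Integration.integral_diff;
          intro integrable_continuous_disorder continuous_dot \<alpha>off_props cG local_fieldD(1)[OF residual_local])
    also have "mean (\<lambda>m. dot s (\<alpha>off m) (Gam (corrector n) m)) = \<theta> n"
      unfolding \<theta>_def by (rule Gam_symmetric[OF \<alpha>off_local corrector_local])
    finally show ?thesis .
  qed
  have diag: "4 * bd - 2 * lam * d2 = 2 / lam * (mean (\<lambda>m. (B m)\<^sup>2) - mean (\<lambda>m. (current_avg N m)\<^sup>2))"
  proof -
    have "4 * bd - 2 * lam * d2 = mean (\<lambda>m. 4 * (B m * current_fluct N m) - 2 * lam * (current_fluct N m)\<^sup>2)"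
      unfolding bd_def d2_def
      by (subst Bochner_Integration.integral_diff)
        (auto intro!: integrable_continuous_disorder continuous_intros cont_current_fluct cont_B)
    also have "(\<lambda>m. 4 * (B m * current_fluct N m) - 2 * lam * (current_fluct N m)\<^sup>2) = (\<lambda>m. 2 / lam * ((B m)\<^sup>2 - (current_avg N m)\<^sup>2))"
      using lam_pos by (intro ext) (simp add: current_fluct_def power2_eq_square field_simps)
    also have "mean \<dots> = 2 / lam * mean (\<lambda>m. (B m)\<^sup>2 - (current_avg N m)\<^sup>2)"
      by (rule integral_mult_right_zero)
    also have "mean (\<lambda>m. (B m)\<^sup>2 - (current_avg N m)\<^sup>2) = mean (\<lambda>m. (B m)\<^sup>2) - mean (\<lambda>m. (current_avg N m)\<^sup>2)"
      by (rule Bochner_Integration.integral_diff; intro integrable_continuous_disorder continuous_intros cont_B cont_current_avg)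
    finally show ?thesis .
  qed
  have "2 * pairing_star \<nu> \<phi> g - \<gamma> / 2 * E_star \<nu> (\<lambda>m \<omega>. (grad_flip_Gamma g m \<omega>)\<^sup>2)
         - lam / 2 * E_star \<nu> (\<lambda>m \<omega>. (grad_exch_Gamma g m \<omega>)\<^sup>2)
    = (4 * bd - 2 * lam * d2) + 4 * \<theta> n - 2 * (\<gamma> / 2 * F + lam / 2 * E)"
    unfolding p f e by (simp add: algebra_simps)
  also have "\<dots> = (4 * bd - 2 * lam * d2) + 2 * \<theta> n + 2 * ze"
    unfolding D by simp
  finally show ?thesis using remainder_bound[of n "s + n + 2"] unfolding diag ze_def by linarith
qed

text \<open>
  In the representation required by the class, the only diagonal coefficient is \<open>\<Psi> N\<close> at the index \<open>0\<close>.
\<close>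

lemma test_field_class_Q:
  assumes s: "0 < s"
  shows "(\<lambda>m. quad (s + n) (test_field N n m)) \<in> class_Q C"
proof -
  note g' = local_fieldD[OF corrector_local[of n]]
  define \<psi> where "\<psi> i j m = (if i = j then (if i = 0 then \<Psi> N m else 0) else corrector n m i j)" for i j m
  have sym: "\<forall>i j. \<psi> i j = \<psi> j i"
    using g'(2) by (auto simp: \<psi>_def symm_def fun_eq_iff)
  have d\<Psi>: "depends_on_box (2 * s + N) (\<Psi> N)"
    unfolding depends_on_box_def
  proof (intro ballI impI)
    fix m m' assume m: "m \<in> D" "m' \<in> D" "\<forall>x\<in>box (2 * s + N). m x = m' x"
    have "B (shift k m) = B (shift k m')" if "k \<in> box N" for k
    proof -
      have "depends_on_box (2 * s + N) (\<lambda>m. B (shift k m))" by (rule depends_on_box_shift[OF B_depends_on_box]) (use that in simp)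
      then show ?thesis using m unfolding depends_on_box_def by blast
    qed
    then have "(\<Sum>k\<in>box N. green N k * B (shift k m)) = (\<Sum>k\<in>box N. green N k * B (shift k m'))"
      by (intro sum.cong refl) (simp only:)
    then show "\<Psi> N m = \<Psi> N m'" unfolding \<Psi>_def by simp
  qed
  have reg: "\<forall>i j. continuous_on D (\<psi> i j) \<and> cylinder C (\<lambda>m _. \<psi> i j m)"
  proof (intro allI conjI)
    fix i j
    show "continuous_on D (\<psi> i j)"
      using contD[OF g'(1)] cont_\<Psi> by (cases "i = j"; cases "i = 0") (simp_all add: \<psi>_def[abs_def])
    have "depends_on_box (2 * s + N) (\<psi> i j)"
    proof (cases "i = j")
      case True
      show ?thesis
      proof (cases "i = 0")
        case i: True
        then have "\<psi> i j = \<Psi> N" using True by (simp add: \<psi>_def fun_eq_iff)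
        then show ?thesis using d\<Psi> by simp
      next
        case i: False
        then have "\<psi> i j = (\<lambda>_. 0)" using True by (simp add: \<psi>_def fun_eq_iff)
        then show ?thesis by (simp add: depends_on_box_def)
      qed
    next
      case False
      have "depends_on_box (2 * s + N) \<alpha>" by (rule depends_on_box_mono[OF dep]) simp
      then have "depends_on_box (2 * s + N) (\<lambda>m. neumann_sum n (off (\<alpha> m)) i j)" by (rule depends_on_box_compose)
      moreover have "\<psi> i j = (\<lambda>m. neumann_sum n (off (\<alpha> m)) i j)"
        using False by (simp add: \<psi>_def corrector_def \<alpha>off_def fun_eq_iff)
      ultimately show ?thesis by simp
    qed
    then show "cylinder C (\<lambda>m _. \<psi> i j m)" by (rule depends_on_box_cylinder)
  qed
  have inside: "i \<in> box (s + n) \<and> j \<in> box (s + n)" if "corrector n m i j \<noteq> 0" for m i j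
    using that g'(3)[of m] unfolding supported_def by simp
  have out: "\<psi> i j m = 0" if "(i, j) \<notin> box (s + n) \<times> box (s + n)" for i j m
    using that inside[of m i j] by (cases "i = j"; cases "i = 0") (auto simp: \<psi>_def)
  have fin: "finite {(i, j). \<exists>m\<in>D. \<psi> i j m \<noteq> 0}"
  proof (rule finite_subset)
    show "{(i, j). \<exists>m\<in>D. \<psi> i j m \<noteq> 0} \<subseteq> box (s + n) \<times> box (s + n)"
    proof
      fix p assume "p \<in> {(i, j). \<exists>m\<in>D. \<psi> i j m \<noteq> 0}"
      then obtain i j m where "p = (i, j)" "\<psi> i j m \<noteq> 0" by blast
      then show "p \<in> box (s + n) \<times> box (s + n)" using out[of i j m] by blast
    qed
  qed simp
  have rep: "quad (s + n) (test_field N n m) \<omega> = (\<Sum>\<^sub>\<infinity>i. \<psi> i i m * ((\<omega> (i + 1))\<^sup>2 - (\<omega> i)\<^sup>2))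
      + (\<Sum>\<^sub>\<infinity>(i, j)\<in>{(i, j). i \<noteq> j}. \<psi> i j m * \<omega> i * \<omega> j)" for m \<omega>
  proof -
    have "(\<Sum>\<^sub>\<infinity>i. \<psi> i i m * ((\<omega> (i + 1))\<^sup>2 - (\<omega> i)\<^sup>2)) = (\<Sum>i\<in>{0}. \<psi> i i m * ((\<omega> (i + 1))\<^sup>2 - (\<omega> i)\<^sup>2))"
      by (rule infsum_finite_support) (simp_all add: \<psi>_def)
    then have 1: "(\<Sum>\<^sub>\<infinity>i. \<psi> i i m * ((\<omega> (i + 1))\<^sup>2 - (\<omega> i)\<^sup>2)) = \<Psi> N m * ((\<omega> 1)\<^sup>2 - (\<omega> 0)\<^sup>2)"
      by (simp add: \<psi>_def)
    have "(\<Sum>\<^sub>\<infinity>(i, j)\<in>{(i, j). i \<noteq> j}. \<psi> i j m * \<omega> i * \<omega> j)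
        = infsum (\<lambda>p. off (test_field N n m) (fst p) (snd p) * (\<omega> (fst p) * \<omega> (snd p))) (box (s + n) \<times> box (s + n))"
      by (rule infsum_cong_neutral)
        (auto simp: off_def test_field_def \<psi>_def simp del: mem_box dest: inside)
    also have "\<dots> = dot (s + n) (off (test_field N n m)) (\<lambda>i j. \<omega> i * \<omega> j)"
      by (simp add: dot_def sum.cartesian_product case_prod_unfold)
    finally have 2: "(\<Sum>\<^sub>\<infinity>(i, j)\<in>{(i, j). i \<noteq> j}. \<psi> i j m * \<omega> i * \<omega> j) = dot (s + n) (off (test_field N n m)) (\<lambda>i j. \<omega> i * \<omega> j)" .
    have "(\<Sum>i\<in>box (s + n). test_field N n m i i * (\<omega> i * \<omega> i)) = (\<Sum>i\<in>{0, 1}. test_field N n m i i * (\<omega> i * \<omega> i))"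
      by (rule sum.mono_neutral_right) (use s in \<open>auto simp: test_field_def\<close>)
    also have "\<dots> = \<Psi> N m * ((\<omega> 1)\<^sup>2 - (\<omega> 0)\<^sup>2)"
      by (simp add: test_field_def power2_eq_square algebra_simps)
    finally show ?thesis
      unfolding 1 2 quad_dot by (simp add: dot_split[of "s + n" "test_field N n m"])
  qed
  show ?thesis
    unfolding class_Q_def mem_Collect_eq using sym reg fin rep by (intro exI[of _ \<psi>]) blast
qed

text \<open>
  Summation by parts against the linear function.
\<close>

lemma bracket_mean_B:
  assumes \<phi>: "\<And>m \<omega>. m \<in> D \<Longrightarrow> \<phi> m \<omega> = quad s (\<alpha> m) \<omega>"
  shows "bracket_star_star \<nu> \<phi> = 2 * mean B"
proof -
  have "(\<Sum>x\<in>box s. of_int x * \<alpha> m x x) = (\<Sum>i\<in>box s. primitive m i)" for m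
    using sum_by_parts[of "primitive m" s "of_int"] by (simp add: \<alpha>_diag primitive_zero)
  then have "bracket_star_star \<nu> \<phi> = 2 * mean (\<lambda>m. \<Sum>i\<in>box s. primitive m i)"
    using bracket_star_star_quad[OF \<alpha>_local trace \<phi>] by simp
  also have "mean (\<lambda>m. \<Sum>i\<in>box s. primitive m i) = (\<Sum>i\<in>box s. mean (\<lambda>m. primitive m i))"
    by (intro mean_sum cont_primitive)
  also have "\<dots> = (\<Sum>i\<in>box s. mean (\<lambda>m. primitive (shift (- i) m) i))"
    by (intro sum.cong refl mean_shift[symmetric, of "\<lambda>m. primitive m _"] cont_primitive)
  also have "\<dots> = mean B"
    unfolding B_def[abs_def] by (intro mean_sum[symmetric] continuous_shift[of "\<lambda>m. primitive m _"] cont_primitive)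
  finally show ?thesis .
qed

section \<open>Comparison of the two bounds\<close>

lemma cube_geometric_tendsto: "(\<lambda>n. (2 * real (s + n) + 1) ^ 3 * r ^ n) \<longlonglongrightarrow> 0"
proof -
  have r: "0 < r" "r < 1" using r_bounds lam_pos \<gamma>_pos by (simp_all add: r_def)
  \<comment> \<open>the cube of the null sequence \<open>n * q ^ n\<close> absorbs the third power\<close>
  define q where "q = root 3 r"
  have q: "0 < q" "q < 1" "q ^ 3 = r"
    using r by (simp_all add: q_def)
  have "(\<lambda>n. real n * q ^ n) \<longlonglongrightarrow> 0" by (rule powser_times_n_limit_0) (use q in simp)
  from tendsto_power[OF this, of 3] have "(\<lambda>n. (real n * q ^ n) ^ 3) \<longlonglongrightarrow> 0" by simp
  from tendsto_mult_left[OF this, of "(2 * real s + 3) ^ 3"]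
  have lim: "(\<lambda>n. (2 * real s + 3) ^ 3 * (real n * q ^ n) ^ 3) \<longlonglongrightarrow> 0" by simp
  show ?thesis
  proof (rule tendsto_sandwich[OF _ _ tendsto_const lim])
    show "\<forall>\<^sub>F n in sequentially. 0 \<le> (2 * real (s + n) + 1) ^ 3 * r ^ n" using r by simp
    show "\<forall>\<^sub>F n in sequentially. (2 * real (s + n) + 1) ^ 3 * r ^ n \<le> (2 * real s + 3) ^ 3 * (real n * q ^ n) ^ 3"
      using eventually_ge_at_top[of 1]
    proof eventually_elim
      case (elim n)
      have "2 * real (s + n) + 1 \<le> (2 * real s + 3) * real n"
      proof -
        have "2 * real s * 1 \<le> 2 * real s * real n" using elim by (intro mult_left_mono) auto
        moreover have "1 \<le> real n" using elim by simp
        ultimately show ?thesis by (simp add: algebra_simps)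
      qed
      then have "(2 * real (s + n) + 1) ^ 3 \<le> ((2 * real s + 3) * real n) ^ 3" by (intro power_mono) auto
      then have "(2 * real (s + n) + 1) ^ 3 * r ^ n \<le> ((2 * real s + 3) * real n) ^ 3 * r ^ n"
        using r by (intro mult_right_mono) auto
      moreover have "r ^ n = (q ^ n) ^ 3" unfolding q(3)[symmetric] by (simp only: power_mult[symmetric] mult.commute)
      ultimately show ?case by (simp only: power_mult_distrib mult.assoc)
    qed
  qed
qed

lemma errors_tendsto: "(\<lambda>n. 2 * \<epsilon> n + 2 * \<eta> n) \<longlonglongrightarrow> 0"
proof -
  have "(\<lambda>n. (2 * K0 * (K0 / (4 * \<gamma>))) * ((2 * real (s + n) + 1) ^ 3 * r ^ n)) \<longlonglongrightarrow> 0"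
    by (rule tendsto_mult_right_zero[OF cube_geometric_tendsto])
  then have e: "(\<lambda>n. 2 * \<eta> n) \<longlonglongrightarrow> 0"
    by (simp add: \<eta>_def power2_eq_square power3_eq_cube mult_ac)
  have "(\<lambda>n. (2 * K0 * (Kb / (4 * \<gamma>))) * ((2 * real (s + n) + 1) ^ 3 * r ^ n)) \<longlonglongrightarrow> 0"
    by (rule tendsto_mult_right_zero[OF cube_geometric_tendsto])
  then have "(\<lambda>n. 2 * \<epsilon> n) \<longlonglongrightarrow> 0"
  proof (rule tendsto_sandwich[OF _ _ tendsto_const, rotated 2])
    have nn: "0 \<le> K0 * (Kb / (4 * \<gamma>)) * r ^ n" for n
      using K0_nonneg Kb_nonneg \<gamma>_pos r_bounds by simp
    show "\<forall>\<^sub>F n in sequentially. 0 \<le> 2 * \<epsilon> n"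
      using K0_nonneg Kb_nonneg \<gamma>_pos r_bounds by (simp add: \<epsilon>_def)
    show "\<forall>\<^sub>F n in sequentially. 2 * \<epsilon> n \<le> (2 * K0 * (Kb / (4 * \<gamma>))) * ((2 * real (s + n) + 1) ^ 3 * r ^ n)"
    proof (intro always_eventually allI)
      fix n
      have "(2 * real (s + n) + 1) ^ 2 \<le> (2 * real (s + n) + 1) ^ 3" by (rule power_increasing) auto
      then have "(K0 * (Kb / (4 * \<gamma>)) * r ^ n) * (2 * real (s + n) + 1) ^ 2 \<le> (K0 * (Kb / (4 * \<gamma>)) * r ^ n) * (2 * real (s + n) + 1) ^ 3"
        by (rule mult_left_mono) (rule nn)
      then show "2 * \<epsilon> n \<le> (2 * K0 * (Kb / (4 * \<gamma>))) * ((2 * real (s + n) + 1) ^ 3 * r ^ n)"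
        by (simp add: \<epsilon>_def mult_ac)
    qed
  qed
  from tendsto_add[OF this e] show ?thesis by simp
qed

text \<open>
  The two bounds differ by \<open>2 * \<epsilon> n + 2 * \<eta> n\<close> and by the variance of \<open>current_avg N\<close>, which are made
  small by the choice of \<open>n\<close> and \<open>N\<close>.
\<close>

theorem limsup_le_triple_norm:
  assumes s: "0 < s" and \<phi>: "\<And>m \<omega>. m \<in> D \<Longrightarrow> \<phi> m \<omega> = quad s (\<alpha> m) \<omega>"
  shows "limsup (\<lambda>l. ereal (1 / (2 * real l) * E_star \<nu> (\<lambda>m \<omega>.
      neg_generator_inv \<nu> \<gamma> lam l (translate_sum (int l - int s - 1) \<phi>) m \<omega>
        * translate_sum (int l - int s - 1) \<phi> m \<omega>))) \<le> triple_norm_sq C \<nu> \<gamma> lam \<phi>" (is "limsup (\<lambda>l. ereal (?X l)) \<le> ?T")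
proof (rule ereal_le_epsilon2)
  fix e :: real assume e: "0 < e"
  define W where "W n = 2 / lam * mean (\<lambda>m. (B m)\<^sup>2) + 2 * (\<theta> n + \<epsilon> n)" for n
  define V where "V N n = 2 / lam * (mean (\<lambda>m. (B m)\<^sup>2) - mean (\<lambda>m. (current_avg N m)\<^sup>2)) + 2 * \<theta> n - 2 * \<eta> n" for N n
  have upper: "limsup (\<lambda>l. ereal (?X l)) \<le> ereal (W n)" for n
  proof -
    obtain K where K: "\<And>l. l \<ge> 3 * s + n + 1 \<Longrightarrow> E_star \<nu> (\<lambda>m \<omega>.
        neg_generator_inv \<nu> \<gamma> lam l (translate_sum (int l - int s - 1) \<phi>) m \<omega>
          * translate_sum (int l - int s - 1) \<phi> m \<omega>) \<le> 2 * real l * W n + K"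
      using resolvent_upper_bound[OF \<phi>, of n] unfolding W_def by blast
    have "\<forall>\<^sub>F l in sequentially. ereal (?X l) \<le> ereal (W n + K / 2 * (1 / real l))"
      using eventually_ge_at_top[of "3 * s + n + 1"]
    proof eventually_elim
      case (elim l)
      then have l: "real l > 0" by simp
      have "?X l \<le> 1 / (2 * real l) * (2 * real l * W n + K)"
        by (rule mult_left_mono[OF K[OF elim]]) simp
      also have "\<dots> = W n + K / 2 * (1 / real l)" using l by (simp add: field_simps)
      finally show ?case by simp
    qed
    then have "limsup (\<lambda>l. ereal (?X l)) \<le> limsup (\<lambda>l. ereal (W n + K / 2 * (1 / real l)))"
      by (rule Limsup_mono)
    also have "\<dots> = ereal (W n)"
    proof (rule lim_imp_Limsup)
      have "(\<lambda>l. W n + K / 2 * (1 / real l)) \<longlonglongrightarrow> W n + K / 2 * 0"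
        by (intro tendsto_intros lim_1_over_n)
      then show "(\<lambda>l. ereal (W n + K / 2 * (1 / real l))) \<longlonglongrightarrow> ereal (W n)" by simp
    qed simp
    finally show ?thesis .
  qed
  have lower: "ereal (V N n + 2 / lam * (mean B)\<^sup>2) \<le> ?T" for N n
  proof -
    let ?g = "\<lambda>m. quad (s + n) (test_field N n m)"
    let ?V = "\<lambda>g. 2 * pairing_star \<nu> \<phi> g - \<gamma> / 2 * E_star \<nu> (\<lambda>m \<omega>. (grad_flip_Gamma g m \<omega>)\<^sup>2)
         - lam / 2 * E_star \<nu> (\<lambda>m \<omega>. (grad_exch_Gamma g m \<omega>)\<^sup>2)"
    have "ereal (V N n) \<le> ereal (?V ?g)"
      using functional_test_field[OF s \<phi>, where n = n and N = N] by (simp add: V_def)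
    also have "\<dots> \<le> (SUP g\<in>class_Q C. ereal (?V g))"
      by (rule SUP_upper[OF test_field_class_Q[OF s]])
    finally have "ereal (V N n) + ereal (1 / (lam * chi_1) * (bracket_star_star \<nu> \<phi>)\<^sup>2) \<le> ?T"
      unfolding triple_norm_sq_def by (rule add_right_mono)
    moreover have "1 / (lam * chi_1) * (bracket_star_star \<nu> \<phi>)\<^sup>2 = 2 / lam * (mean B)\<^sup>2"
      using lam_pos by (simp add: chi_1_def bracket_mean_B[OF \<phi>] power2_eq_square)
    ultimately show ?thesis by simp
  qed
  obtain n where n: "2 * \<epsilon> n + 2 * \<eta> n < e / 2"
  proof -
    have "\<forall>\<^sub>F n in sequentially. 2 * \<epsilon> n + 2 * \<eta> n < e / 2"
      using order_tendstoD(2)[OF errors_tendsto, of "e / 2"] e by simp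
    then show thesis using that by (auto simp: eventually_sequentially)
  qed
  define c where "c = 2 / lam * ((8 * real s + 1) * KB\<^sup>2)"
  obtain N :: nat where N: "c / (2 * real N + 1) < e / 2"
  proof -
    obtain N :: nat where "real N > 2 * c / e" using reals_Archimedean2 by blast
    then have "2 * c < real N * e" using e by (simp add: field_simps)
    also have "\<dots> \<le> (2 * real N + 1) * e" using e by (simp add: algebra_simps)
    finally have "c / (2 * real N + 1) < e / 2" by (simp add: field_simps)
    then show thesis by (rule that)
  qed
  have "2 / lam * mean (\<lambda>m. (current_avg N m)\<^sup>2) \<le> 2 / lam * ((mean B)\<^sup>2 + (8 * real s + 1) * KB\<^sup>2 / (2 * real N + 1))"
    using lam_pos by (intro mult_left_mono mean_current_avg_sq) simp
  also have "\<dots> = 2 / lam * (mean B)\<^sup>2 + c / (2 * real N + 1)"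
    by (simp add: c_def distrib_left)
  finally have a: "2 / lam * mean (\<lambda>m. (current_avg N m)\<^sup>2) \<le> 2 / lam * (mean B)\<^sup>2 + c / (2 * real N + 1)" .
  have "W n \<le> (V N n + 2 / lam * (mean B)\<^sup>2) + e"
  proof -
    have "p + 2 * (t + x) \<le> p - q + 2 * t - 2 * y + b + e"
      if "q \<le> b + z" "2 * x + 2 * y < e / 2" "z < e / 2" for p q b t x y z :: real
      using that by (simp add: algebra_simps)
    from this[OF a n N] show ?thesis unfolding W_def V_def right_diff_distrib .
  qed
  then have "ereal (W n) \<le> ereal (V N n + 2 / lam * (mean B)\<^sup>2) + ereal e" by simp
  also have "\<dots> \<le> ?T + ereal e" by (rule add_right_mono[OF lower])
  finally show "limsup (\<lambda>l. ereal (?X l)) \<le> ?T + ereal e" using upper[of n] by (rule order_trans[rotated])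
qed

end

theorem lemma4p3:
  fixes lam \<gamma> C :: real and \<nu> :: "real measure" and \<phi> :: observable
  assumes "lam > 0" and "\<gamma> > 0" and "C > 1"
    and "site_law C \<nu>"
    and "\<phi> \<in> class_Q0 C \<nu>"
  shows "limsup (\<lambda>l :: nat.
           let l\<phi> = int l - int (cyl_radius C \<phi>) - 1;
               \<Phi> = translate_sum l\<phi> \<phi>
           in ereal (1 / (2 * real l) *
                E_star \<nu> (\<lambda>m \<omega>. neg_generator_inv \<nu> \<gamma> lam l \<Phi> m \<omega> * \<Phi> m \<omega>)))
         \<le> triple_norm_sq C \<nu> \<gamma> lam \<phi>"
proof -
  interpret model C \<nu> \<gamma> lam by unfold_locales (use assms in auto)
  obtain \<alpha> where \<alpha>: "local_field (cyl_radius C \<phi>) \<alpha>" "depends_on_box (cyl_radius C \<phi>) \<alpha>"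
    "\<And>m. (\<Sum>i\<in>box (cyl_radius C \<phi>). \<alpha> m i i) = 0"
    "\<And>m \<omega>. m \<in> D \<Longrightarrow> \<phi> m \<omega> = quad (cyl_radius C \<phi>) (\<alpha> m) \<omega>"
    using class_Q0_coefficients[OF assms(5)] by blast
  obtain K where K: "\<And>m i j. m \<in> D \<Longrightarrow> \<bar>\<alpha> m i j\<bar> \<le> K"
    using local_field_bounded[OF \<alpha>(1)] by blast
  interpret coefficients C \<nu> \<gamma> lam "cyl_radius C \<phi>" \<alpha> K
    by unfold_locales (use \<alpha> K in auto)
  show ?thesis
    using limsup_le_triple_norm[OF class_Q0_cyl_radius(1)[OF assms(5)] \<alpha>(4)] by (simp add: Let_def)
qed

end
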